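(* Let $n\ge 2$. Any singular linear form $\rho: CS_{\rm c.c}(\mathbb R^n)\to\mathbb C$ which satisfies Stokes' property is proportional to the noncommutative residue, i.e. $\rho=c\cdot{\rm res}$ for some constant $c\in\mathbb C$. Equivalently, any closed singular linear form $\widetilde\rho:\Omega CS_{\rm c.c}(\mathbb R^n)\to\mathbb C$ (the extension to forms of a singular linear form $\rho$) is proportional to the residue extended to forms, i.e. $\widetilde\rho=c\cdot\widetilde{\rm res}$ for some constant $c$.
   Context: For $a\in\mathbb C$, $\mathcal S^a_{\rm c.c}(\mathbb R^n)$ is the set of smooth functions $\sigma$ on $\mathbb R^n$ with $|\partial_\xi^\beta\sigma(\xi)|\le C_\beta(1+|\xi|)^{{\rm Re}(a)-|\beta|}$ for all multiindices $\beta$. $CS^a_{\rm c.c}(\mathbb R^n)$ (classical symbols of order $a$ with constant coefficients) is the set of $\sigma\in\mathcal S^a_{\rm c.c}(\mathbb R^n)$ such that for every $N$, $\sigma=\sum_{j=0}^{N-1}\chi\,\sigma_{a-j}+\sigma_{(N)}$ with $\sigma_{(N)}\in\mathcal S^{a-N}_{\rm c.c}(\mathbb R^n)$, $\sigma_{a-j}$ smooth on $\mathbb R^n\setminus\{0\}$ and positively homogeneous of degree $a-j$, and $\chi$ a smooth cut-off function vanishing near $0$ and equal to $1$ outside the unit ball. $CS_{\rm c.c}(\mathbb R^n)$ is the algebra generated by $\bigcup_{a\in\mathbb C}CS^a_{\rm c.c}(\mathbb R^n)$, and $CS^{-\infty}_{\rm c.c}(\mathbb R^n)=\bigcap_a CS^a_{\rm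 c.c}(\mathbb R^n)$ is the set of smoothing symbols. Noncommutative residue: ${\rm res}(\sigma)=(2\pi)^{-n/2}\int_{S^{n-1}}\sigma_{-n}(\xi)\,d\mu_S(\xi)$, where $\sigma_{-n}$ is the homogeneous component of degree $-n$ (zero if there is none, extended linearly) and $d\mu_S$ is the standard volume measure on $S^{n-1}$. A linear form $\rho$ is singular if it vanishes on smoothing symbols. It satisfies Stokes' property (is closed) if $\rho(\partial_j\tau)=0$ for all $j\in\{1,\dots,n\}$ and all $\tau\in CS_{\rm c.c}(\mathbb R^n)$. Forms: $\Omega^kCS_{\rm c.c}(\mathbb R^n)$ is the set of $k$-forms $\sum_{|I|=k}\alpha_I(\xi)\,d\xi_I$ with $\alpha_I\in CS_{\rm c.c}(\mathbb R^n)$, and $\Omega CS_{\rm c.c}(\mathbb R^n)=\bigoplus_k\Omega^kCS_{\rm c.c}(\mathbb R^n)$, with the usual exterior differential $d$. A linear form $\rho$ extends to forms by $\widetilde\rho(\alpha\,d\xi_{i_1}\wedge\cdots\wedge d\xi_{i_k})=\rho(\alpha)$ if $k=n$ and $0$ if $k<n$ (for $i_1<\cdots<i_k$). $\widetilde\rho$ is closed if $\widetilde\rho(d\beta)=0$ for all symbol valued forms $\beta$; it is called singular if $\rho$ is. *)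

theory Defs
  imports "HOL-Analysis.Analysis" "HOL-Library.Multiset"
begin

(* R^n is real^'n; the index type is linearly ordered because the sign convention for
   exterior forms refers to i_1 < ... < i_k. *)

definition pderiv_at :: "'n::finite \<Rightarrow> (real^'n \<Rightarrow> 'b::real_normed_vector) \<Rightarrow> real^'n \<Rightarrow> 'b"
  where "pderiv_at i f x = frechet_derivative f (at x) (axis i 1)"

primrec iter_pderiv ::
    "'n::finite list \<Rightarrow> (real^'n \<Rightarrow> 'b::real_normed_vector) \<Rightarrow> real^'n \<Rightarrow> 'b"
  where
    "iter_pderiv [] f = f"
  | "iter_pderiv (i # js) f = pderiv_at i (iter_pderiv js f)"

(* Used for open S only.  Differentiability of all iterated partial derivatives includes their
   continuity, so this is the class C^infinity. *)
definition smooth_on :: "(real^'n::finite) set \<Rightarrow> (real^'n \<Rightarrow> 'b::real_normed_vector) \<Rightarrow> bool"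
  where "smooth_on S f \<longleftrightarrow> (\<forall>js. \<forall>x\<in>S. iter_pderiv js f differentiable (at x))"

(* A multiindex is a multiset over the index type: its i-th entry is count \<beta> i, and its
   length |\<beta>| is size \<beta>. *)
definition multi_pderiv ::
    "'n::{finite,linorder} multiset \<Rightarrow> (real^'n::{finite,linorder} \<Rightarrow> 'b::real_normed_vector) \<Rightarrow> real^'n::{finite,linorder} \<Rightarrow> 'b"
  where "multi_pderiv \<beta> f = iter_pderiv (sorted_list_of_multiset \<beta>) f"

definition symbols :: "complex \<Rightarrow> (real^'n::{finite,linorder} \<Rightarrow> complex) set"
  where "symbols a =
    {\<sigma>. smooth_on UNIV \<sigma> \<and>
        (\<forall>\<beta>. \<exists>C. \<forall>\<xi>. norm (multi_pderiv \<beta> \<sigma> \<xi>)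
                        \<le> C * (1 + norm \<xi>) powr (Re a - real (size \<beta>)))}"

definition cutoff :: "(real^'n::finite \<Rightarrow> real) \<Rightarrow> bool"
  where "cutoff \<psi> \<longleftrightarrow> smooth_on UNIV \<psi> \<and> (\<forall>\<^sub>F \<xi> in nhds 0. \<psi> \<xi> = 0) \<and> (\<forall>\<xi>. norm \<xi> \<ge> 1 \<longrightarrow> \<psi> \<xi> = 1)"

definition pos_homogeneous :: "complex \<Rightarrow> (real^'n::finite \<Rightarrow> complex) \<Rightarrow> bool"
  where "pos_homogeneous b f \<longleftrightarrow>
    (\<forall>t>0. \<forall>\<xi>. \<xi> \<noteq> 0 \<longrightarrow> f (t *\<^sub>R \<xi>) = complex_of_real t powr b * f \<xi>)"

(* h j is the component of degree a - j. *)
definition classical_expansion ::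
    "complex \<Rightarrow> (nat \<Rightarrow> real^'n::{finite,linorder} \<Rightarrow> complex) \<Rightarrow> (real^'n::{finite,linorder} \<Rightarrow> complex) \<Rightarrow> bool"
  where "classical_expansion a h \<sigma> \<longleftrightarrow>
    (\<forall>j. smooth_on (- {0}) (h j) \<and> pos_homogeneous (a - of_nat j) (h j)) \<and>
    (\<exists>\<psi>. cutoff \<psi> \<and>
         (\<forall>N. (\<lambda>\<xi>. \<sigma> \<xi> - (\<Sum>j<N. complex_of_real (\<psi> \<xi>) * h j \<xi>)) \<in> symbols (a - of_nat N)))"

definition CS_order :: "complex \<Rightarrow> (real^'n::{finite,linorder} \<Rightarrow> complex) set"
  where "CS_order a = {\<sigma> \<in> symbols a. \<exists>h. classical_expansion a h \<sigma>}"

inductive_set CS :: "(real^'n::{finite,linorder} \<Rightarrow> complex) set"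
  where
    CS_base: "\<sigma> \<in> CS_order a \<Longrightarrow> \<sigma> \<in> CS"
  | CS_add: "\<sigma> \<in> CS \<Longrightarrow> \<tau> \<in> CS \<Longrightarrow> (\<lambda>\<xi>. \<sigma> \<xi> + \<tau> \<xi>) \<in> CS"
  | CS_scale: "\<sigma> \<in> CS \<Longrightarrow> (\<lambda>\<xi>. c * \<sigma> \<xi>) \<in> CS"
  | CS_mult: "\<sigma> \<in> CS \<Longrightarrow> \<tau> \<in> CS \<Longrightarrow> (\<lambda>\<xi>. \<sigma> \<xi> * \<tau> \<xi>) \<in> CS"

definition CS_smoothing :: "(real^'n::{finite,linorder} \<Rightarrow> complex) set"
  where "CS_smoothing = (\<Inter>a. CS_order a)"

(* The standard volume measure of the unit sphere, by polar coordinates: the volume of A is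
   n times the Lebesgue measure of the cone {t * \<omega> | 0 < t < 1, \<omega> in A}. *)
definition sphere_measure :: "(real^'n::finite) measure"
  where "sphere_measure =
    scale_measure (of_nat CARD('n))
      (distr (restrict_space lborel (ball 0 1 - {0})) (restrict_space borel (sphere 0 1)) sgn)"

definition component ::
    "complex \<Rightarrow> (nat \<Rightarrow> real^'n::finite \<Rightarrow> complex) \<Rightarrow> complex \<Rightarrow> real^'n \<Rightarrow> complex"
  where "component a h b =
    (if \<exists>j. a - of_nat j = b then h (THE j. a - of_nat j = b) else (\<lambda>_. 0))"

(* The residue of a classical symbol, extended linearly to sums of classical symbols of
   different orders.  The value does not depend on the decomposition, because positively
   homogeneous functions of distinct complex degrees are asymptotically independent. *)
inductive has_residue :: "(real^'n::{finite,linorder} \<Rightarrow> complex) \<Rightarrow> complex \<Rightarrow> bool"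
  where
    has_residue_classical:
      "\<sigma> \<in> CS_order a \<Longrightarrow> classical_expansion a h \<sigma> \<Longrightarrow>
       has_residue \<sigma>
         (complex_of_real ((2 * pi) powr (- real CARD('n) / 2)) *
          (LINT \<xi>|sphere_measure. component a h (- of_nat CARD('n)) \<xi>))"
  | has_residue_add:
      "has_residue \<sigma> r \<Longrightarrow> has_residue \<tau> s \<Longrightarrow> has_residue (\<lambda>\<xi>. \<sigma> \<xi> + \<tau> \<xi>) (r + s)"
  | has_residue_scale:
      "has_residue \<sigma> r \<Longrightarrow> has_residue (\<lambda>\<xi>. c * \<sigma> \<xi>) (c * r)"

definition res :: "(real^'n::{finite,linorder} \<Rightarrow> complex) \<Rightarrow> complex"
  where "res \<sigma> = (THE r. has_residue \<sigma> r)"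

definition linear_form :: "((real^'n::{finite,linorder} \<Rightarrow> complex) \<Rightarrow> complex) \<Rightarrow> bool"
  where "linear_form \<rho> \<longleftrightarrow>
    (\<forall>\<sigma>\<in>CS. \<forall>\<tau>\<in>CS. \<rho> (\<lambda>\<xi>. \<sigma> \<xi> + \<tau> \<xi>) = \<rho> \<sigma> + \<rho> \<tau>) \<and>
    (\<forall>c. \<forall>\<sigma>\<in>CS. \<rho> (\<lambda>\<xi>. c * \<sigma> \<xi>) = c * \<rho> \<sigma>)"

definition singular_form :: "((real^'n::{finite,linorder} \<Rightarrow> complex) \<Rightarrow> complex) \<Rightarrow> bool"
  where "singular_form \<rho> \<longleftrightarrow> (\<forall>\<sigma>\<in>CS_smoothing. \<rho> \<sigma> = 0)"

definition stokes :: "((real^'n::{finite,linorder} \<Rightarrow> complex) \<Rightarrow> complex) \<Rightarrow> bool"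
  where "stokes \<rho> \<longleftrightarrow> (\<forall>j. \<forall>\<tau>\<in>CS. \<rho> (pderiv_at j \<tau>) = 0)"

(* The form \<Sum>_I \<alpha>_I d\<xi>_I, with I ranging over all sets of indices and d\<xi>_I the wedge product in
   increasing order, is the coefficient family I \<mapsto> \<alpha>_I; its part of degree k is the restriction to
   card I = k. *)
type_synonym 'n form = "'n set \<Rightarrow> real^'n \<Rightarrow> complex"

definition symbol_forms :: "'n::{finite,linorder} form set"
  where "symbol_forms = {\<beta>. \<forall>I. \<beta> I \<in> CS}"

(* d\<xi>_i \<and> d\<xi>_I = (-1)^(number of j in I with j < i) d\<xi>_(insert i I) for i not in I. *)
definition ext_deriv :: "'n::{finite,linorder} form \<Rightarrow> 'n form"
  where "ext_deriv \<beta> J \<xi> =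
    (\<Sum>i\<in>J. (-1) ^ card {j\<in>J. j < i} * pderiv_at i (\<beta> (J - {i})) \<xi>)"

definition extend_to_forms ::
    "((real^'n::{finite,linorder} \<Rightarrow> complex) \<Rightarrow> complex) \<Rightarrow> 'n form \<Rightarrow> complex"
  where "extend_to_forms \<rho> \<beta> = \<rho> (\<beta> UNIV)"

definition closed_on_forms :: "('n::{finite,linorder} form \<Rightarrow> complex) \<Rightarrow> bool"
  where "closed_on_forms T \<longleftrightarrow> (\<forall>\<beta>\<in>symbol_forms. T (ext_deriv \<beta>) = 0)"

end

theory Submission
  imports Defs
begin

text \<open>
  Let \<open>\<rho>\<close> be a closed singular linear form and \<open>n\<close> the dimension. The proof evaluates \<open>\<rho>\<close> on the
  pieces \<open>\<sigma> = \<Sum>\<^sub>j \<psi> \<sigma>\<^sub>a\<^sub>-\<^sub>j + \<sigma>\<^sub>(\<^sub>N\<^sub>)\<close> of a classical symbol, where \<open>\<psi>\<close> is a cutoff.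

  A component \<open>h\<close> of degree \<open>b \<noteq> -n\<close> satisfies Euler's equation, so \<open>(n + b) h\<close> is the divergence of
  the field \<open>\<xi> h(\<xi>)\<close>; the derivatives of \<open>\<psi>\<close> contribute a function of bounded support, which is
  smoothing. Hence \<open>\<rho> (\<psi> h) = 0\<close> (\<open>\<rho>_noncritical_component\<close>). For a symbol \<open>\<sigma>\<close> of sufficiently low
  order, the same idea works on the whole symbol: \<open>u(\<xi>) = \<integral>\<^sub>0\<^sup>1 t\<^sup>n\<^sup>-\<^sup>1 \<sigma>(t \<xi>) dt\<close> is smooth and \<open>\<sigma>\<close> is the
  divergence of \<open>\<xi> u(\<xi>)\<close>. Moreover \<open>u\<close> lies in the symbol algebra: the integral over all \<open>t > 0\<close> is
  homogeneous of degree \<open>-n\<close>, and the integral over \<open>t > 1\<close> has an expansion that is computed term by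
  term. Thus \<open>\<rho>\<close> kills all remainders of low order (\<open>\<rho>_low_order\<close>).

  There remain the components of degree \<open>-n\<close>. On them \<open>\<rho>\<close> is studied through the map that sends a test
  function \<open>\<phi>\<close> on the whole space to \<open>\<integral>\<^sub>0\<^sup>\<infinity> t\<^sup>n\<^sup>-\<^sup>1 \<phi>(t \<xi>) dt\<close>, a homogeneous function of degree \<open>-n\<close>. It
  sends \<open>\<partial>\<^sub>i \<phi>\<close> to the \<open>i\<close>-th derivative of \<open>\<integral>\<^sub>0\<^sup>\<infinity> t\<^sup>n\<^sup>-\<^sup>2 \<phi>(t \<xi>) dt\<close>, which makes sense because \<open>n \<ge> 2\<close>; so
  the composition with \<open>\<rho>\<close> is a linear functional \<open>L\<close> on test functions that vanishes on derivatives
  (\<open>ray_form_pderiv\<close>). For two test functions, \<open>\<theta> \<star> \<phi> - (\<integral> \<theta>) \<phi>\<close> is a divergence of test functions, so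
  \<open>L(\<theta> \<star> \<phi>) = (\<integral> \<theta>) L(\<phi>)\<close>, and the commutativity of the convolution shows that \<open>L\<close> is proportional to
  the integral (\<open>closed_functional_proportional_to_integral\<close>). This replaces the study of the top
  cohomology of the sphere. Finally every homogeneous \<open>h\<close> of degree \<open>-n\<close> is the image of the test
  function \<open>q h\<close>, where \<open>q\<close> is the radial derivative \<open>\<Sum>\<^sub>i \<xi>\<^sub>i \<partial>\<^sub>i \<psi>\<close>, and polar coordinates give
  \<open>\<integral> q h = \<integral>\<^sub>S h\<close> (\<open>ray_integral_radial_slope\<close>, \<open>integral_radial_slope\<close>). So \<open>\<rho> (\<psi> h)\<close> is a constant
  times the integral of \<open>h\<close> over the sphere.

  That the residue is a function at all rests on the asymptotic independence of the powers \<open>t\<^sup>b\<close> with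
  distinct complex exponents (\<open>powers_asymptotically_independent\<close>). Closedness on forms is Stokes'
  property tested on the forms with a single coefficient in degree \<open>n - 1\<close>.
\<close>

section \<open>Iterated partial derivatives\<close>

lemma pderiv_at_eqI:
  assumes "(f has_derivative D) (at x)"
  shows "pderiv_at i f x = D (axis i 1)"
  using frechet_derivative_at[OF assms] by (simp add: pderiv_at_def)

lemma has_derivative_pderiv_sum:
  fixes f :: "real^'n::finite \<Rightarrow> 'b::real_normed_vector"
  assumes "f differentiable (at x)"
  shows "(f has_derivative (\<lambda>v. \<Sum>i\<in>UNIV. (v $ i) *\<^sub>R pderiv_at i f x)) (at x)"
proof -
  have d: "(f has_derivative frechet_derivative f (at x)) (at x)"
    using assms by (simp add: frechet_derivative_works)
  interpret L: linear "frechet_derivative f (at x)"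
    using d has_derivative_linear by blast
  have "frechet_derivative f (at x) v = (\<Sum>i\<in>UNIV. (v $ i) *\<^sub>R pderiv_at i f x)" for v
  proof -
    have "frechet_derivative f (at x) v = frechet_derivative f (at x) (\<Sum>i\<in>UNIV. (v $ i) *\<^sub>R axis i 1)"
      using basis_expansion[of v] by (simp add: scalar_mult_eq_scaleR)
    also have "\<dots> = (\<Sum>i\<in>UNIV. (v $ i) *\<^sub>R pderiv_at i f x)"
      by (simp add: L.sum L.scale pderiv_at_def)
    finally show ?thesis .
  qed
  then show ?thesis using d by (metis (no_types, lifting) ext)
qed

lemma iter_pderiv_append: "iter_pderiv (js @ ks) f = iter_pderiv js (iter_pderiv ks f)"
  by (induction js) auto

lemma pderiv_at_cong_open:
  assumes "open S" "x \<in> S" "\<And>y. y \<in> S \<Longrightarrow> f y = g y"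
  shows "pderiv_at i f x = pderiv_at i g x"
proof -
  have "(f has_derivative D) (at x) \<longleftrightarrow> (g has_derivative D) (at x)" for D
    using assms by (intro iffI; elim has_derivative_transform_within_open[of _ _ _ _ S]) auto
  then show ?thesis by (simp add: pderiv_at_def frechet_derivative_def)
qed

lemma iter_pderiv_cong_open:
  assumes "open S" "\<And>y. y \<in> S \<Longrightarrow> f y = g y" "x \<in> S"
  shows "iter_pderiv js f x = iter_pderiv js g x"
  using assms(3)
proof (induction js arbitrary: x)
  case (Cons i js)
  then show ?case using pderiv_at_cong_open[OF assms(1) Cons.prems, of "iter_pderiv js f" "iter_pderiv js g"] by simp
qed (use assms in auto)

lemma differentiable_cong_open:
  assumes "open S" "\<And>y. y \<in> S \<Longrightarrow> f y = g y" "x \<in> S" "f differentiable (at x)"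
  shows "g differentiable (at x)"
  using assms by (meson differentiable_def has_derivative_transform_within_open)

text \<open>Closure properties of smooth functions are proved by induction on this order: a derivative of a
  product is not a product but a sum of two, so the induction must not be on the list of derivatives.\<close>
primrec times_differentiable :: "nat \<Rightarrow> (real^'n::finite) set \<Rightarrow> (real^'n \<Rightarrow> 'b::real_normed_vector) \<Rightarrow> bool"
  where
    "times_differentiable 0 S f \<longleftrightarrow> True"
  | "times_differentiable (Suc k) S f \<longleftrightarrow>
      (\<forall>x\<in>S. f differentiable (at x)) \<and> (\<forall>i. times_differentiable k S (pderiv_at i f))"

lemma times_differentiable_iff:
  "times_differentiable k S f \<longleftrightarrow>
    (\<forall>js. length js < k \<longrightarrow> (\<forall>x\<in>S. iter_pderiv js f differentiable (at x)))"
proof (induction k arbitrary: f)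
  case (Suc k)
  have "(\<forall>js. length js < Suc k \<longrightarrow> P js) \<longleftrightarrow> P [] \<and> (\<forall>js i. length js < k \<longrightarrow> P (js @ [i]))"
    for P :: "'a list \<Rightarrow> bool"
  proof safe
    fix js :: "'a list" assume "P []" "\<forall>js i. length js < k \<longrightarrow> P (js @ [i])" "length js < Suc k"
    then show "P js" by (cases js rule: rev_cases) auto
  qed auto
  from this[of "\<lambda>js. \<forall>x\<in>S. iter_pderiv js f differentiable (at x)"]
  show ?case by (auto simp: Suc iter_pderiv_append)
qed auto

lemma smooth_on_iff_times_differentiable: "smooth_on S f \<longleftrightarrow> (\<forall>k. times_differentiable k S f)"
  unfolding smooth_on_def times_differentiable_iff by blast

lemma smooth_on_pderiv: "smooth_on S f \<Longrightarrow> smooth_on S (pderiv_at i f)"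
  unfolding smooth_on_iff_times_differentiable using times_differentiable.simps(2) by blast

lemma smooth_on_iter_pderiv: "smooth_on S f \<Longrightarrow> smooth_on S (iter_pderiv js f)"
  by (induction js) (auto intro: smooth_on_pderiv)

lemma smooth_on_differentiable: "smooth_on S f \<Longrightarrow> x \<in> S \<Longrightarrow> f differentiable (at x)"
  unfolding smooth_on_def using iter_pderiv.simps(1) by metis

lemma smooth_on_continuous: "smooth_on S f \<Longrightarrow> continuous_on S f"
  by (meson continuous_at_imp_continuous_on differentiable_imp_continuous_within smooth_on_differentiable)

lemma smooth_on_subset: "smooth_on T f \<Longrightarrow> S \<subseteq> T \<Longrightarrow> smooth_on S f"
  unfolding smooth_on_def by blast

lemma smooth_on_Un: "smooth_on S f \<Longrightarrow> smooth_on T f \<Longrightarrow> smooth_on (S \<union> T) f"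
  unfolding smooth_on_def by blast

lemma smooth_on_cong_open:
  assumes "open S" "\<And>y. y \<in> S \<Longrightarrow> f y = g y" "smooth_on S f"
  shows "smooth_on S g"
  unfolding smooth_on_def
proof (intro allI ballI)
  fix js x assume x: "x \<in> S"
  show "iter_pderiv js g differentiable (at x)"
    using assms(3) x
    by (intro differentiable_cong_open[OF assms(1) iter_pderiv_cong_open[OF assms(1,2)] x])
       (auto simp: smooth_on_def)
qed

lemma times_differentiable_cong_open:
  assumes "open S" "\<And>y. y \<in> S \<Longrightarrow> f y = g y" "times_differentiable k S f"
  shows "times_differentiable k S g"
  unfolding times_differentiable_iff
proof (intro allI ballI impI)
  fix js :: "'a list" and x assume "length js < k" and x: "x \<in> S"
  then show "iter_pderiv js g differentiable (at x)"
    using assms(3) x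
    by (intro differentiable_cong_open[OF assms(1) iter_pderiv_cong_open[OF assms(1,2)] x])
       (auto simp: times_differentiable_iff)
qed

text \<open>For a function whose derivatives are recognised as smooth by other means.\<close>
lemma smooth_on_if_derivs_smooth:
  assumes "open S" "\<And>x. x \<in> S \<Longrightarrow> f differentiable (at x)"
    and "\<And>i. smooth_on S (g i)" and "\<And>i x. x \<in> S \<Longrightarrow> pderiv_at i f x = g i x"
  shows "smooth_on S f"
  unfolding smooth_on_iff_times_differentiable
proof
  fix k show "times_differentiable k S f"
  proof (cases k)
    case (Suc m)
    have "times_differentiable m S (pderiv_at i f)" for i
    proof (rule times_differentiable_cong_open[OF assms(1)])
      show "times_differentiable m S (g i)"
        using assms(3) unfolding smooth_on_iff_times_differentiable by blast
    qed (rule assms(4)[symmetric])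
    then show ?thesis using Suc assms(2) by simp
  qed simp
qed

lemma pderiv_at_const [simp]: "pderiv_at i (\<lambda>_. c) = (\<lambda>_. 0)"
  by (auto simp: pderiv_at_def)

lemma pderiv_at_add:
  assumes "f differentiable (at x)" "g differentiable (at x)"
  shows "pderiv_at i (\<lambda>x. f x + g x) x = pderiv_at i f x + pderiv_at i g x"
  using has_derivative_add[OF assms[unfolded frechet_derivative_works]]
  by (subst pderiv_at_eqI) (auto simp: pderiv_at_def)

lemma pderiv_at_bounded_linear:
  assumes "bounded_linear L" "f differentiable (at x)"
  shows "pderiv_at i (\<lambda>x. L (f x)) x = L (pderiv_at i f x)"
  using bounded_linear.has_derivative[OF assms(1) assms(2)[unfolded frechet_derivative_works]]
  by (subst pderiv_at_eqI) (auto simp: pderiv_at_def)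

lemma pderiv_at_mult:
  fixes f g :: "real^'n::finite \<Rightarrow> 'b::real_normed_algebra"
  assumes "f differentiable (at x)" "g differentiable (at x)"
  shows "pderiv_at i (\<lambda>x. f x * g x) x = pderiv_at i f x * g x + f x * pderiv_at i g x"
  using pderiv_at_eqI[OF has_derivative_mult[OF assms[unfolded frechet_derivative_works]], of i]
  by (simp add: pderiv_at_def add.commute)

lemma pderiv_at_sum:
  assumes "\<And>k. k \<in> K \<Longrightarrow> f k differentiable (at x)"
  shows "pderiv_at i (\<lambda>x. \<Sum>k\<in>K. f k x) x = (\<Sum>k\<in>K. pderiv_at i (f k) x)"
proof -
  have "((\<lambda>x. \<Sum>k\<in>K. f k x) has_derivative (\<lambda>v. \<Sum>k\<in>K. frechet_derivative (f k) (at x) v)) (at x)"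
    using assms by (intro has_derivative_sum) (simp add: frechet_derivative_works)
  from pderiv_at_eqI[OF this] show ?thesis by (simp add: pderiv_at_def)
qed

lemma smooth_on_const: "smooth_on S (\<lambda>_. c)"
proof -
  have "iter_pderiv js (\<lambda>_. c) = (if js = [] then (\<lambda>_. c) else (\<lambda>_. 0))" for js :: "'a list"
    by (induction js) auto
  then show ?thesis by (auto simp: smooth_on_def)
qed

lemma times_differentiable_add:
  assumes "open S" "times_differentiable k S f" "times_differentiable k S g"
  shows "times_differentiable k S (\<lambda>x. f x + g x)"
  using assms(2,3)
proof (induction k arbitrary: f g)
  case (Suc k)
  have "times_differentiable k S (pderiv_at i (\<lambda>x. f x + g x))" for i
    by (rule times_differentiable_cong_open[OF assms(1) _ Suc.IH, of "pderiv_at i f" "pderiv_at i g"])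
       (use Suc.prems in \<open>auto simp: pderiv_at_add\<close>)
  then show ?case using Suc.prems by auto
qed simp

lemma times_differentiable_mult:
  fixes f g :: "real^'n::finite \<Rightarrow> 'b::real_normed_algebra"
  assumes "open S" "times_differentiable k S f" "times_differentiable k S g"
  shows "times_differentiable k S (\<lambda>x. f x * g x)"
  using assms(2,3)
proof (induction k arbitrary: f g)
  case (Suc k)
  have lower: "times_differentiable k S f" "times_differentiable k S g"
    using Suc.prems unfolding times_differentiable_iff by auto
  have "times_differentiable k S (pderiv_at i (\<lambda>x. f x * g x))" for i
    by (rule times_differentiable_cong_open[OF assms(1) _ times_differentiable_add[OF assms(1) Suc.IH Suc.IH],
          of "pderiv_at i f" g f "pderiv_at i g"])
       (use Suc.prems lower in \<open>auto simp: pderiv_at_mult\<close>)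
  then show ?case using Suc.prems by auto
qed simp

lemma times_differentiable_bounded_linear:
  assumes "open S" "bounded_linear L" "times_differentiable k S f"
  shows "times_differentiable k S (\<lambda>x. L (f x))"
  using assms(3)
proof (induction k arbitrary: f)
  case (Suc k)
  have "times_differentiable k S (pderiv_at i (\<lambda>x. L (f x)))" for i
    by (rule times_differentiable_cong_open[OF assms(1) _ Suc.IH, of "pderiv_at i f"])
       (use Suc.prems in \<open>auto simp: pderiv_at_bounded_linear[OF assms(2)]\<close>)
  moreover have "(\<lambda>x. L (f x)) differentiable (at x)" if "x \<in> S" for x
  proof -
    have "f differentiable (at x)" using Suc.prems that by simp
    then show ?thesis using bounded_linear.has_derivative[OF assms(2)] unfolding differentiable_def by blast
  qed
  ultimately show ?case by auto
qed simp

lemma smooth_on_add: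
  "open S \<Longrightarrow> smooth_on S f \<Longrightarrow> smooth_on S g \<Longrightarrow> smooth_on S (\<lambda>x. f x + g x)"
  by (simp add: smooth_on_iff_times_differentiable times_differentiable_add)

lemma smooth_on_mult:
  fixes f g :: "real^'n::finite \<Rightarrow> 'b::real_normed_algebra"
  shows "open S \<Longrightarrow> smooth_on S f \<Longrightarrow> smooth_on S g \<Longrightarrow> smooth_on S (\<lambda>x. f x * g x)"
  by (simp add: smooth_on_iff_times_differentiable times_differentiable_mult)

lemma smooth_on_bounded_linear:
  "open S \<Longrightarrow> bounded_linear L \<Longrightarrow> smooth_on S f \<Longrightarrow> smooth_on S (\<lambda>x. L (f x))"
  by (simp add: smooth_on_iff_times_differentiable times_differentiable_bounded_linear)

lemma smooth_on_of_real:
  fixes f :: "real^'n::finite \<Rightarrow> real"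
  shows "open S \<Longrightarrow> smooth_on S f \<Longrightarrow> smooth_on S (\<lambda>x. complex_of_real (f x))"
  using smooth_on_bounded_linear[OF _ bounded_linear_of_real] .

lemma smooth_on_uminus:
  fixes f :: "real^'n::finite \<Rightarrow> complex"
  shows "open S \<Longrightarrow> smooth_on S f \<Longrightarrow> smooth_on S (\<lambda>x. - f x)"
  using smooth_on_bounded_linear[OF _ bounded_linear_minus[OF bounded_linear_ident]] .

lemma smooth_on_diff:
  fixes f :: "real^'n::finite \<Rightarrow> complex"
  shows "open S \<Longrightarrow> smooth_on S f \<Longrightarrow> smooth_on S g \<Longrightarrow> smooth_on S (\<lambda>x. f x - g x)"
  using smooth_on_add[OF _ _ smooth_on_uminus, of S f g] by simp

lemma smooth_on_sum:
  "open S \<Longrightarrow> (\<And>k. k \<in> K \<Longrightarrow> smooth_on S (f k)) \<Longrightarrow> smooth_on S (\<lambda>x. \<Sum>k\<in>K. f k x)"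
  by (induction K rule: infinite_finite_induct) (auto intro: smooth_on_add smooth_on_const)

lemma bounded_linear_coord: "bounded_linear (\<lambda>x::real^'n::finite. complex_of_real (x $ j))"
  by (intro bounded_linear_compose[OF bounded_linear_of_real] bounded_linear_vec_nth)

lemma pderiv_at_coord: "pderiv_at i (\<lambda>x. complex_of_real (x $ j)) x = (if i = j then 1 else 0)"
  using pderiv_at_eqI[OF bounded_linear_imp_has_derivative[OF bounded_linear_coord[of j]], of i x]
  by (auto simp: axis_def)

lemma smooth_on_coord: "open S \<Longrightarrow> smooth_on S (\<lambda>x::real^'n::finite. complex_of_real (x $ j))"
  by (rule smooth_on_if_derivs_smooth[where g = "\<lambda>i _. if i = j then 1 else 0"])
     (simp_all add: pderiv_at_coord smooth_on_const bounded_linear_imp_differentiable[OF bounded_linear_coord])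

lemmas smooth_on_intros = smooth_on_add smooth_on_mult smooth_on_uminus smooth_on_diff smooth_on_sum
  smooth_on_const smooth_on_coord smooth_on_pderiv smooth_on_of_real

lemma iter_pderiv_add:
  assumes "open S" "smooth_on S f" "smooth_on S g" "x \<in> S"
  shows "iter_pderiv js (\<lambda>x. f x + g x) x = iter_pderiv js f x + iter_pderiv js g x"
  using assms(4)
proof (induction js arbitrary: x)
  case (Cons i js)
  have "iter_pderiv (i # js) (\<lambda>x. f x + g x) x
      = pderiv_at i (\<lambda>x. iter_pderiv js f x + iter_pderiv js g x) x"
    using pderiv_at_cong_open[OF assms(1) Cons.prems Cons.IH] by simp
  also have "\<dots> = iter_pderiv (i # js) f x + iter_pderiv (i # js) g x"
    using Cons.prems assms(2,3) by (simp add: pderiv_at_add smooth_on_def)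
  finally show ?case .
qed auto

lemma iter_pderiv_bounded_linear:
  assumes "open S" "bounded_linear L" "smooth_on S f" "x \<in> S"
  shows "iter_pderiv js (\<lambda>x. L (f x)) x = L (iter_pderiv js f x)"
  using assms(4)
proof (induction js arbitrary: x)
  case (Cons i js)
  have "iter_pderiv (i # js) (\<lambda>x. L (f x)) x = pderiv_at i (\<lambda>x. L (iter_pderiv js f x)) x"
    using pderiv_at_cong_open[OF assms(1) Cons.prems Cons.IH] by simp
  also have "\<dots> = L (iter_pderiv (i # js) f x)"
    using Cons.prems assms(3) by (simp add: pderiv_at_bounded_linear[OF assms(2)] smooth_on_def)
  finally show ?case .
qed auto

lemma pderiv_at_cmult:
  fixes f :: "real^'n::finite \<Rightarrow> complex"
  shows "f differentiable (at x) \<Longrightarrow> pderiv_at i (\<lambda>x. c * f x) x = c * pderiv_at i f x"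
  using pderiv_at_bounded_linear[OF bounded_linear_mult_right] .

lemma pderiv_at_diff:
  fixes f :: "real^'n::finite \<Rightarrow> complex"
  assumes "f differentiable (at x)" "g differentiable (at x)"
  shows "pderiv_at i (\<lambda>x. f x - g x) x = pderiv_at i f x - pderiv_at i g x"
  using has_derivative_diff[OF assms[unfolded frechet_derivative_works]]
  by (subst pderiv_at_eqI) (auto simp: pderiv_at_def)

lemma pderiv_chain:
  fixes f :: "real^'n::finite \<Rightarrow> complex"
  assumes "f differentiable (at (g t))" "(g has_vector_derivative v) (at t within T)"
  shows "((\<lambda>t. f (g t)) has_vector_derivative (\<Sum>i\<in>UNIV. of_real (v $ i) * pderiv_at i f (g t))) (at t within T)"
proof -
  have "((\<lambda>t. f (g t)) has_derivative (\<lambda>s. \<Sum>i\<in>UNIV. ((s *\<^sub>R v) $ i) *\<^sub>R pderiv_at i f (g t))) (at t within T)"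
    using has_derivative_in_compose[OF assms(2)[unfolded has_vector_derivative_def]
        has_derivative_at_withinI[OF has_derivative_pderiv_sum[OF assms(1)]]] .
  moreover have "(\<lambda>s. \<Sum>i\<in>UNIV. ((s *\<^sub>R v) $ i) *\<^sub>R pderiv_at i f (g t))
     = (\<lambda>s. s *\<^sub>R (\<Sum>i\<in>UNIV. of_real (v $ i) * pderiv_at i f (g t)))"
    by (simp add: scaleR_sum_right) (simp add: scaleR_conv_of_real mult_ac)
  ultimately show ?thesis by (simp add: has_vector_derivative_def)
qed

section \<open>Integrals depending smoothly on a parameter\<close>

text \<open>Differentiation under the integral sign rests on a continuous total derivative of the integrand, which
  is assembled from the continuous partial derivatives.\<close>
lemma parametric_integral_derivative:
  fixes F :: "'e::euclidean_space \<Rightarrow> real^'n::finite \<Rightarrow> complex"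
  assumes S: "open S" "x \<in> S"
    and diff: "\<And>t x. t \<in> cbox a b \<Longrightarrow> x \<in> S \<Longrightarrow> F t differentiable (at x)"
    and cont: "continuous_on (S \<times> cbox a b) (\<lambda>(x,t). F t x)"
    and cont': "\<And>i. continuous_on (S \<times> cbox a b) (\<lambda>(x,t). pderiv_at i (F t) x)"
  shows "(\<lambda>x. integral (cbox a b) (\<lambda>t. F t x)) differentiable (at x)"
    and "pderiv_at i (\<lambda>x. integral (cbox a b) (\<lambda>t. F t x)) x = integral (cbox a b) (\<lambda>t. pderiv_at i (F t) x)"
proof -
  define D where "D x t = (\<Sum>i\<in>UNIV. blinfun_scaleR_left (pderiv_at i (F t) x) o\<^sub>L blinfun_inner_left (axis i (1::real)))"
    for x t
  have D: "blinfun_apply (D x t) v = (\<Sum>i\<in>UNIV. (v $ i) *\<^sub>R pderiv_at i (F t) x)" for x t v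
    by (simp add: D_def blinfun.sum_left inner_axis)
  obtain e where e: "e > 0" "ball x e \<subseteq> S" using S open_contains_ball by blast
  have sub: "ball x e \<times> cbox a b \<subseteq> S \<times> cbox a b" using e by auto
  have contD: "continuous_on (ball x e \<times> cbox a b) (\<lambda>(x,t). D x t)"
    unfolding D_def split_beta
    by (intro continuous_intros continuous_on_subset[OF cont'[unfolded split_beta] sub])
  have slice: "continuous_on (cbox a b) (\<lambda>t. F t y)" if "y \<in> ball x e" for y
    using that e by (intro continuous_on_compose2[OF cont[unfolded split_beta], of "cbox a b" "\<lambda>t. (y,t)", simplified])
       (auto intro!: continuous_intros)
  have xin: "x \<in> ball x e" using e by simp
  have "((\<lambda>x. integral (cbox a b) (\<lambda>t. F t x)) has_derivative integral (cbox a b) (D x)) (at x within ball x e)"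
  proof (rule leibniz_rule[OF _ _ contD xin convex_ball])
    fix y t assume yt: "y \<in> ball x e" "t \<in> cbox a b"
    then have "(F t has_derivative (\<lambda>v. \<Sum>i\<in>UNIV. (v $ i) *\<^sub>R pderiv_at i (F t) y)) (at y)"
      using diff e by (intro has_derivative_pderiv_sum) auto
    then show "(F t has_derivative blinfun_apply (D y t)) (at y within ball x e)"
      using has_derivative_at_withinI by (metis (no_types, lifting) D ext)
  next
    fix y assume "y \<in> ball x e"
    from integrable_continuous[OF slice[OF this]]
    show "(\<lambda>t. F t y) integrable_on cbox a b" .
  qed
  then have der: "((\<lambda>x. integral (cbox a b) (\<lambda>t. F t x)) has_derivative integral (cbox a b) (D x)) (at x)"
    using at_within_open[OF xin open_ball] by simp
  then show "(\<lambda>x. integral (cbox a b) (\<lambda>t. F t x)) differentiable (at x)"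
    by (auto simp: differentiable_def)
  have intD: "D x integrable_on cbox a b"
    using xin by (intro integrable_continuous continuous_on_compose2[OF contD[unfolded split_beta], of "cbox a b" "\<lambda>t. (x,t)", simplified])
       (auto intro!: continuous_intros)
  have "blinfun_apply (integral (cbox a b) (D x)) (axis i 1) = integral (cbox a b) (\<lambda>t. D x t (axis i 1))"
    using integral_linear[OF intD, of "\<lambda>L. blinfun_apply L (axis i 1)"]
    by (simp add: o_def blinfun.bounded_linear_left)
  also have "\<dots> = integral (cbox a b) (\<lambda>t. pderiv_at i (F t) x)"
    by (simp add: D axis_def if_distrib[of "\<lambda>r. r *\<^sub>R _"] cong: if_cong)
  finally show "pderiv_at i (\<lambda>x. integral (cbox a b) (\<lambda>t. F t x)) x = integral (cbox a b) (\<lambda>t. pderiv_at i (F t) x)"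
    using pderiv_at_eqI[OF der] by simp
qed

text \<open>Because the hypothesis speaks of all iterated derivatives, it reproduces itself under
  differentiation.\<close>
lemma
  fixes F :: "'e::euclidean_space \<Rightarrow> real^'n::finite \<Rightarrow> complex"
  assumes "open S"
    and "\<And>t. t \<in> cbox a b \<Longrightarrow> smooth_on S (F t)"
    and "\<And>js. continuous_on (S \<times> cbox a b) (\<lambda>(x,t). iter_pderiv js (F t) x)"
  shows smooth_on_parametric_integral: "smooth_on S (\<lambda>x. integral (cbox a b) (\<lambda>t. F t x))"
    and iter_pderiv_parametric_integral: "x \<in> S \<Longrightarrow> iter_pderiv js (\<lambda>x. integral (cbox a b) (\<lambda>t. F t x)) x
      = integral (cbox a b) (\<lambda>t. iter_pderiv js (F t) x)"
proof -
  have step: "(\<lambda>x. integral (cbox a b) (\<lambda>t. iter_pderiv js (F t) x)) differentiable (at x)"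
     "pderiv_at i (\<lambda>x. integral (cbox a b) (\<lambda>t. iter_pderiv js (F t) x)) x
       = integral (cbox a b) (\<lambda>t. iter_pderiv (i # js) (F t) x)" if "x \<in> S" for x js i
    using parametric_integral_derivative[OF assms(1) that, of a b "\<lambda>t. iter_pderiv js (F t)"]
      assms(2) assms(3)[of js] assms(3)[of "_ # js"] by (auto simp: smooth_on_def)
  have eq: "iter_pderiv js (\<lambda>x. integral (cbox a b) (\<lambda>t. F t x)) x
      = integral (cbox a b) (\<lambda>t. iter_pderiv js (F t) x)" if "x \<in> S" for js x
    using that
  proof (induction js arbitrary: x)
    case (Cons i js)
    then show ?case using step(2)[OF Cons.prems, of i js]
      by (simp add: pderiv_at_cong_open[OF assms(1) Cons.prems Cons.IH])
  qed simp
  show "smooth_on S (\<lambda>x. integral (cbox a b) (\<lambda>t. F t x))"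
    unfolding smooth_on_def
    using differentiable_cong_open[OF assms(1) eq[symmetric] _ step(1)] by blast
  show "x \<in> S \<Longrightarrow> iter_pderiv js (\<lambda>x. integral (cbox a b) (\<lambda>t. F t x)) x
      = integral (cbox a b) (\<lambda>t. iter_pderiv js (F t) x)" by (rule eq)
qed

section \<open>Affine substitutions and symmetry of mixed derivatives\<close>

lemma pderiv_at_affine:
  fixes f :: "real^'n::finite \<Rightarrow> complex"
  assumes "f differentiable (at (c *\<^sub>R x + d))"
  shows "(\<lambda>x. f (c *\<^sub>R x + d)) differentiable (at x)"
    and "pderiv_at i (\<lambda>x. f (c *\<^sub>R x + d)) x = of_real c * pderiv_at i f (c *\<^sub>R x + d)"
proof -
  have "((\<lambda>x. c *\<^sub>R x + d) has_derivative (\<lambda>v. c *\<^sub>R v)) (at x)"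
    by (auto intro!: derivative_eq_intros)
  from has_derivative_compose[OF this has_derivative_pderiv_sum[OF assms]]
  have D: "((\<lambda>x. f (c *\<^sub>R x + d)) has_derivative
      (\<lambda>v. \<Sum>i\<in>UNIV. ((c *\<^sub>R v) $ i) *\<^sub>R pderiv_at i f (c *\<^sub>R x + d))) (at x)" .
  then show "(\<lambda>x. f (c *\<^sub>R x + d)) differentiable (at x)" by (auto simp: differentiable_def)
  show "pderiv_at i (\<lambda>x. f (c *\<^sub>R x + d)) x = of_real c * pderiv_at i f (c *\<^sub>R x + d)"
    using pderiv_at_eqI[OF D, of i]
    by (simp add: axis_def scaleR_conv_of_real[where 'a = complex] if_distrib[of of_real]
          if_distrib[of "\<lambda>r. _ * r"] if_distrib[of "\<lambda>r. r * _"] cong: if_cong)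
qed

lemma
  fixes f :: "real^'n::finite \<Rightarrow> complex"
  assumes "open S" "smooth_on S f"
  shows smooth_on_affine: "smooth_on {x. c *\<^sub>R x + d \<in> S} (\<lambda>x. f (c *\<^sub>R x + d))"
    and iter_pderiv_affine: "c *\<^sub>R x + d \<in> S \<Longrightarrow>
      iter_pderiv js (\<lambda>x. f (c *\<^sub>R x + d)) x = of_real c ^ length js * iter_pderiv js f (c *\<^sub>R x + d)"
proof -
  let ?T = "{x. c *\<^sub>R x + d \<in> S}"
  have T: "open ?T"
  proof -
    have "continuous_on UNIV (\<lambda>x. c *\<^sub>R x + d)" by (intro continuous_intros)
    from open_vimage[OF assms(1) this] show ?thesis by (simp add: vimage_def)
  qed
  have d: "(\<lambda>x. of_real c ^ m * iter_pderiv js f (c *\<^sub>R x + d)) differentiable (at x)"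
    "pderiv_at i (\<lambda>x. of_real c ^ m * iter_pderiv js f (c *\<^sub>R x + d)) x
      = of_real c ^ Suc m * iter_pderiv (i # js) f (c *\<^sub>R x + d)" if "x \<in> ?T" for x m js i
  proof -
    have "iter_pderiv js f differentiable (at (c *\<^sub>R x + d))"
      using assms(2) that by (auto simp: smooth_on_def)
    from pderiv_at_affine[OF this]
    show "(\<lambda>x. of_real c ^ m * iter_pderiv js f (c *\<^sub>R x + d)) differentiable (at x)"
      "pderiv_at i (\<lambda>x. of_real c ^ m * iter_pderiv js f (c *\<^sub>R x + d)) x
      = of_real c ^ Suc m * iter_pderiv (i # js) f (c *\<^sub>R x + d)"
      by (auto simp: pderiv_at_cmult mult_ac intro!: differentiable_mult)
  qed
  have eq: "iter_pderiv js (\<lambda>x. f (c *\<^sub>R x + d)) x = of_real c ^ length js * iter_pderiv js f (c *\<^sub>R x + d)"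
    if "x \<in> ?T" for x js
    using that
  proof (induction js arbitrary: x)
    case (Cons i js)
    have "iter_pderiv (i # js) (\<lambda>x. f (c *\<^sub>R x + d)) x
       = pderiv_at i (\<lambda>x. of_real c ^ length js * iter_pderiv js f (c *\<^sub>R x + d)) x"
      using pderiv_at_cong_open[OF T Cons.prems Cons.IH] by simp
    then show ?case using d(2)[OF Cons.prems] by simp
  qed simp
  show "smooth_on ?T (\<lambda>x. f (c *\<^sub>R x + d))"
    unfolding smooth_on_def using differentiable_cong_open[OF T eq[symmetric] _ d(1)] by blast
  show "c *\<^sub>R x + d \<in> S \<Longrightarrow>
      iter_pderiv js (\<lambda>x. f (c *\<^sub>R x + d)) x = of_real c ^ length js * iter_pderiv js f (c *\<^sub>R x + d)"
    using eq by simp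
qed

text \<open>Differentiating \<open>f (y + t e\<^sub>j) - f y = \<integral>\<^sub>0\<^sup>t \<partial>\<^sub>j f (y + s e\<^sub>j) ds\<close> under the integral sign in the
  direction \<open>i\<close>, and then both sides in \<open>t\<close> at \<open>0\<close>, gives the symmetry of mixed derivatives.\<close>
lemma pderiv_at_commute:
  fixes f :: "real^'n::finite \<Rightarrow> complex"
  assumes f: "smooth_on UNIV f"
  shows "pderiv_at i (pderiv_at j f) x = pderiv_at j (pderiv_at i f) x"
proof -
  let ?e = "axis j (1::real) :: real^'n"
  have diff: "iter_pderiv js f differentiable (at y)" for js y using f by (auto simp: smooth_on_def)
  note d0 = diff[of "[]", simplified] and d1 = diff[of "[_]", simplified] and d2 = diff[of "[_,_]", simplified]
  have line: "((\<lambda>t. g (y + t *\<^sub>R ?e)) has_vector_derivative pderiv_at j g (y + t *\<^sub>R ?e)) (at t within T)"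
    if "\<And>y. g differentiable (at y)" for g :: "real^'n \<Rightarrow> complex" and y t T
  proof -
    have "((\<lambda>t. y + t *\<^sub>R ?e) has_vector_derivative ?e) (at t within T)"
      by (auto simp: has_vector_derivative_def intro!: derivative_eq_intros)
    moreover have "(\<Sum>k\<in>UNIV. of_real (?e $ k) * pderiv_at k g z) = pderiv_at j g z" for z
      by (simp add: axis_def if_distrib[of of_real] if_distrib[of "\<lambda>r. r * _"] cong: if_cong)
    ultimately show ?thesis using pderiv_chain[OF that, of "\<lambda>t. y + t *\<^sub>R ?e" ?e t T] by simp
  qed
  have cont: "continuous_on T (iter_pderiv js f)" for T js
    by (meson diff continuous_at_imp_continuous_on differentiable_imp_continuous_within)
  have shift: "pderiv_at i f (y + t *\<^sub>R ?e) - pderiv_at i f y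
      = integral {0..t} (\<lambda>s. pderiv_at i (pderiv_at j f) (y + s *\<^sub>R ?e))" if "t \<ge> 0" for y t
  proof -
    have "integral {0..t} (\<lambda>s. pderiv_at j f (z + s *\<^sub>R ?e)) = f (z + t *\<^sub>R ?e) - f z" for z
      using fundamental_theorem_of_calculus[OF that line[OF d0, of z], of ] by (auto dest: integral_unique)
    then have "(\<lambda>z. integral (cbox 0 t) (\<lambda>s. pderiv_at j f (z + s *\<^sub>R ?e)))
       = (\<lambda>z. f (1 *\<^sub>R z + t *\<^sub>R ?e) - f z)" by auto
    moreover have "pderiv_at i (\<lambda>z. integral (cbox 0 t) (\<lambda>s. pderiv_at j f (z + s *\<^sub>R ?e))) y
      = integral (cbox 0 t) (\<lambda>s. pderiv_at i (\<lambda>z. pderiv_at j f (1 *\<^sub>R z + s *\<^sub>R ?e)) y)"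
      by (subst parametric_integral_derivative(2)[of UNIV])
         (use pderiv_at_affine[OF d1, where c = 1] in \<open>auto simp: split_beta intro!: continuous_intros
            continuous_on_compose2[OF cont[of UNIV "[j]", simplified]]
            continuous_on_compose2[OF cont[of UNIV "[_, j]", simplified]]\<close>)
    ultimately show ?thesis
      using pderiv_at_affine[OF d0, where c = 1 and x = y and d = "t *\<^sub>R ?e"]
        pderiv_at_affine(2)[OF d1, where c = 1]
      by (simp add: pderiv_at_diff d0)
  qed
  let ?g = "\<lambda>t. pderiv_at i f x + integral {0..t} (\<lambda>s. pderiv_at i (pderiv_at j f) (x + s *\<^sub>R ?e))"
  have "continuous_on {0..1} (\<lambda>s. pderiv_at i (pderiv_at j f) (x + s *\<^sub>R ?e))"
    by (auto intro!: continuous_intros continuous_on_compose2[OF cont[of UNIV "[_, j]", simplified]])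
  from integral_has_vector_derivative[OF this, of 0]
  have "(?g has_vector_derivative pderiv_at i (pderiv_at j f) x) (at 0 within {0..1})"
    by (auto intro!: derivative_eq_intros)
  then have "((\<lambda>t. pderiv_at i f (x + t *\<^sub>R ?e)) has_vector_derivative pderiv_at i (pderiv_at j f) x) (at 0 within {0..1})"
    by (rule has_vector_derivative_transform[rotated 2]) (use shift[of _ x] in \<open>auto simp: algebra_simps\<close>)
  moreover have "((\<lambda>t. pderiv_at i f (x + t *\<^sub>R ?e)) has_vector_derivative pderiv_at j (pderiv_at i f) x) (at 0 within {0..1})"
    using line[OF d1, of i x 0 "{0..1}"] by simp
  moreover have "at 0 within {0..1::real} \<noteq> bot"
    by (simp add: at_within_Icc_at_right)
  ultimately show ?thesis by (metis vector_derivative_unique_within)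
qed

lemma iter_pderiv_pderiv_commute:
  fixes f :: "real^'n::finite \<Rightarrow> complex"
  assumes f: "smooth_on UNIV f"
  shows "pderiv_at i (iter_pderiv js f) = iter_pderiv js (pderiv_at i f)"
proof (induction js)
  case (Cons j js)
  have "pderiv_at i (pderiv_at j (iter_pderiv js f)) = pderiv_at j (pderiv_at i (iter_pderiv js f))"
    using pderiv_at_commute[OF smooth_on_iter_pderiv[OF f]] by blast
  then show ?case using Cons by simp
qed simp

lemma iter_pderiv_mset_cong:
  fixes f :: "real^'n::finite \<Rightarrow> complex"
  assumes f: "smooth_on UNIV f" and "mset js = mset ks"
  shows "iter_pderiv js f = iter_pderiv ks f"
  using assms(2)
proof (induction js arbitrary: ks)
  case (Cons i js)
  then obtain us vs where ks: "ks = us @ i # vs"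
    by (metis list.set_intros(1) set_mset_mset split_list)
  with Cons have "iter_pderiv js f = iter_pderiv (us @ vs) f" by simp
  then show ?case
    by (simp add: ks iter_pderiv_append iter_pderiv_pderiv_commute[OF f]
          iter_pderiv_pderiv_commute[OF smooth_on_iter_pderiv[OF f]])
qed simp

section \<open>Symbol classes\<close>

lemma powr_comparable:
  fixes r s m :: real
  assumes "0 < r" "r \<le> s" "s \<le> 2 * r"
  shows "r powr m \<le> 2 powr \<bar>m\<bar> * s powr m"
proof (cases "m \<ge> 0")
  case True
  have "r powr m \<le> s powr m" using assms True by (intro powr_mono2) auto
  also have "\<dots> \<le> 2 powr \<bar>m\<bar> * s powr m"
    using ge_one_powr_ge_zero[of 2 "\<bar>m\<bar>"] by (simp add: mult_le_cancel_right1)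
  finally show ?thesis .
next
  case False
  have "r powr m \<le> (s / 2) powr m" using assms False by (intro powr_mono2') auto
  also have "\<dots> = 2 powr \<bar>m\<bar> * s powr m" using assms False
    by (simp add: powr_divide powr_minus_divide)
  finally show ?thesis .
qed

text \<open>Bounds for all unsorted lists of derivatives can be proved by induction on the list, unlike bounds for
  multiindices, whose sorted lists are not closed under appending an index.\<close>
lemma symbols_iff_iter_pderiv:
  "\<sigma> \<in> symbols a \<longleftrightarrow> smooth_on UNIV \<sigma> \<and>
     (\<forall>js. \<exists>C. \<forall>\<xi>. norm (iter_pderiv js \<sigma> \<xi>) \<le> C * (1 + norm \<xi>) powr (Re a - real (length js)))"
proof -
  have "(\<forall>\<beta>. \<exists>C. \<forall>\<xi>. norm (multi_pderiv \<beta> \<sigma> \<xi>) \<le> C * (1 + norm \<xi>) powr (Re a - real (size \<beta>))) \<longleftrightarrow>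
     (\<forall>js. \<exists>C. \<forall>\<xi>. norm (iter_pderiv js \<sigma> \<xi>) \<le> C * (1 + norm \<xi>) powr (Re a - real (length js)))"
    (is "?L \<longleftrightarrow> ?R") if "smooth_on UNIV \<sigma>"
  proof
    assume L: ?L
    show ?R
    proof
      fix js
      have "multi_pderiv (mset js) \<sigma> = iter_pderiv js \<sigma>"
        unfolding multi_pderiv_def by (rule iter_pderiv_mset_cong[OF that]) simp
      then show "\<exists>C. \<forall>\<xi>. norm (iter_pderiv js \<sigma> \<xi>) \<le> C * (1 + norm \<xi>) powr (Re a - real (length js))"
        using L[rule_format, of "mset js"] by simp
    qed
  next
    assume R: ?R
    show ?L
    proof
      fix \<beta>
      show "\<exists>C. \<forall>\<xi>. norm (multi_pderiv \<beta> \<sigma> \<xi>) \<le> C * (1 + norm \<xi>) powr (Re a - real (size \<beta>))"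
        using R[rule_format, of "sorted_list_of_multiset \<beta>"]
        unfolding multi_pderiv_def by (metis mset_sorted_list_of_multiset size_mset)
    qed
  qed
  then show ?thesis unfolding symbols_def by blast
qed

lemma symbols_smooth: "\<sigma> \<in> symbols a \<Longrightarrow> smooth_on UNIV \<sigma>"
  by (simp add: symbols_iff_iter_pderiv)

lemma symbols_bound:
  assumes "\<sigma> \<in> symbols a"
  obtains C where "C \<ge> 0" "\<And>\<xi>. norm (iter_pderiv js \<sigma> \<xi>) \<le> C * (1 + norm \<xi>) powr (Re a - real (length js))"
proof -
  obtain C where C: "norm (iter_pderiv js \<sigma> \<xi>) \<le> C * (1 + norm \<xi>) powr (Re a - real (length js))" for \<xi>
    using assms unfolding symbols_iff_iter_pderiv by blast
  have "C \<ge> 0"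
    using order_trans[OF norm_ge_zero C[of 0]] by simp
  then show ?thesis using that C by blast
qed

text \<open>Continuity bounds the derivatives on the unit ball, so only the growth outside it matters.\<close>
lemma symbolsI:
  assumes "smooth_on UNIV \<sigma>"
    and "\<And>js. \<exists>C. \<forall>\<xi>. norm \<xi> > 1 \<longrightarrow> norm (iter_pderiv js \<sigma> \<xi>) \<le> C * norm \<xi> powr (Re a - real (length js))"
  shows "\<sigma> \<in> symbols a"
  unfolding symbols_iff_iter_pderiv
proof (intro conjI allI assms(1))
  fix js
  obtain C where C: "norm \<xi> > 1 \<Longrightarrow> norm (iter_pderiv js \<sigma> \<xi>) \<le> C * norm \<xi> powr (Re a - real (length js))" for \<xi>
    using assms(2) by blast
  have "continuous_on (cball 0 1) (iter_pderiv js \<sigma>)"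
    using smooth_on_continuous[OF smooth_on_iter_pderiv[OF assms(1)]] continuous_on_subset by blast
  note compact_imp_bounded[OF compact_continuous_image[OF this compact_cball]]
  then obtain B where "\<forall>y\<in>iter_pderiv js \<sigma> ` cball 0 1. norm y \<le> B"
    unfolding bounded_iff by blast
  then have B: "norm (iter_pderiv js \<sigma> \<xi>) \<le> B" if "norm \<xi> \<le> 1" for \<xi>
    using that by simp
  let ?m = "Re a - real (length js)"
  let ?K = "max 0 (max B C)"
  have "norm (iter_pderiv js \<sigma> \<xi>) \<le> (?K * 2 powr \<bar>?m\<bar>) * (1 + norm \<xi>) powr ?m" for \<xi>
  proof (cases "norm \<xi> > 1")
    case True
    have "norm (iter_pderiv js \<sigma> \<xi>) \<le> ?K * norm \<xi> powr ?m"
      by (rule order_trans[OF C[OF True] mult_right_mono]) auto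
    also have "\<dots> \<le> ?K * (2 powr \<bar>?m\<bar> * (1 + norm \<xi>) powr ?m)"
      using True by (intro mult_left_mono powr_comparable) auto
    finally show ?thesis by (simp add: mult_ac)
  next
    case False
    have "norm (iter_pderiv js \<sigma> \<xi>) \<le> ?K * 1 powr ?m" using B[of \<xi>] False by auto
    also have "\<dots> \<le> ?K * (2 powr \<bar>?m\<bar> * (1 + norm \<xi>) powr ?m)"
      using False by (intro mult_left_mono powr_comparable) auto
    finally show ?thesis by (simp add: mult_ac)
  qed
  then show "\<exists>C. \<forall>\<xi>. norm (iter_pderiv js \<sigma> \<xi>) \<le> C * (1 + norm \<xi>) powr ?m" by blast
qed

lemma symbols_add:
  assumes "\<sigma> \<in> symbols a" "\<tau> \<in> symbols a"
  shows "(\<lambda>\<xi>. \<sigma> \<xi> + \<tau> \<xi>) \<in> symbols a"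
  unfolding symbols_iff_iter_pderiv
proof (intro conjI allI)
  have sm: "smooth_on UNIV \<sigma>" "smooth_on UNIV \<tau>" using assms symbols_smooth by auto
  then show "smooth_on UNIV (\<lambda>\<xi>. \<sigma> \<xi> + \<tau> \<xi>)" by (intro smooth_on_intros) auto
  fix js
  obtain C where C: "norm (iter_pderiv js \<sigma> \<xi>) \<le> C * (1 + norm \<xi>) powr (Re a - real (length js))" for \<xi>
    using symbols_bound[OF assms(1), of js] by metis
  obtain D where D: "norm (iter_pderiv js \<tau> \<xi>) \<le> D * (1 + norm \<xi>) powr (Re a - real (length js))" for \<xi>
    using symbols_bound[OF assms(2), of js] by metis
  have "norm (iter_pderiv js (\<lambda>\<xi>. \<sigma> \<xi> + \<tau> \<xi>) \<xi>) \<le> (C + D) * (1 + norm \<xi>) powr (Re a - real (length js))" for \<xi>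
    using norm_triangle_mono[OF C D, of \<xi>]
    by (simp add: iter_pderiv_add[OF open_UNIV sm] algebra_simps)
  then show "\<exists>C. \<forall>\<xi>. norm (iter_pderiv js (\<lambda>\<xi>. \<sigma> \<xi> + \<tau> \<xi>) \<xi>) \<le> C * (1 + norm \<xi>) powr (Re a - real (length js))"
    by blast
qed

lemma symbols_cmult:
  assumes "\<sigma> \<in> symbols a"
  shows "(\<lambda>\<xi>. c * \<sigma> \<xi>) \<in> symbols a"
  unfolding symbols_iff_iter_pderiv
proof (intro conjI allI)
  have sm: "smooth_on UNIV \<sigma>" using assms symbols_smooth by auto
  then show "smooth_on UNIV (\<lambda>\<xi>. c * \<sigma> \<xi>)" by (intro smooth_on_intros) auto
  fix js
  obtain C where C: "norm (iter_pderiv js \<sigma> \<xi>) \<le> C * (1 + norm \<xi>) powr (Re a - real (length js))" for \<xi>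
    using symbols_bound[OF assms(1), of js] by metis
  have "norm (iter_pderiv js (\<lambda>\<xi>. c * \<sigma> \<xi>) \<xi>) \<le> (norm c * C) * (1 + norm \<xi>) powr (Re a - real (length js))" for \<xi>
    using mult_left_mono[OF C norm_ge_zero, of c \<xi>]
    by (simp add: iter_pderiv_bounded_linear[OF open_UNIV bounded_linear_mult_right sm] norm_mult mult_ac)
  then show "\<exists>C. \<forall>\<xi>. norm (iter_pderiv js (\<lambda>\<xi>. c * \<sigma> \<xi>) \<xi>) \<le> C * (1 + norm \<xi>) powr (Re a - real (length js))"
    by blast
qed

lemma symbols_mono:
  assumes "\<sigma> \<in> symbols a" "Re a \<le> Re b"
  shows "\<sigma> \<in> symbols b"
  unfolding symbols_iff_iter_pderiv
proof (intro conjI allI)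
  show "smooth_on UNIV \<sigma>" using assms symbols_smooth by auto
  fix js
  obtain C where "C \<ge> 0" and C: "norm (iter_pderiv js \<sigma> \<xi>) \<le> C * (1 + norm \<xi>) powr (Re a - real (length js))" for \<xi>
    using symbols_bound[OF assms(1), of js] by metis
  have "norm (iter_pderiv js \<sigma> \<xi>) \<le> C * (1 + norm \<xi>) powr (Re b - real (length js))" for \<xi>
    using assms(2) \<open>C \<ge> 0\<close> by (intro order_trans[OF C] mult_left_mono powr_mono) auto
  then show "\<exists>C. \<forall>\<xi>. norm (iter_pderiv js \<sigma> \<xi>) \<le> C * (1 + norm \<xi>) powr (Re b - real (length js))"
    by blast
qed

lemma symbols_pderiv:
  assumes "\<sigma> \<in> symbols a"
  shows "pderiv_at i \<sigma> \<in> symbols (a - 1)"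
  unfolding symbols_iff_iter_pderiv
proof (intro conjI allI)
  show "smooth_on UNIV (pderiv_at i \<sigma>)" using assms symbols_smooth smooth_on_pderiv by blast
  fix js
  show "\<exists>C. \<forall>\<xi>. norm (iter_pderiv js (pderiv_at i \<sigma>) \<xi>) \<le> C * (1 + norm \<xi>) powr (Re (a - 1) - real (length js))"
    using assms symbols_bound[of \<sigma> a "js @ [i]"]
    by (auto simp: iter_pderiv_append algebra_simps)
qed

lemma symbols_zero: "(\<lambda>_. 0) \<in> symbols a"
  by (rule symbolsI) (auto simp: smooth_on_const iter_pderiv_bounded_linear[of UNIV "\<lambda>_. 0" "\<lambda>_. 0", OF open_UNIV bounded_linear_zero smooth_on_const] intro!: exI[of _ 0])

lemma symbols_sum: "(\<And>k. k \<in> K \<Longrightarrow> f k \<in> symbols a) \<Longrightarrow> (\<lambda>\<xi>. \<Sum>k\<in>K. f k \<xi>) \<in> symbols a"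
  by (induction K rule: infinite_finite_induct) (auto intro: symbols_add symbols_zero)

text \<open>The innermost derivative is taken first: it turns the product into two products with one factor of
  order lower by one, to which the induction hypothesis applies.\<close>
lemma symbols_mult:
  assumes "\<sigma> \<in> symbols a" "\<tau> \<in> symbols b"
  shows "(\<lambda>\<xi>. \<sigma> \<xi> * \<tau> \<xi>) \<in> symbols (a + b)"
  unfolding symbols_iff_iter_pderiv
proof (intro conjI allI)
  have sm: "smooth_on UNIV \<sigma>" "smooth_on UNIV \<tau>" using assms symbols_smooth by auto
  then show "smooth_on UNIV (\<lambda>\<xi>. \<sigma> \<xi> * \<tau> \<xi>)" by (intro smooth_on_intros) auto
  fix js
  show "\<exists>C. \<forall>\<xi>. norm (iter_pderiv js (\<lambda>\<xi>. \<sigma> \<xi> * \<tau> \<xi>) \<xi>) \<le> C * (1 + norm \<xi>) powr (Re (a + b) - real (length js))"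
    using assms
  proof (induction js arbitrary: \<sigma> \<tau> a b rule: rev_induct)
    case Nil
    obtain C where C: "C \<ge> 0" "norm (\<sigma> \<xi>) \<le> C * (1 + norm \<xi>) powr Re a" for \<xi>
      using symbols_bound[OF Nil(1), of "[]"] by auto
    obtain D where D: "norm (\<tau> \<xi>) \<le> D * (1 + norm \<xi>) powr Re b" for \<xi>
      using symbols_bound[OF Nil(2), of "[]"] by auto
    have "norm (\<sigma> \<xi> * \<tau> \<xi>) \<le> (C * D) * (1 + norm \<xi>) powr Re (a + b)" for \<xi>
      using mult_mono[OF C(2) D, of \<xi> \<xi>] C(1) by (simp add: norm_mult powr_add mult_ac)
    then show ?case by auto
  next
    case (snoc i js)
    have sm: "smooth_on UNIV \<sigma>" "smooth_on UNIV \<tau>" using snoc.prems symbols_smooth by auto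
    have "pderiv_at i (\<lambda>\<xi>. \<sigma> \<xi> * \<tau> \<xi>) = (\<lambda>\<xi>. pderiv_at i \<sigma> \<xi> * \<tau> \<xi> + \<sigma> \<xi> * pderiv_at i \<tau> \<xi>)"
      using smooth_on_differentiable[OF sm(1)] smooth_on_differentiable[OF sm(2)]
      by (auto simp: pderiv_at_mult)
    then have eq: "iter_pderiv (js @ [i]) (\<lambda>\<xi>. \<sigma> \<xi> * \<tau> \<xi>) \<xi>
        = iter_pderiv js (\<lambda>\<xi>. pderiv_at i \<sigma> \<xi> * \<tau> \<xi>) \<xi> + iter_pderiv js (\<lambda>\<xi>. \<sigma> \<xi> * pderiv_at i \<tau> \<xi>) \<xi>" for \<xi>
      using sm by (auto simp: iter_pderiv_append intro!: iter_pderiv_add[of UNIV] smooth_on_intros)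
    obtain C where C: "norm (iter_pderiv js (\<lambda>\<xi>. pderiv_at i \<sigma> \<xi> * \<tau> \<xi>) \<xi>)
        \<le> C * (1 + norm \<xi>) powr (Re (a + b) - real (length (js @ [i])))" for \<xi>
      using snoc.IH[OF symbols_pderiv[OF snoc.prems(1)] snoc.prems(2)] by (auto simp: algebra_simps)
    obtain D where D: "norm (iter_pderiv js (\<lambda>\<xi>. \<sigma> \<xi> * pderiv_at i \<tau> \<xi>) \<xi>)
        \<le> D * (1 + norm \<xi>) powr (Re (a + b) - real (length (js @ [i])))" for \<xi>
      using snoc.IH[OF snoc.prems(1) symbols_pderiv[OF snoc.prems(2)]] by (auto simp: algebra_simps)
    have "norm (iter_pderiv (js @ [i]) (\<lambda>\<xi>. \<sigma> \<xi> * \<tau> \<xi>) \<xi>)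
        \<le> (C + D) * (1 + norm \<xi>) powr (Re (a + b) - real (length (js @ [i])))" for \<xi>
      unfolding eq distrib_right by (rule norm_triangle_mono[OF C D])
    then show ?case by blast
  qed
qed

lemma bounded_support_symbols:
  fixes f :: "real^'n::{finite,linorder} \<Rightarrow> complex"
  assumes "smooth_on UNIV f" "\<And>\<xi>. norm \<xi> > R \<Longrightarrow> f \<xi> = 0"
  shows "f \<in> symbols a"
proof (rule symbolsI[OF assms(1)])
  fix js
  let ?g = "\<lambda>\<xi>. norm (iter_pderiv js f \<xi>) * norm \<xi> powr - (Re a - real (length js))"
  let ?K = "cball 0 \<bar>R\<bar> - ball 0 1 :: (real^'n::{finite,linorder}) set"
  have z: "iter_pderiv js f \<xi> = 0" if "norm \<xi> > R" for \<xi>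
  proof -
    have op: "open {\<xi>::real^'n::{finite,linorder}. norm \<xi> > R}" by (intro open_Collect_less continuous_intros)
    have "iter_pderiv js f \<xi> = iter_pderiv js (\<lambda>_. 0) \<xi>"
      using that by (intro iter_pderiv_cong_open[OF op]) (auto simp: assms(2))
    also have "\<dots> = 0"
      by (simp add: iter_pderiv_bounded_linear[of UNIV "\<lambda>_. 0" "\<lambda>_. 0", OF open_UNIV bounded_linear_zero smooth_on_const])
    finally show ?thesis .
  qed
  have "continuous_on ?K ?g"
    by (intro continuous_intros continuous_on_subset[OF smooth_on_continuous[OF smooth_on_iter_pderiv[OF assms(1)]]])
       auto
  moreover have "compact ?K" by (intro compact_diff) auto
  ultimately have "bounded (?g ` ?K)" using compact_continuous_image compact_imp_bounded by blast
  then obtain B where B: "\<xi> \<in> ?K \<Longrightarrow> ?g \<xi> \<le> B" for \<xi>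
    unfolding bounded_iff by fastforce
  have "norm (iter_pderiv js f \<xi>) \<le> max 0 B * norm \<xi> powr (Re a - real (length js))" if "norm \<xi> > 1" for \<xi>
  proof (cases "norm \<xi> > R")
    case False
    then have "?g \<xi> \<le> B" using that by (intro B) auto
    then have "?g \<xi> * norm \<xi> powr (Re a - real (length js)) \<le> max 0 B * norm \<xi> powr (Re a - real (length js))"
      by (intro mult_right_mono) auto
    moreover have "?g \<xi> * norm \<xi> powr (Re a - real (length js)) = norm (iter_pderiv js f \<xi>)"
      using that by (auto simp: mult.assoc simp flip: powr_add)
    ultimately show ?thesis by (simp only:)
  qed (simp add: z)
  then show "\<exists>C. \<forall>\<xi>. norm \<xi> > 1 \<longrightarrow> norm (iter_pderiv js f \<xi>) \<le> C * norm \<xi> powr (Re a - real (length js))"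
    by blast
qed

section \<open>Homogeneous functions and cutoffs\<close>

lemma pos_homogeneousD:
  "pos_homogeneous b h \<Longrightarrow> t > 0 \<Longrightarrow> \<xi> \<noteq> 0 \<Longrightarrow> h (t *\<^sub>R \<xi>) = complex_of_real t powr b * h \<xi>"
  by (simp add: pos_homogeneous_def)

lemma pos_homogeneous_pderiv:
  fixes h :: "real^'n::finite \<Rightarrow> complex"
  assumes sm: "smooth_on (- {0}) h" and hom: "pos_homogeneous b h"
  shows "pos_homogeneous (b - 1) (pderiv_at i h)"
  unfolding pos_homogeneous_def
proof (intro allI impI)
  fix t :: real and \<xi> :: "real^'n" assume t: "t > 0" and \<xi>: "\<xi> \<noteq> 0"
  have d: "h differentiable (at \<eta>)" if "\<eta> \<noteq> 0" for \<eta>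
    using sm that smooth_on_differentiable by auto
  have op: "open (- {0 :: real^'n})" by auto
  have "of_real t * pderiv_at i h (t *\<^sub>R \<xi>) = pderiv_at i (\<lambda>\<eta>. h (t *\<^sub>R \<eta> + 0)) \<xi>"
    using t \<xi> by (subst pderiv_at_affine(2)) (auto intro!: d)
  also have "\<dots> = pderiv_at i (\<lambda>\<eta>. complex_of_real t powr b * h \<eta>) \<xi>"
    by (rule pderiv_at_cong_open[OF op]) (use t \<xi> in \<open>auto simp: pos_homogeneousD[OF hom]\<close>)
  also have "\<dots> = complex_of_real t powr b * pderiv_at i h \<xi>"
    by (rule pderiv_at_cmult[OF d[OF \<xi>]])
  finally have "pderiv_at i h (t *\<^sub>R \<xi>) = complex_of_real t powr b / of_real t * pderiv_at i h \<xi>"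
    using t by (simp add: field_simps)
  also have "complex_of_real t powr b / of_real t = complex_of_real t powr (b - 1)"
    using t by (simp add: powr_diff)
  finally show "pderiv_at i h (t *\<^sub>R \<xi>) = complex_of_real t powr (b - 1) * pderiv_at i h \<xi>" .
qed

lemma pos_homogeneous_iter_pderiv:
  fixes h :: "real^'n::finite \<Rightarrow> complex"
  assumes "smooth_on (- {0}) h" "pos_homogeneous b h"
  shows "pos_homogeneous (b - of_nat (length js)) (iter_pderiv js h)"
proof (induction js)
  case (Cons i js)
  from pos_homogeneous_pderiv[OF smooth_on_iter_pderiv[OF assms(1)] this, of i]
  show ?case by (simp add: algebra_simps)
qed (use assms in auto)

text \<open>By compactness of the sphere.\<close>
lemma pos_homogeneous_bound:
  fixes h :: "real^'n::finite \<Rightarrow> complex"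
  assumes "continuous_on (- {0}) h" "pos_homogeneous b h"
  obtains C where "C \<ge> 0" "\<And>\<xi>. \<xi> \<noteq> 0 \<Longrightarrow> norm (h \<xi>) \<le> C * norm \<xi> powr Re b"
proof -
  have "continuous_on (sphere 0 1) h"
    using assms(1) by (rule continuous_on_subset) auto
  note compact_imp_bounded[OF compact_continuous_image[OF this compact_sphere]]
  then obtain B where B: "\<forall>y\<in>h ` sphere 0 1. norm y \<le> B"
    unfolding bounded_iff by blast
  have "norm (h \<xi>) \<le> max 0 B * norm \<xi> powr Re b" if "\<xi> \<noteq> 0" for \<xi>
  proof -
    have "norm (h (sgn \<xi>)) \<le> max 0 B" using B that by (auto simp: norm_sgn le_max_iff_disj)
    moreover have "\<xi> = norm \<xi> *\<^sub>R sgn \<xi>" by (simp add: sgn_div_norm that)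
    then have "h \<xi> = complex_of_real (norm \<xi>) powr b * h (sgn \<xi>)"
      using pos_homogeneousD[OF assms(2), of "norm \<xi>" "sgn \<xi>"] that by (metis sgn_zero_iff zero_less_norm_iff)
    ultimately show ?thesis
      using that by (simp add: norm_mult norm_powr_real_powr mult_left_mono mult.commute)
  qed
  then show ?thesis using that[of "max 0 B"] by auto
qed

lemma pos_homogeneous_cmult: "pos_homogeneous b h \<Longrightarrow> pos_homogeneous b (\<lambda>\<xi>. c * h \<xi>)"
  by (simp add: pos_homogeneous_def)

lemma pos_homogeneous_mult:
  "pos_homogeneous a h \<Longrightarrow> pos_homogeneous b g \<Longrightarrow> pos_homogeneous (a + b) (\<lambda>\<xi>. h \<xi> * g \<xi>)"
  by (auto simp: pos_homogeneous_def powr_add mult_ac)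

lemma pos_homogeneous_sum:
  "(\<And>k. k \<in> K \<Longrightarrow> pos_homogeneous b (h k)) \<Longrightarrow> pos_homogeneous b (\<lambda>\<xi>. \<Sum>k\<in>K. h k \<xi>)"
  by (auto simp: pos_homogeneous_def sum_distrib_left)

lemma pos_homogeneous_zero: "pos_homogeneous b (\<lambda>_. 0)"
  by (auto simp: pos_homogeneous_def)

lemma pos_homogeneous_coord: "pos_homogeneous 1 (\<lambda>\<xi>. complex_of_real (\<xi> $ i))"
  by (auto simp: pos_homogeneous_def powr_one')

text \<open>The Euler operator, i.e. the derivative along the radial field.\<close>
definition euler :: "(real^'n::finite \<Rightarrow> complex) \<Rightarrow> real^'n \<Rightarrow> complex"
  where "euler f \<xi> = (\<Sum>i\<in>UNIV. of_real (\<xi> $ i) * pderiv_at i f \<xi>)"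

lemma smooth_on_euler: "open S \<Longrightarrow> smooth_on S f \<Longrightarrow> smooth_on S (euler f)"
  unfolding euler_def[abs_def] by (intro smooth_on_intros) auto

lemma euler_mult:
  assumes "f differentiable (at \<xi>)" "g differentiable (at \<xi>)"
  shows "euler (\<lambda>\<xi>. f \<xi> * g \<xi>) \<xi> = euler f \<xi> * g \<xi> + f \<xi> * euler g \<xi>"
  using assms by (simp add: euler_def pderiv_at_mult sum_distrib_left sum_distrib_right sum.distrib algebra_simps)

lemma divergence_radial:
  fixes f :: "real^'n::finite \<Rightarrow> complex"
  assumes "f differentiable (at \<xi>)"
  shows "(\<Sum>i\<in>UNIV. pderiv_at i (\<lambda>\<xi>. of_real (\<xi> $ i) * f \<xi>) \<xi>) = of_nat CARD('n) * f \<xi> + euler f \<xi>"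
proof -
  have "(\<lambda>\<xi>::real^'n. complex_of_real (\<xi> $ i)) differentiable (at \<xi>)" for i
    using smooth_on_differentiable[OF smooth_on_coord[OF open_UNIV]] by blast
  then show ?thesis
    using assms by (simp add: pderiv_at_mult pderiv_at_coord euler_def sum.distrib)
qed

lemma has_vector_derivative_radial:
  fixes f :: "real^'n::finite \<Rightarrow> complex"
  assumes "f differentiable (at (t *\<^sub>R \<xi>))" "t \<noteq> 0"
  shows "((\<lambda>t. f (t *\<^sub>R \<xi>)) has_vector_derivative (euler f (t *\<^sub>R \<xi>) / of_real t)) (at t within T)"
proof -
  have "((\<lambda>t. t *\<^sub>R \<xi>) has_vector_derivative \<xi>) (at t within T)"
    by (auto simp: has_vector_derivative_def intro!: derivative_eq_intros)
  from pderiv_chain[OF assms(1) this]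
  show ?thesis using assms(2) by (simp add: euler_def sum_divide_distrib field_simps)
qed

lemma has_vector_derivative_powr:
  assumes "t > 0"
  shows "((\<lambda>t. complex_of_real t powr b) has_vector_derivative (b * complex_of_real t powr (b - 1))) (at t within T)"
proof -
  have "((\<lambda>z. z powr b) has_field_derivative (b * complex_of_real t powr (b - 1))) (at (complex_of_real t))"
    using assms by (intro has_field_derivative_powr) (auto simp: complex_nonpos_Reals_iff)
  from has_vector_derivative_real_field[OF this] show ?thesis .
qed

lemma euler_pos_homogeneous:
  fixes h :: "real^'n::finite \<Rightarrow> complex"
  assumes "smooth_on (- {0}) h" "pos_homogeneous b h" "\<xi> \<noteq> 0"
  shows "euler h \<xi> = b * h \<xi>"
proof -
  have "((\<lambda>t. h (t *\<^sub>R \<xi>)) has_vector_derivative euler h \<xi>) (at 1)"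
    using has_vector_derivative_radial[of h 1 \<xi> UNIV] assms by (simp add: smooth_on_differentiable)
  then have "((\<lambda>t. complex_of_real t powr b * h \<xi>) has_vector_derivative euler h \<xi>) (at 1)"
    by (rule has_vector_derivative_transform_within_open[where S = "{0<..}"])
       (use assms in \<open>auto simp: pos_homogeneousD\<close>)
  moreover have "((\<lambda>t. complex_of_real t powr b * h \<xi>) has_vector_derivative b * h \<xi>) (at 1)"
    using has_vector_derivative_mult_left[OF has_vector_derivative_powr[of 1 b UNIV], of "h \<xi>"] by simp
  ultimately show ?thesis by (rule vector_derivative_unique_at)
qed

lemma cutoff_smooth: "cutoff \<psi> \<Longrightarrow> smooth_on UNIV (\<lambda>\<xi>. complex_of_real (\<psi> \<xi>))"
  unfolding cutoff_def by (intro smooth_on_of_real) auto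

lemma cutoff_eq_1: "cutoff \<psi> \<Longrightarrow> norm \<xi> \<ge> 1 \<Longrightarrow> \<psi> \<xi> = 1"
  unfolding cutoff_def by auto

lemma cutoff_nbhd:
  assumes "cutoff \<psi>"
  obtains U where "open U" "0 \<in> U" "\<And>\<xi>. \<xi> \<in> U \<Longrightarrow> \<psi> \<xi> = 0"
  using assms unfolding cutoff_def eventually_nhds by auto

lemma smooth_on_extend_by_zero:
  fixes f :: "real^'n::finite \<Rightarrow> complex"
  assumes "smooth_on (- {0}) f" "open U" "0 \<in> U" "\<And>\<xi>. \<xi> \<in> U \<Longrightarrow> f \<xi> = 0"
  shows "smooth_on UNIV f"
proof -
  have "smooth_on U f"
    by (rule smooth_on_cong_open[OF assms(2) _ smooth_on_const[of _ 0]]) (simp add: assms(4))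
  moreover have "- {0} \<union> U = UNIV" using assms(3) by auto
  ultimately show ?thesis using smooth_on_Un[OF assms(1)] by metis
qed

lemma smooth_on_cutoff_mult:
  fixes g :: "real^'n::finite \<Rightarrow> complex"
  assumes "cutoff \<psi>" "smooth_on (- {0}) g"
  shows "smooth_on UNIV (\<lambda>\<xi>. of_real (\<psi> \<xi>) * g \<xi>)"
proof -
  obtain U where U: "open U" "0 \<in> U" "\<And>\<xi>. \<xi> \<in> U \<Longrightarrow> \<psi> \<xi> = 0"
    using cutoff_nbhd[OF assms(1)] by blast
  show ?thesis
    by (rule smooth_on_extend_by_zero[OF _ U(1,2)])
       (auto simp: U(3) intro!: smooth_on_mult assms(2) smooth_on_subset[OF cutoff_smooth[OF assms(1)]])
qed

lemma cutoff_mult: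
  assumes "cutoff \<psi>" "cutoff \<phi>"
  shows "cutoff (\<lambda>\<xi>. \<psi> \<xi> * \<phi> \<xi>)"
  unfolding cutoff_def
proof (intro conjI)
  show "smooth_on UNIV (\<lambda>\<xi>. \<psi> \<xi> * \<phi> \<xi>)"
    using assms by (intro smooth_on_mult) (auto simp: cutoff_def)
  have "\<forall>\<^sub>F \<xi> in nhds 0. \<psi> \<xi> = 0" using assms unfolding cutoff_def by auto
  then show "\<forall>\<^sub>F \<xi> in nhds 0. \<psi> \<xi> * \<phi> \<xi> = 0" by eventually_elim simp
  show "\<forall>\<xi>. 1 \<le> norm \<xi> \<longrightarrow> \<psi> \<xi> * \<phi> \<xi> = 1"
    using assms by (simp add: cutoff_eq_1)
qed

lemma cutoff_homogeneous_symbol: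
  fixes h :: "real^'n::{finite,linorder} \<Rightarrow> complex"
  assumes "cutoff \<psi>" "smooth_on (- {0}) h" "pos_homogeneous b h"
  shows "(\<lambda>\<xi>. of_real (\<psi> \<xi>) * h \<xi>) \<in> symbols b"
proof (rule symbolsI[OF smooth_on_cutoff_mult[OF assms(1,2)]])
  fix js
  obtain C where C: "\<xi> \<noteq> 0 \<Longrightarrow> norm (iter_pderiv js h \<xi>) \<le> C * norm \<xi> powr (Re b - real (length js))" for \<xi>
    using pos_homogeneous_bound[OF smooth_on_continuous[OF smooth_on_iter_pderiv[OF assms(2)]]
        pos_homogeneous_iter_pderiv[OF assms(2,3)], of js] by auto
  have op: "open {\<xi>::real^'n::{finite,linorder}. 1 < norm \<xi>}"
    by (intro open_Collect_less continuous_intros)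
  have "iter_pderiv js (\<lambda>\<xi>. of_real (\<psi> \<xi>) * h \<xi>) \<xi> = iter_pderiv js h \<xi>" if "norm \<xi> > 1" for \<xi>
    using that by (intro iter_pderiv_cong_open[OF op]) (auto simp: cutoff_eq_1[OF assms(1)])
  then show "\<exists>C. \<forall>\<xi>. norm \<xi> > 1 \<longrightarrow> norm (iter_pderiv js (\<lambda>\<xi>. of_real (\<psi> \<xi>) * h \<xi>) \<xi>)
      \<le> C * norm \<xi> powr (Re b - real (length js))"
    using C by (metis norm_zero not_one_less_zero)
qed

section \<open>The algebra of classical symbols\<close>

lemma smoothing_in_CS: "f \<in> CS_smoothing \<Longrightarrow> f \<in> CS"
  unfolding CS_smoothing_def by (auto intro: CS_base)

text \<open>Exchanging the cutoff changes a symbol only on the unit ball.\<close>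
lemma cutoff_difference_symbol:
  fixes g :: "real^'n::{finite,linorder} \<Rightarrow> complex"
  assumes "cutoff \<psi>" "cutoff \<phi>" "smooth_on (- {0}) g"
  shows "(\<lambda>\<xi>. (of_real (\<psi> \<xi>) - of_real (\<phi> \<xi>)) * g \<xi>) \<in> symbols a"
proof (rule bounded_support_symbols[where R = 1])
  show "smooth_on UNIV (\<lambda>\<xi>. (of_real (\<psi> \<xi>) - of_real (\<phi> \<xi>)) * g \<xi>)"
    using smooth_on_diff[OF open_UNIV smooth_on_cutoff_mult[OF assms(1,3)] smooth_on_cutoff_mult[OF assms(2,3)]]
    by (simp add: left_diff_distrib)
qed (use assms in \<open>auto simp: cutoff_eq_1\<close>)

lemma classical_expansion_any_cutoff:
  fixes \<sigma> :: "real^'n::{finite,linorder} \<Rightarrow> complex"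
  assumes "classical_expansion a h \<sigma>" "cutoff \<psi>"
  shows "(\<lambda>\<xi>. \<sigma> \<xi> - (\<Sum>j<N. of_real (\<psi> \<xi>) * h j \<xi>)) \<in> symbols (a - of_nat N)"
proof -
  obtain \<phi> where \<phi>: "cutoff \<phi>"
     "(\<lambda>\<xi>. \<sigma> \<xi> - (\<Sum>j<N. of_real (\<phi> \<xi>) * h j \<xi>)) \<in> symbols (a - of_nat N)"
    using assms(1) unfolding classical_expansion_def by blast
  have "(\<lambda>\<xi>. \<sigma> \<xi> - (\<Sum>j<N. of_real (\<phi> \<xi>) * h j \<xi>)
        + (\<Sum>j<N. (of_real (\<phi> \<xi>) - of_real (\<psi> \<xi>)) * h j \<xi>)) \<in> symbols (a - of_nat N)"
    using assms \<phi> by (intro symbols_add symbols_sum cutoff_difference_symbol)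
                     (auto simp: classical_expansion_def)
  then show ?thesis by (simp add: left_diff_distrib sum_subtractf)
qed

lemma classical_expansionI:
  assumes "\<And>j. smooth_on (- {0}) (h j)" "\<And>j. pos_homogeneous (a - of_nat j) (h j)" "cutoff \<psi>"
    and "\<And>N. (\<lambda>\<xi>. \<sigma> \<xi> - (\<Sum>j<N. of_real (\<psi> \<xi>) * h j \<xi>)) \<in> symbols (a - of_nat N)"
  shows "\<sigma> \<in> symbols a" "classical_expansion a h \<sigma>" "\<sigma> \<in> CS_order a"
proof -
  show "\<sigma> \<in> symbols a" using assms(4)[of 0] by simp
  moreover show "classical_expansion a h \<sigma>" unfolding classical_expansion_def using assms by blast
  ultimately show "\<sigma> \<in> CS_order a" unfolding CS_order_def by blast
qed

lemma smoothingI: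
  fixes f :: "real^'n::{finite,linorder} \<Rightarrow> complex" and \<psi> :: "real^'n::{finite,linorder} \<Rightarrow> real"
  assumes "cutoff \<psi>" "\<And>a. f \<in> symbols a"
  shows "f \<in> CS_smoothing"
  unfolding CS_smoothing_def
proof
  fix a
  show "f \<in> CS_order a"
    by (rule classical_expansionI(3)[where h = "\<lambda>_ _. 0", OF _ _ assms(1)])
       (auto simp: smooth_on_const pos_homogeneous_zero assms(2))
qed

lemma bounded_support_smoothing:
  fixes f :: "real^'n::{finite,linorder} \<Rightarrow> complex" and \<psi> :: "real^'n::{finite,linorder} \<Rightarrow> real"
  assumes "cutoff \<psi>" "smooth_on UNIV f" "\<And>\<xi>. norm \<xi> > R \<Longrightarrow> f \<xi> = 0"
  shows "f \<in> CS_smoothing"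
  using smoothingI[OF assms(1)] bounded_support_symbols[OF assms(2,3)] .

lemma classical_expansion_smooth: "classical_expansion a h \<sigma> \<Longrightarrow> smooth_on (- {0}) (h j)"
  and classical_expansion_homogeneous: "classical_expansion a h \<sigma> \<Longrightarrow> pos_homogeneous (a - of_nat j) (h j)"
  unfolding classical_expansion_def by auto

lemmas classical_expansionD = classical_expansion_smooth classical_expansion_homogeneous
  classical_expansion_any_cutoff

lemma CS_orderE:
  assumes "\<sigma> \<in> CS_order a"
  obtains h where "classical_expansion a h \<sigma>"
  using assms unfolding CS_order_def by blast

lemma CS_order_symbols: "\<sigma> \<in> CS_order a \<Longrightarrow> \<sigma> \<in> symbols a"
  by (simp add: CS_order_def)

lemma CS_order_cutoff:
  fixes \<sigma> :: "real^'n::{finite,linorder} \<Rightarrow> complex"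
  assumes "\<sigma> \<in> CS_order a"
  obtains \<psi> :: "real^'n::{finite,linorder} \<Rightarrow> real" where "cutoff \<psi>"
proof -
  obtain h where "classical_expansion a h \<sigma>" using assms unfolding CS_order_def by blast
  then show ?thesis using that unfolding classical_expansion_def by blast
qed

lemma cutoff_homogeneous_CS_order:
  fixes h :: "real^'n::{finite,linorder} \<Rightarrow> complex"
  assumes "cutoff \<psi>" "smooth_on (- {0}) h" "pos_homogeneous b h"
  defines "g \<equiv> \<lambda>j::nat. if j = 0 then h else (\<lambda>_. 0)"
  shows "classical_expansion b g (\<lambda>\<xi>. of_real (\<psi> \<xi>) * h \<xi>)"
    and "(\<lambda>\<xi>. of_real (\<psi> \<xi>) * h \<xi>) \<in> CS_order b"
proof -
  have "(\<Sum>j<N. of_real (\<psi> \<xi>) * g j \<xi>) = (if N = 0 then 0 else of_real (\<psi> \<xi>) * h \<xi>)" for N \<xi>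
    by (cases N) (auto simp: g_def sum.lessThan_Suc_shift simp del: sum.lessThan_Suc)
  then have "(\<lambda>\<xi>. of_real (\<psi> \<xi>) * h \<xi> - (\<Sum>j<N. of_real (\<psi> \<xi>) * g j \<xi>)) \<in> symbols (b - of_nat N)" for N
    using cutoff_homogeneous_symbol[OF assms(1-3)] by (cases "N = 0") (auto simp: symbols_zero)
  with classical_expansionI[of g b \<psi>] assms
  show "classical_expansion b g (\<lambda>\<xi>. of_real (\<psi> \<xi>) * h \<xi>)" "(\<lambda>\<xi>. of_real (\<psi> \<xi>) * h \<xi>) \<in> CS_order b"
    by (auto simp: g_def smooth_on_const pos_homogeneous_zero)
qed

lemma coord_in_CS:
  assumes "cutoff (\<psi> :: real^'n::{finite,linorder} \<Rightarrow> real)"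
  shows "(\<lambda>\<xi>::real^'n::{finite,linorder}. complex_of_real (\<xi> $ i)) \<in> CS"
proof -
  have "(\<lambda>\<xi>::real^'n::{finite,linorder}. of_real (\<psi> \<xi>) * complex_of_real (\<xi> $ i)) \<in> CS"
    by (rule CS_base[OF cutoff_homogeneous_CS_order(2)[OF assms _ pos_homogeneous_coord]]) (simp add: smooth_on_coord open_Compl)
  moreover have "(\<lambda>\<xi>::real^'n::{finite,linorder}. (1 - complex_of_real (\<psi> \<xi>)) * complex_of_real (\<xi> $ i)) \<in> CS"
    by (intro smoothing_in_CS bounded_support_smoothing[OF assms, where R = 1] smooth_on_intros cutoff_smooth[OF assms])
       (auto simp: cutoff_eq_1[OF assms])
  ultimately show ?thesis by (auto dest: CS_add simp: algebra_simps)
qed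

lemma CS_order_cmult:
  fixes \<sigma> :: "real^'n::{finite,linorder} \<Rightarrow> complex"
  assumes "\<sigma> \<in> CS_order a"
  shows "(\<lambda>\<xi>. c * \<sigma> \<xi>) \<in> CS_order a"
proof -
  obtain h where "classical_expansion a h \<sigma>" using CS_orderE[OF assms] .
  note h = classical_expansionD[OF this]
  obtain \<psi> :: "real^'n::{finite,linorder} \<Rightarrow> real" where \<psi>: "cutoff \<psi>" using CS_order_cutoff[OF assms] .
  show ?thesis
  proof (rule classical_expansionI(3)[OF _ _ \<psi>])
    fix j N
    show "smooth_on (- {0}) (\<lambda>\<xi>. c * h j \<xi>)" by (intro smooth_on_intros h) auto
    show "pos_homogeneous (a - of_nat j) (\<lambda>\<xi>. c * h j \<xi>)" by (intro pos_homogeneous_cmult h)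
    show "(\<lambda>\<xi>. c * \<sigma> \<xi> - (\<Sum>j<N. of_real (\<psi> \<xi>) * (c * h j \<xi>))) \<in> symbols (a - of_nat N)"
      using symbols_cmult[OF h(3)[OF \<psi>, of N], of c]
      by (simp add: right_diff_distrib sum_distrib_left mult.left_commute)
  qed
qed

text \<open>The products of components of total index at least \<open>N\<close> have low order, the cross terms with a remainder
  too, and the remaining terms carry the cutoff \<open>\<psi>\<^sup>2\<close> in place of \<open>\<psi>\<close>.\<close>
lemma CS_order_mult:
  fixes \<sigma> :: "real^'n::{finite,linorder} \<Rightarrow> complex"
  assumes "\<sigma> \<in> CS_order a" "\<tau> \<in> CS_order b"
  shows "(\<lambda>\<xi>. \<sigma> \<xi> * \<tau> \<xi>) \<in> CS_order (a + b)"
proof -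
  obtain h where "classical_expansion a h \<sigma>" using CS_orderE[OF assms(1)] .
  note h = classical_expansionD[OF this]
  obtain g where "classical_expansion b g \<tau>" using CS_orderE[OF assms(2)] .
  note g = classical_expansionD[OF this]
  obtain \<psi> :: "real^'n::{finite,linorder} \<Rightarrow> real" where \<psi>: "cutoff \<psi>" using CS_order_cutoff[OF assms(1)] .
  define k where "k m \<xi> = (\<Sum>i\<le>m. h i \<xi> * g (m - i) \<xi>)" for m \<xi>
  have hg: "pos_homogeneous (a + b - of_nat (i + j)) (\<lambda>\<xi>. h i \<xi> * g j \<xi>)" for i j
    using pos_homogeneous_mult[OF h(2) g(2), of i j] by (simp add: algebra_simps)
  have smhg: "smooth_on (- {0}) (\<lambda>\<xi>. h i \<xi> * g j \<xi>)" for i j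
    by (intro smooth_on_intros h g) auto
  show ?thesis
  proof (rule classical_expansionI(3)[OF _ _ \<psi>])
    fix m :: nat
    show "smooth_on (- {0}) (k m)" unfolding k_def[abs_def] by (intro smooth_on_sum smhg) auto
    show "pos_homogeneous (a + b - of_nat m) (k m)" unfolding k_def[abs_def]
      by (intro pos_homogeneous_sum) (use hg in \<open>metis atMost_iff le_add_diff_inverse\<close>)
  next
    fix N :: nat
    define P where "P \<xi> = (\<Sum>j<N. of_real (\<psi> \<xi>) * h j \<xi>)" for \<xi>
    define Q where "Q \<xi> = (\<Sum>j<N. of_real (\<psi> \<xi>) * g j \<xi>)" for \<xi>
    define H where "H = {p \<in> {..<N} \<times> {..<N}. fst p + snd p \<ge> N}"
    define L where "L = {p::nat \<times> nat. fst p + snd p < N}"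
    have HL: "H \<union> L = {..<N} \<times> {..<N}" "H \<inter> L = {}" "finite H" "finite L"
    proof -
      show "H \<union> L = {..<N} \<times> {..<N}" by (auto simp: H_def L_def)
      then show "finite H" "finite L" by (metis finite_SigmaI finite_Un finite_lessThan)+
    qed (auto simp: H_def L_def)
    have "P \<xi> * Q \<xi> - (\<Sum>m<N. of_real (\<psi> \<xi>) * k m \<xi>)
      = (\<Sum>(i,j)\<in>H. of_real (\<psi> \<xi> * \<psi> \<xi>) * (h i \<xi> * g j \<xi>))
        + (\<Sum>(i,j)\<in>L. (of_real (\<psi> \<xi> * \<psi> \<xi>) - of_real (\<psi> \<xi>)) * (h i \<xi> * g j \<xi>))" for \<xi>
    proof -
      have "P \<xi> * Q \<xi> = (\<Sum>(i,j)\<in>{..<N} \<times> {..<N}. of_real (\<psi> \<xi> * \<psi> \<xi>) * (h i \<xi> * g j \<xi>))"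
        unfolding P_def Q_def sum_product sum.cartesian_product by (simp add: mult_ac)
      also have "\<dots> = (\<Sum>(i,j)\<in>H. of_real (\<psi> \<xi> * \<psi> \<xi>) * (h i \<xi> * g j \<xi>))
          + (\<Sum>(i,j)\<in>L. of_real (\<psi> \<xi> * \<psi> \<xi>) * (h i \<xi> * g j \<xi>))"
        unfolding HL(1)[symmetric] using HL by (intro sum.union_disjoint) auto
      moreover have "(\<Sum>m<N. of_real (\<psi> \<xi>) * k m \<xi>) = (\<Sum>(i,j)\<in>L. of_real (\<psi> \<xi>) * (h i \<xi> * g j \<xi>))"
        unfolding k_def sum_distrib_left L_def
        using sum.triangle_reindex[of "\<lambda>i j. of_real (\<psi> \<xi>) * (h i \<xi> * g j \<xi>)" N]
        by (simp add: case_prod_unfold)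
      ultimately show ?thesis
        by (simp add: left_diff_distrib sum_subtractf case_prod_unfold)
    qed
    then have eq: "\<sigma> \<xi> * \<tau> \<xi> - (\<Sum>m<N. of_real (\<psi> \<xi>) * k m \<xi>)
      = (\<sigma> \<xi> - P \<xi>) * \<tau> \<xi> + P \<xi> * (\<tau> \<xi> - Q \<xi>)
        + ((\<Sum>(i,j)\<in>H. of_real (\<psi> \<xi> * \<psi> \<xi>) * (h i \<xi> * g j \<xi>))
        + (\<Sum>(i,j)\<in>L. (of_real (\<psi> \<xi> * \<psi> \<xi>) - of_real (\<psi> \<xi>)) * (h i \<xi> * g j \<xi>)))" for \<xi>
      by (simp add: algebra_simps)
    have 1: "(\<lambda>\<xi>. (\<sigma> \<xi> - P \<xi>) * \<tau> \<xi>) \<in> symbols (a + b - of_nat N)"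
      using symbols_mult[OF h(3)[OF \<psi>, of N], of \<tau> b] assms(2)
      unfolding P_def CS_order_def by (simp add: algebra_simps)
    have "P \<in> symbols a" unfolding P_def[abs_def]
      by (intro symbols_sum symbols_mono[OF cutoff_homogeneous_symbol[OF \<psi> h(1,2)]]) simp
    from symbols_mult[OF this g(3)[OF \<psi>, of N]]
    have 2: "(\<lambda>\<xi>. P \<xi> * (\<tau> \<xi> - Q \<xi>)) \<in> symbols (a + b - of_nat N)"
      unfolding Q_def by (simp add: algebra_simps)
    have 3: "(\<lambda>\<xi>. \<Sum>p\<in>H. of_real (\<psi> \<xi> * \<psi> \<xi>) * (h (fst p) \<xi> * g (snd p) \<xi>)) \<in> symbols (a + b - of_nat N)"
      by (intro symbols_sum symbols_mono[OF cutoff_homogeneous_symbol[OF cutoff_mult[OF \<psi> \<psi>] smhg hg]])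
         (auto simp: H_def)
    have 4: "(\<lambda>\<xi>. \<Sum>p\<in>L. (of_real (\<psi> \<xi> * \<psi> \<xi>) - of_real (\<psi> \<xi>)) * (h (fst p) \<xi> * g (snd p) \<xi>)) \<in> symbols (a + b - of_nat N)"
      by (intro symbols_sum cutoff_difference_symbol[OF cutoff_mult[OF \<psi> \<psi>] \<psi> smhg])
    show "(\<lambda>\<xi>. \<sigma> \<xi> * \<tau> \<xi> - (\<Sum>m<N. of_real (\<psi> \<xi>) * k m \<xi>)) \<in> symbols (a + b - of_nat N)"
      unfolding eq case_prod_unfold by (intro symbols_add 1 2 3 4)
  qed
qed

text \<open>Products of classical symbols are classical, hence sums of classical symbols already form the algebra.\<close>
lemma CS_sum_induct [consumes 1, case_names classical add]:
  fixes \<sigma> :: "real^'n::{finite,linorder} \<Rightarrow> complex"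
  assumes "\<sigma> \<in> CS"
    and base: "\<And>\<sigma> a. \<sigma> \<in> CS_order a \<Longrightarrow> P \<sigma>"
    and add: "\<And>\<sigma> \<tau>. \<sigma> \<in> CS \<Longrightarrow> \<tau> \<in> CS \<Longrightarrow> P \<sigma> \<Longrightarrow> P \<tau> \<Longrightarrow> P (\<lambda>\<xi>. \<sigma> \<xi> + \<tau> \<xi>)"
  shows "P \<sigma>"
proof -
  \<comment> \<open>The sums of classical symbols, as the least set with the two closure properties.\<close>
  define Sums :: "(real^'n::{finite,linorder} \<Rightarrow> complex) set" where
    "Sums = {\<sigma>. \<forall>Q. (\<forall>\<tau> a. \<tau> \<in> CS_order a \<longrightarrow> Q \<tau>) \<longrightarrow> (\<forall>\<sigma> \<tau>. Q \<sigma> \<longrightarrow> Q \<tau> \<longrightarrow> Q (\<lambda>\<xi>. \<sigma> \<xi> + \<tau> \<xi>)) \<longrightarrow> Q \<sigma>}"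
  have I: "\<tau> \<in> CS_order a \<Longrightarrow> \<tau> \<in> Sums" for \<tau> a unfolding Sums_def by blast
  have A: "\<sigma> \<in> Sums \<Longrightarrow> \<tau> \<in> Sums \<Longrightarrow> (\<lambda>\<xi>. \<sigma> \<xi> + \<tau> \<xi>) \<in> Sums" for \<sigma> \<tau>
    unfolding Sums_def by blast
  have ind: "Q \<sigma>" if "\<sigma> \<in> Sums" "\<And>\<tau> a. \<tau> \<in> CS_order a \<Longrightarrow> Q \<tau>" "\<And>\<sigma> \<tau>. Q \<sigma> \<Longrightarrow> Q \<tau> \<Longrightarrow> Q (\<lambda>\<xi>. \<sigma> \<xi> + \<tau> \<xi>)"
    for \<sigma> Q using that unfolding Sums_def by blast
  have scale: "(\<lambda>\<xi>. c * \<sigma> \<xi>) \<in> Sums" if "\<sigma> \<in> Sums" for c \<sigma>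
    by (rule ind[OF that]) (auto simp: distrib_left intro: I A CS_order_cmult)
  have mult: "(\<lambda>\<xi>. \<sigma> \<xi> * \<tau> \<xi>) \<in> Sums" if "\<sigma> \<in> Sums" "\<tau> \<in> Sums" for \<sigma> \<tau>
  proof (rule ind[OF that(1)])
    show "(\<lambda>\<xi>. \<sigma> \<xi> * \<tau> \<xi>) \<in> Sums" if "\<sigma> \<in> CS_order a" for \<sigma> a
      by (rule ind[OF \<open>\<tau> \<in> Sums\<close>]) (auto simp: distrib_left intro: I A CS_order_mult that)
  qed (auto simp: distrib_right intro: A)
  have "\<sigma> \<in> Sums" using assms(1)
    by induction (auto intro: I A scale mult)
  then have "\<sigma> \<in> CS \<and> P \<sigma>"
    by (rule ind) (auto intro: base add CS_base CS_add)
  then show ?thesis by blast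
qed

text \<open>The components of a derivative are the derivatives of the components; the derivatives of the cutoff
  live on the unit ball.\<close>
lemma CS_order_pderiv:
  fixes \<sigma> :: "real^'n::{finite,linorder} \<Rightarrow> complex"
  assumes "\<sigma> \<in> CS_order a"
  shows "pderiv_at i \<sigma> \<in> CS_order (a - 1)"
proof -
  obtain h where "classical_expansion a h \<sigma>" using CS_orderE[OF assms] .
  note h = classical_expansionD[OF this] and sm = CS_order_symbols[OF assms]
  obtain \<psi> :: "real^'n::{finite,linorder} \<Rightarrow> real" where \<psi>: "cutoff \<psi>" using CS_order_cutoff[OF assms(1)] .
  note sm\<psi> = smooth_on_differentiable[OF cutoff_smooth[OF \<psi>]]
  show ?thesis
  proof (rule classical_expansionI(3)[OF _ _ \<psi>])
    fix j :: nat
    show "smooth_on (- {0}) (pderiv_at i (h j))" by (intro smooth_on_intros h)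
    show "pos_homogeneous (a - 1 - of_nat j) (pderiv_at i (h j))"
      using pos_homogeneous_pderiv[OF h(1,2), of j i] by (simp add: algebra_simps)
  next
    fix N :: nat
    have smh: "smooth_on UNIV (\<lambda>\<xi>. of_real (\<psi> \<xi>) * h j \<xi>)" for j
      by (intro smooth_on_cutoff_mult \<psi> h)
    have "pderiv_at i (\<lambda>\<xi>. \<sigma> \<xi> - (\<Sum>j<N. of_real (\<psi> \<xi>) * h j \<xi>))
       = (\<lambda>\<xi>. pderiv_at i \<sigma> \<xi> - (\<Sum>j<N. pderiv_at i (\<lambda>\<xi>. of_real (\<psi> \<xi>) * h j \<xi>) \<xi>))"
      using smooth_on_differentiable[OF smh] smooth_on_differentiable[OF symbols_smooth[OF sm]]
      by (intro ext, subst pderiv_at_diff) (auto simp: pderiv_at_sum intro!: differentiable_sum)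
    then have main: "(\<lambda>\<xi>. pderiv_at i \<sigma> \<xi> - (\<Sum>j<N. pderiv_at i (\<lambda>\<xi>. of_real (\<psi> \<xi>) * h j \<xi>) \<xi>))
        \<in> symbols (a - 1 - of_nat N)"
      using symbols_pderiv[OF h(3)[OF \<psi>, of N], of i] by (simp add: algebra_simps)
    have rest: "(\<lambda>\<xi>. pderiv_at i (\<lambda>\<xi>. of_real (\<psi> \<xi>) * h j \<xi>) \<xi> - of_real (\<psi> \<xi>) * pderiv_at i (h j) \<xi>) \<in> symbols (a - 1 - of_nat N)" for j
    proof (rule bounded_support_symbols[where R = 1])
      show "smooth_on UNIV (\<lambda>\<xi>. pderiv_at i (\<lambda>\<xi>. of_real (\<psi> \<xi>) * h j \<xi>) \<xi> - of_real (\<psi> \<xi>) * pderiv_at i (h j) \<xi>)"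
        by (intro smooth_on_diff smooth_on_pderiv[OF smh] smooth_on_cutoff_mult \<psi> smooth_on_pderiv h) auto
      fix \<xi> :: "real^'n::{finite,linorder}" assume "norm \<xi> > 1"
      moreover have "open {\<xi>::real^'n::{finite,linorder}. 1 < norm \<xi>}"
        by (intro open_Collect_less continuous_intros)
      ultimately have "pderiv_at i (\<lambda>\<xi>. of_real (\<psi> \<xi>) * h j \<xi>) \<xi> = pderiv_at i (h j) \<xi>"
        by (intro pderiv_at_cong_open[of "{\<xi>. 1 < norm \<xi>}"]) (auto simp: cutoff_eq_1[OF \<psi>])
      then show "pderiv_at i (\<lambda>\<xi>. of_real (\<psi> \<xi>) * h j \<xi>) \<xi> - of_real (\<psi> \<xi>) * pderiv_at i (h j) \<xi> = 0"
        using \<open>norm \<xi> > 1\<close> by (simp add: cutoff_eq_1[OF \<psi>])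
    qed
    have "(\<lambda>\<xi>. (pderiv_at i \<sigma> \<xi> - (\<Sum>j<N. pderiv_at i (\<lambda>\<xi>. of_real (\<psi> \<xi>) * h j \<xi>) \<xi>))
        + (\<Sum>j<N. pderiv_at i (\<lambda>\<xi>. of_real (\<psi> \<xi>) * h j \<xi>) \<xi> - of_real (\<psi> \<xi>) * pderiv_at i (h j) \<xi>)) \<in> symbols (a - 1 - of_nat N)"
      by (intro symbols_add symbols_sum main rest)
    then show "(\<lambda>\<xi>. pderiv_at i \<sigma> \<xi> - (\<Sum>j<N. of_real (\<psi> \<xi>) * pderiv_at i (h j) \<xi>)) \<in> symbols (a - 1 - of_nat N)"
      by (simp add: sum_subtractf)
  qed
qed

lemma CS_smooth: "\<sigma> \<in> CS \<Longrightarrow> smooth_on UNIV \<sigma>"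
  by (induction rule: CS_sum_induct) (auto simp: CS_order_def intro: symbols_smooth smooth_on_add)

lemma CS_pderiv: "\<sigma> \<in> CS \<Longrightarrow> pderiv_at i \<sigma> \<in> CS"
proof (induction rule: CS_sum_induct)
  case (classical \<sigma> a)
  then show ?case using CS_order_pderiv CS_base by blast
next
  case (add \<sigma> \<tau>)
  have "pderiv_at i (\<lambda>\<xi>. \<sigma> \<xi> + \<tau> \<xi>) = (\<lambda>\<xi>. pderiv_at i \<sigma> \<xi> + pderiv_at i \<tau> \<xi>)"
    using add smooth_on_differentiable[OF CS_smooth] by (auto intro!: pderiv_at_add)
  then show ?case using add CS_add by metis
qed

lemma CS_diff: "\<sigma> \<in> CS \<Longrightarrow> \<tau> \<in> CS \<Longrightarrow> (\<lambda>\<xi>. \<sigma> \<xi> - \<tau> \<xi>) \<in> CS"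
  using CS_add[OF _ CS_scale[of _ "-1"]] by simp

lemma CS_sum:
  fixes f :: "'k \<Rightarrow> real^'n::{finite,linorder} \<Rightarrow> complex"
  shows "(\<lambda>_::real^'n::{finite,linorder}. 0) \<in> CS \<Longrightarrow> (\<And>k. k \<in> K \<Longrightarrow> f k \<in> CS) \<Longrightarrow> (\<lambda>\<xi>. \<Sum>k\<in>K. f k \<xi>) \<in> CS"
  by (induction K rule: infinite_finite_induct) (auto intro: CS_add)

text \<open>This splits a classical symbol into finitely many components and a classical symbol whose order is as
  low as desired.\<close>
lemma classical_remainder:
  fixes \<sigma> :: "real^'n::{finite,linorder} \<Rightarrow> complex"
  assumes "classical_expansion a h \<sigma>" "cutoff \<psi>"
  shows "(\<lambda>\<xi>. \<sigma> \<xi> - (\<Sum>j<N. of_real (\<psi> \<xi>) * h j \<xi>)) \<in> CS_order (a - of_nat N)"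
proof (rule classical_expansionI(3)[where h = "\<lambda>j. h (N + j)", OF _ _ assms(2)])
  fix j :: nat
  show "smooth_on (- {0}) (h (N + j))" "pos_homogeneous (a - of_nat N - of_nat j) (h (N + j))"
    using assms(1) unfolding classical_expansion_def by (auto simp: algebra_simps dest: spec[of _ "N + j"])
next
  fix M :: nat
  have "(\<Sum>j<N + M. of_real (\<psi> \<xi>) * h j \<xi>)
      = (\<Sum>j<N. of_real (\<psi> \<xi>) * h j \<xi>) + (\<Sum>j<M. of_real (\<psi> \<xi>) * h (N + j) \<xi>)" for \<xi>
    by (induction M) auto
  then show "(\<lambda>\<xi>. \<sigma> \<xi> - (\<Sum>j<N. of_real (\<psi> \<xi>) * h j \<xi>) - (\<Sum>j<M. of_real (\<psi> \<xi>) * h (N + j) \<xi>))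
       \<in> symbols (a - of_nat N - of_nat M)"
    using classical_expansion_any_cutoff[OF assms, of "N + M"] by (simp add: algebra_simps)
qed

section \<open>Integrals along rays\<close>

text \<open>The integral of \<open>t\<^sup>k \<sigma>(t \<xi>)\<close> over the part \<open>t \<le> 1\<close> of the ray, which is smooth at the origin.\<close>
definition inner_radial :: "nat \<Rightarrow> (real^'n::finite \<Rightarrow> complex) \<Rightarrow> real^'n \<Rightarrow> complex"
  where "inner_radial k \<sigma> \<xi> = integral {0..1} (\<lambda>t. of_real t ^ k * \<sigma> (t *\<^sub>R \<xi>))"

text \<open>The integral of \<open>t\<^sup>k\<^sup>-\<^sup>2 \<sigma>(t \<xi>)\<close> over \<open>t \<ge> 1\<close>, after the substitution \<open>t = 1/s\<close>. The compact range of
  \<open>s\<close> makes the theorems on parametric integrals applicable: for a symbol of low order the integrand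
  extends continuously to \<open>s = 0\<close>.\<close>
definition outer_radial :: "nat \<Rightarrow> (real^'n::finite \<Rightarrow> complex) \<Rightarrow> real^'n \<Rightarrow> complex"
  where "outer_radial k \<sigma> \<xi> = integral {0..1} (\<lambda>s. of_real (inverse s) ^ k * \<sigma> (inverse s *\<^sub>R \<xi>))"

text \<open>The integral of \<open>t\<^sup>k\<^sup>-\<^sup>1 \<sigma>(t \<xi>)\<close> over all \<open>t > 0\<close>, a function of degree \<open>-k\<close>.\<close>
definition ray_integral :: "nat \<Rightarrow> (real^'n::finite \<Rightarrow> complex) \<Rightarrow> real^'n \<Rightarrow> complex"
  where "ray_integral k \<sigma> \<xi> = inner_radial (k - 1) \<sigma> \<xi> + outer_radial (k + 1) \<sigma> \<xi>"

lemma
  fixes \<sigma> :: "real^'n::finite \<Rightarrow> complex"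
  assumes "smooth_on UNIV \<sigma>"
  shows smooth_on_dilate: "smooth_on UNIV (\<lambda>\<xi>. of_real c ^ k * \<sigma> (c *\<^sub>R \<xi>))"
    and iter_pderiv_dilate: "iter_pderiv js (\<lambda>\<xi>. of_real c ^ k * \<sigma> (c *\<^sub>R \<xi>)) \<xi>
      = of_real c ^ (k + length js) * iter_pderiv js \<sigma> (c *\<^sub>R \<xi>)"
proof -
  have s: "smooth_on UNIV (\<lambda>\<xi>. \<sigma> (c *\<^sub>R \<xi>))"
    using smooth_on_affine[OF open_UNIV assms, of c 0] by simp
  then show "smooth_on UNIV (\<lambda>\<xi>. of_real c ^ k * \<sigma> (c *\<^sub>R \<xi>))"
    by (intro smooth_on_mult smooth_on_const) auto
  show "iter_pderiv js (\<lambda>\<xi>. of_real c ^ k * \<sigma> (c *\<^sub>R \<xi>)) \<xi>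
      = of_real c ^ (k + length js) * iter_pderiv js \<sigma> (c *\<^sub>R \<xi>)"
    using iter_pderiv_bounded_linear[OF open_UNIV bounded_linear_mult_right s, of \<xi> js "of_real c ^ k"]
      iter_pderiv_affine[OF open_UNIV assms, of c \<xi> 0 js]
    by (simp add: power_add mult.assoc)
qed

lemma continuous_on_inner_integrand:
  fixes \<tau> :: "real^'n::finite \<Rightarrow> complex"
  assumes "continuous_on UNIV \<tau>"
  shows "continuous_on A (\<lambda>(\<xi>,t). of_real t ^ k * \<tau> (t *\<^sub>R \<xi>))"
  unfolding case_prod_unfold
  by (intro continuous_intros continuous_on_compose2[OF assms]) auto

lemma
  fixes \<sigma> :: "real^'n::finite \<Rightarrow> complex"
  assumes "smooth_on UNIV \<sigma>"
  shows smooth_on_inner_radial: "smooth_on UNIV (inner_radial k \<sigma>)"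
    and iter_pderiv_inner_radial: "iter_pderiv js (inner_radial k \<sigma>) \<xi> = inner_radial (k + length js) (iter_pderiv js \<sigma>) \<xi>"
proof -
  have 1: "smooth_on UNIV (\<lambda>\<xi>. of_real t ^ k * \<sigma> (t *\<^sub>R \<xi>))" for t :: real
    by (rule smooth_on_dilate[OF assms])
  have 2: "continuous_on (UNIV \<times> cbox 0 1)
     (\<lambda>(\<xi>,t::real). iter_pderiv js (\<lambda>\<xi>. of_real t ^ k * \<sigma> (t *\<^sub>R \<xi>)) \<xi>)" for js
    unfolding iter_pderiv_dilate[OF assms]
    by (rule continuous_on_inner_integrand) (rule smooth_on_continuous[OF smooth_on_iter_pderiv[OF assms]])
  note smooth_on_parametric_integral[OF open_UNIV 1 2]
    and iter_pderiv_parametric_integral[OF open_UNIV 1 2 UNIV_I, of js \<xi>]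
  then show "smooth_on UNIV (inner_radial k \<sigma>)"
    "iter_pderiv js (inner_radial k \<sigma>) \<xi> = inner_radial (k + length js) (iter_pderiv js \<sigma>) \<xi>"
    unfolding inner_radial_def[abs_def] iter_pderiv_dilate[OF assms] by auto
qed

text \<open>Along a ray the integrand of the outer integral is dominated by a power of the parameter, which
  tends to zero when the symbol decays fast enough. At the parameter zero the convention for the
  inverse of zero already gives the integrand its limit.\<close>
lemma outer_integrand_bound:
  fixes \<tau> :: "real^'n::finite \<Rightarrow> complex"
  assumes "\<And>\<eta>. norm (\<tau> \<eta>) \<le> C * (1 + norm \<eta>) powr p" "C \<ge> 0" "p \<le> 0" "\<xi> \<noteq> 0" "s \<ge> 0" "k > 0"
  shows "norm (of_real (inverse s) ^ k * \<tau> (inverse s *\<^sub>R \<xi>)) \<le> C * norm \<xi> powr p * s powr - (real k + p)"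
proof (cases "s = 0")
  case False
  then have s: "s > 0" using assms by simp
  have "norm (\<tau> (inverse s *\<^sub>R \<xi>)) \<le> C * (1 + norm (inverse s *\<^sub>R \<xi>)) powr p" by (rule assms)
  also have "\<dots> \<le> C * (norm (inverse s *\<^sub>R \<xi>)) powr p"
    using assms s by (intro mult_left_mono powr_mono2') auto
  also have "\<dots> = C * norm \<xi> powr p * s powr - p"
    using s by (simp add: powr_mult powr_minus inverse_powr)
  finally have "norm (of_real (inverse s) ^ k * \<tau> (inverse s *\<^sub>R \<xi>)) \<le> inverse s ^ k * (C * norm \<xi> powr p * s powr - p)"
    using s by (simp add: norm_mult norm_power norm_inverse mult_left_mono)
  also have "inverse s ^ k = s powr - real k"
    using s by (simp add: powr_minus powr_realpow power_inverse)
  also have "s powr - real k * (C * norm \<xi> powr p * s powr - p) = C * norm \<xi> powr p * s powr - (real k + p)"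
    by (simp add: powr_add[symmetric])
  finally show ?thesis .
qed (use assms in auto)

lemma continuous_on_outer_integrand:
  fixes \<tau> :: "real^'n::finite \<Rightarrow> complex"
  assumes cont: "continuous_on UNIV \<tau>"
    and bound: "\<And>\<eta>. norm (\<tau> \<eta>) \<le> C * (1 + norm \<eta>) powr p" "C \<ge> 0"
    and p: "real k + p < 0" and k: "k > 0"
  shows "continuous_on ((- {0}) \<times> {0..1}) (\<lambda>(\<xi>,s). of_real (inverse s) ^ k * \<tau> (inverse s *\<^sub>R \<xi>))"
  unfolding continuous_on_def
proof
  let ?A = "(- {0::real^'n}) \<times> {0..1::real}"
  let ?F = "\<lambda>(\<xi>,s). of_real (inverse s) ^ k * \<tau> (inverse s *\<^sub>R \<xi>)"
  fix z assume z: "z \<in> ?A"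
  obtain \<xi> s where zs: "z = (\<xi>, s)" "\<xi> \<noteq> 0" "0 \<le> s" using z by (cases z) auto
  have lim: "(fst \<longlongrightarrow> \<xi>) (at z within ?A)" "(snd \<longlongrightarrow> s) (at z within ?A)"
    using tendsto_fst[OF tendsto_ident_at, of z ?A] tendsto_snd[OF tendsto_ident_at, of z ?A] zs by simp_all
  show "(?F \<longlongrightarrow> ?F z) (at z within ?A)"
  proof (cases "s = 0")
    case False
    have "isCont \<tau> x" for x using cont by (simp add: continuous_on_eq_continuous_at)
    then have "((\<lambda>z. of_real (inverse (snd z)) ^ k * \<tau> (inverse (snd z) *\<^sub>R fst z)) \<longlongrightarrow>
        of_real (inverse s) ^ k * \<tau> (inverse s *\<^sub>R \<xi>)) (at z within ?A)"
      using False by (intro tendsto_intros isCont_tendsto_compose[of _ \<tau>] lim) auto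
    then show ?thesis by (simp add: zs case_prod_unfold)
  next
    case True
    have "((\<lambda>z. C * norm (fst z) powr p * snd z powr - (real k + p)) \<longlongrightarrow>
        C * norm \<xi> powr p * s powr - (real k + p)) (at z within ?A)"
    proof (intro tendsto_intros tendsto_powr' lim)
      show "s \<noteq> 0 \<or> 0 < - (real k + p) \<and> (\<forall>\<^sub>F z in at z within ?A. 0 \<le> snd z)"
        using p by (auto simp: eventually_at_filter intro!: always_eventually)
    qed (use zs in auto)
    then have "((\<lambda>z. C * norm (fst z) powr p * snd z powr - (real k + p)) \<longlongrightarrow> 0) (at z within ?A)"
      using True by simp
    moreover have "\<forall>\<^sub>F z in at z within ?A. norm (?F z) \<le> C * norm (fst z) powr p * snd z powr - (real k + p)"
      unfolding eventually_at_filter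
    proof (intro always_eventually allI impI)
      fix w assume "w \<in> ?A"
      then obtain \<eta> r where w: "w = (\<eta>, r)" "\<eta> \<noteq> 0" "0 \<le> r" by (cases w) auto
      show "norm (?F w) \<le> C * norm (fst w) powr p * snd w powr - (real k + p)"
        using outer_integrand_bound[OF bound _ w(2,3) k] p by (simp add: w(1))
    qed
    ultimately have "(?F \<longlongrightarrow> 0) (at z within ?A)"
      by (rule Lim_null_comparison[rotated])
    then show ?thesis using True k by (cases k) (simp_all add: zs)
  qed
qed

lemma continuous_on_outer_symbol:
  fixes \<sigma> :: "real^'n::{finite,linorder} \<Rightarrow> complex"
  assumes "\<sigma> \<in> symbols a" "Re a + real k < 0" "k > 0"
  shows "continuous_on ((- {0}) \<times> {0..1})
    (\<lambda>(\<xi>,s). of_real (inverse s) ^ (k + length js) * iter_pderiv js \<sigma> (inverse s *\<^sub>R \<xi>))"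
proof -
  obtain C where C: "C \<ge> 0" "\<And>\<xi>. norm (iter_pderiv js \<sigma> \<xi>) \<le> C * (1 + norm \<xi>) powr (Re a - real (length js))"
    using symbols_bound[OF assms(1), of js] by blast
  show ?thesis
    by (rule continuous_on_outer_integrand[OF _ C(2,1)])
       (use assms smooth_on_continuous[OF smooth_on_iter_pderiv[OF symbols_smooth[OF assms(1)]]] in auto)
qed

lemma continuous_on_outer_ray:
  fixes \<sigma> :: "real^'n::{finite,linorder} \<Rightarrow> complex"
  assumes "\<sigma> \<in> symbols a" "Re a + real k < 0" "k > 0" "\<xi> \<noteq> 0"
  shows "continuous_on {0..1} (\<lambda>s. of_real (inverse s) ^ (k + length js) * iter_pderiv js \<sigma> (inverse s *\<^sub>R \<xi>))"
proof -
  have p: "continuous_on {0..1} (\<lambda>s::real. (\<xi>, s))" "(\<lambda>s::real. (\<xi>, s)) ` {0..1} \<subseteq> (- {0}) \<times> {0..1}"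
    using assms(4) by (auto intro!: continuous_intros)
  from continuous_on_compose2[OF continuous_on_outer_symbol[OF assms(1-3), of js] p] show ?thesis
    by (simp only: prod.case)
qed

lemma outer_radial_has_integral:
  fixes \<sigma> :: "real^'n::{finite,linorder} \<Rightarrow> complex"
  assumes "\<sigma> \<in> symbols a" "Re a + real k < 0" "k > 0" "\<xi> \<noteq> 0"
  shows "((\<lambda>s. of_real (inverse s) ^ k * \<sigma> (inverse s *\<^sub>R \<xi>)) has_integral outer_radial k \<sigma> \<xi>) {0..1}"
proof -
  have "continuous_on {0..1} (\<lambda>s. of_real (inverse s) ^ k * \<sigma> (inverse s *\<^sub>R \<xi>))"
    using continuous_on_outer_ray[OF assms, of "[]"] by (simp only: list.size iter_pderiv.simps add_0_right)
  then show ?thesis unfolding outer_radial_def by (intro integrable_integral integrable_continuous_real)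
qed

lemma
  fixes \<sigma> :: "real^'n::{finite,linorder} \<Rightarrow> complex"
  assumes "\<sigma> \<in> symbols a" "Re a + real k < 0" "k > 0"
  shows smooth_on_outer_radial: "smooth_on (- {0}) (outer_radial k \<sigma>)"
    and iter_pderiv_outer_radial: "\<xi> \<noteq> 0 \<Longrightarrow>
      iter_pderiv js (outer_radial k \<sigma>) \<xi> = outer_radial (k + length js) (iter_pderiv js \<sigma>) \<xi>"
proof -
  have sm: "smooth_on UNIV \<sigma>" using assms symbols_smooth by blast
  have 0: "open (- {0::real^'n::{finite,linorder}})" by auto
  have 1: "smooth_on (- {0}) (\<lambda>\<xi>. of_real (inverse s) ^ k * \<sigma> (inverse s *\<^sub>R \<xi>))" for s :: real
    using smooth_on_dilate[OF sm] smooth_on_subset by blast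
  have 2: "continuous_on ((- {0}) \<times> cbox 0 1)
     (\<lambda>(\<xi>,s::real). iter_pderiv js (\<lambda>\<xi>. of_real (inverse s) ^ k * \<sigma> (inverse s *\<^sub>R \<xi>)) \<xi>)" for js
    unfolding iter_pderiv_dilate[OF sm] using continuous_on_outer_symbol[OF assms, of js] by simp
  note smooth_on_parametric_integral[OF 0 1 2]
    and iter_pderiv_parametric_integral[OF 0 1 2, of \<xi> js]
  then show "smooth_on (- {0}) (outer_radial k \<sigma>)"
    "\<xi> \<noteq> 0 \<Longrightarrow> iter_pderiv js (outer_radial k \<sigma>) \<xi> = outer_radial (k + length js) (iter_pderiv js \<sigma>) \<xi>"
    unfolding outer_radial_def[abs_def] iter_pderiv_dilate[OF sm] by auto
qed

text \<open>Each derivative of the outer integral is an outer integral of a derivative. The dominating power of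
  \<open>s\<close> for its integrand is at most one.\<close>
lemma outer_radial_bound:
  fixes \<sigma> :: "real^'n::{finite,linorder} \<Rightarrow> complex"
  assumes "\<sigma> \<in> symbols a" "Re a + real k < 0" "k > 0"
  shows "\<exists>C. \<forall>\<xi>. \<xi> \<noteq> 0 \<longrightarrow> norm (iter_pderiv js (outer_radial k \<sigma>) \<xi>) \<le> C * norm \<xi> powr (Re a - real (length js))"
proof -
  let ?K = "k + length js" and ?p = "Re a - real (length js)"
  obtain C where C: "C \<ge> 0" "\<And>\<xi>. norm (iter_pderiv js \<sigma> \<xi>) \<le> C * (1 + norm \<xi>) powr ?p"
    using symbols_bound[OF assms(1), of js] by blast
  have "norm (iter_pderiv js (outer_radial k \<sigma>) \<xi>) \<le> C * norm \<xi> powr ?p" if \<xi>: "\<xi> \<noteq> 0" for \<xi>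
  proof -
    have c: "continuous_on {0..1} (\<lambda>s. of_real (inverse s) ^ ?K * iter_pderiv js \<sigma> (inverse s *\<^sub>R \<xi>))"
      by (rule continuous_on_outer_ray[OF assms \<xi>])
    have "norm (of_real (inverse s) ^ ?K * iter_pderiv js \<sigma> (inverse s *\<^sub>R \<xi>)) \<le> C * norm \<xi> powr ?p"
      if "s \<in> {0..1}" for s
    proof -
      have "norm (of_real (inverse s) ^ ?K * iter_pderiv js \<sigma> (inverse s *\<^sub>R \<xi>))
          \<le> C * norm \<xi> powr ?p * s powr - (real ?K + ?p)"
        using outer_integrand_bound[OF C(2,1) _ \<xi>, of s ?K] assms that by auto
      also have "\<dots> \<le> C * norm \<xi> powr ?p * 1"
        using C(1) assms(2) that by (intro mult_left_mono powr_le1) auto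
      finally show ?thesis by simp
    qed
    from integral_bound[OF _ c this]
    show ?thesis by (simp add: iter_pderiv_outer_radial[OF assms \<xi>] outer_radial_def)
  qed
  then show ?thesis by blast
qed

lemma pderiv_outer_radial:
  fixes \<sigma> :: "real^'n::{finite,linorder} \<Rightarrow> complex"
  assumes "\<sigma> \<in> symbols a" "Re a + real k < 0" "k > 0" "\<xi> \<noteq> 0"
  shows "pderiv_at i (outer_radial k \<sigma>) \<xi> = outer_radial (Suc k) (pderiv_at i \<sigma>) \<xi>"
  using iter_pderiv_outer_radial[OF assms, of "[i]"] by simp

lemma pderiv_inner_radial:
  assumes "smooth_on UNIV \<sigma>"
  shows "pderiv_at i (inner_radial k \<sigma>) \<xi> = inner_radial (Suc k) (pderiv_at i \<sigma>) \<xi>"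
  using iter_pderiv_inner_radial[OF assms, of "[i]"] by simp

lemma inner_radial_has_integral:
  fixes \<sigma> :: "real^'n::finite \<Rightarrow> complex"
  assumes "continuous_on UNIV \<sigma>"
  shows "((\<lambda>t. of_real t ^ k * \<sigma> (t *\<^sub>R \<xi>)) has_integral inner_radial k \<sigma> \<xi>) {0..1}"
  unfolding inner_radial_def
  by (intro integrable_integral integrable_continuous_real continuous_intros continuous_on_compose2[OF assms]) auto

lemma has_vector_derivative_of_real_power:
  "((\<lambda>t. complex_of_real t ^ m) has_vector_derivative of_nat m * of_real t ^ (m - 1)) (at t within T)"
proof -
  have "((\<lambda>z. z ^ m) has_field_derivative of_nat m * complex_of_real t ^ (m - 1)) (at (complex_of_real t))"
    by (auto intro!: derivative_eq_intros)
  from has_vector_derivative_real_field[OF this] show ?thesis .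
qed

text \<open>\<open>t\<^sup>k ((k + 1) g + E g)(t \<xi>)\<close>, where \<open>E\<close> is the Euler operator, is the derivative of \<open>t\<^sup>k\<^sup>+\<^sup>1 g(t \<xi>)\<close>.\<close>
lemma inner_radial_primitive:
  fixes g :: "real^'n::finite \<Rightarrow> complex"
  assumes "smooth_on UNIV g"
  shows "inner_radial k (\<lambda>\<xi>. of_nat (Suc k) * g \<xi> + euler g \<xi>) \<xi> = g \<xi>"
proof -
  let ?G = "\<lambda>t. complex_of_real t ^ Suc k * g (t *\<^sub>R \<xi>)"
  have d: "g differentiable (at x)" for x using assms smooth_on_differentiable by blast
  have "(?G has_vector_derivative of_real t ^ k * (of_nat (Suc k) * g (t *\<^sub>R \<xi>) + euler g (t *\<^sub>R \<xi>))) (at t)"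
    if "t > 0" for t
  proof -
    have "((\<lambda>t. complex_of_real t ^ Suc k) has_vector_derivative of_nat (Suc k) * of_real t ^ k) (at t)"
      using has_vector_derivative_of_real_power[of "Suc k" t UNIV] by simp
    from has_vector_derivative_mult[OF this has_vector_derivative_radial[OF d, of t \<xi> UNIV]]
    show ?thesis using that by (simp add: algebra_simps)
  qed
  moreover have "continuous_on {0..1} ?G"
    by (intro continuous_intros continuous_on_compose2[OF smooth_on_continuous[OF assms]]) auto
  ultimately have "((\<lambda>t. of_real t ^ k * (of_nat (Suc k) * g (t *\<^sub>R \<xi>) + euler g (t *\<^sub>R \<xi>))) has_integral ?G 1 - ?G 0) {0..1}"
    by (intro fundamental_theorem_of_calculus_interior) auto
  then show ?thesis unfolding inner_radial_def using integral_unique by force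
qed

text \<open>The analogue on the outer part of the ray, where the value at infinity \<open>L\<close> enters as a boundary term.\<close>
lemma outer_radial_primitive:
  fixes g :: "real^'n::finite \<Rightarrow> complex"
  assumes "smooth_on UNIV g"
    and L: "((\<lambda>s. of_real (inverse s) ^ k * g (inverse s *\<^sub>R \<xi>)) \<longlongrightarrow> L) (at_right 0)"
  shows "outer_radial (Suc k) (\<lambda>\<xi>. of_nat k * g \<xi> + euler g \<xi>) \<xi> = L - g \<xi>"
proof -
  let ?H = "\<lambda>s. complex_of_real (inverse s) ^ k * g (inverse s *\<^sub>R \<xi>)"
  let ?G = "\<lambda>s. if s = 0 then L else ?H s"
  let ?g = "\<lambda>s. complex_of_real (inverse s) ^ Suc k * (of_nat k * g (inverse s *\<^sub>R \<xi>) + euler g (inverse s *\<^sub>R \<xi>))"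
  have d: "g differentiable (at x)" for x using assms smooth_on_differentiable by blast
  have H: "(?H has_vector_derivative - ?g s) (at s)" if s: "s > 0" for s
  proof -
    have i: "(inverse has_vector_derivative (- (inverse s ^ 2))) (at s)"
      using DERIV_inverse[of s] s by (simp add: has_real_derivative_iff_has_vector_derivative numeral_2_eq_2)
    let ?u = "inverse s"
    have "((\<lambda>t. complex_of_real t ^ k) has_vector_derivative of_nat k * of_real ?u ^ (k - 1)) (at ?u)"
      by (rule has_vector_derivative_of_real_power)
    from has_vector_derivative_mult[OF this has_vector_derivative_radial[OF d, of ?u \<xi> UNIV]]
    have "((\<lambda>t. complex_of_real t ^ k * g (t *\<^sub>R \<xi>)) has_vector_derivative
       (of_real ?u ^ k * (euler g (?u *\<^sub>R \<xi>) / of_real ?u) + of_nat k * of_real ?u ^ (k - 1) * g (?u *\<^sub>R \<xi>))) (at ?u)"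
      using s by simp
    from vector_diff_chain_at[OF i this]
    have "(?H has_vector_derivative (- (?u ^ 2)) *\<^sub>R
       (of_real ?u ^ k * (euler g (?u *\<^sub>R \<xi>) / of_real ?u) + of_nat k * of_real ?u ^ (k - 1) * g (?u *\<^sub>R \<xi>))) (at s)"
      by (simp add: o_def)
    moreover have "(- (?u ^ 2)) *\<^sub>R
       (of_real ?u ^ k * (euler g (?u *\<^sub>R \<xi>) / of_real ?u) + of_nat k * of_real ?u ^ (k - 1) * g (?u *\<^sub>R \<xi>)) = - ?g s"
      using s by (cases k) (simp_all add: scaleR_conv_of_real[where 'a = complex] power2_eq_square field_simps)
    ultimately show ?thesis by simp
  qed
  have "(?G has_vector_derivative - ?g s) (at s)" if s: "s \<in> {0<..<1}" for s
    by (rule has_vector_derivative_transform_within_open[OF H, of _ "{0<..}"]) (use s in auto)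
  moreover have "continuous_on {0..1} ?G"
    unfolding continuous_on_def
  proof
    fix s :: real assume s: "s \<in> {0..1}"
    show "(?G \<longlongrightarrow> ?G s) (at s within {0..1})"
    proof (cases "s = 0")
      case True
      have "(?G \<longlongrightarrow> L) (at_right 0)"
        using L by (rule Lim_transform_eventually) (auto simp: eventually_at_filter)
      then show ?thesis using True by (simp add: at_within_Icc_at_right)
    next
      case False
      have "(?G has_vector_derivative - ?g s) (at s)"
        by (rule has_vector_derivative_transform_within_open[OF H, of _ "{0<..}"]) (use s False in auto)
      from has_vector_derivative_continuous[OF this] show ?thesis
        using continuous_at_imp_continuous_at_within continuous_within by blast
    qed
  qed
  ultimately have "((\<lambda>s. - ?g s) has_integral ?G 1 - ?G 0) {0..1}"
    by (intro fundamental_theorem_of_calculus_interior) auto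
  from has_integral_neg[OF this] show ?thesis
    unfolding outer_radial_def using integral_unique by force
qed

lemma outer_integrand_tendsto_0:
  fixes \<sigma> :: "real^'n::{finite,linorder} \<Rightarrow> complex"
  assumes "\<sigma> \<in> symbols a" "Re a + real k < 0" "k > 0" "\<xi> \<noteq> 0"
  shows "((\<lambda>s. of_real (inverse s) ^ k * \<sigma> (inverse s *\<^sub>R \<xi>)) \<longlongrightarrow> 0) (at_right 0)"
proof -
  have "continuous_on {0..1} (\<lambda>s. of_real (inverse s) ^ k * \<sigma> (inverse s *\<^sub>R \<xi>))"
    using continuous_on_outer_ray[OF assms, of "[]"] by (simp only: list.size iter_pderiv.simps add_0_right)
  then show ?thesis
    using assms(3) by (cases k) (auto simp: continuous_on_def at_within_Icc_at_right dest!: bspec[of _ _ 0])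
qed

text \<open>The Euler operator commutes with the integral along rays, so the primitive formula becomes a
  differential equation: it says that a function is a radial divergence.\<close>
lemma inner_radial_ode:
  fixes \<sigma> :: "real^'n::finite \<Rightarrow> complex"
  assumes "smooth_on UNIV \<sigma>"
  shows "of_nat (Suc k) * inner_radial k \<sigma> \<xi> + euler (inner_radial k \<sigma>) \<xi> = \<sigma> \<xi>"
proof -
  have "((\<lambda>t. of_nat (Suc k) * (of_real t ^ k * \<sigma> (t *\<^sub>R \<xi>))
        + (\<Sum>i\<in>UNIV. of_real (\<xi> $ i) * (of_real t ^ Suc k * pderiv_at i \<sigma> (t *\<^sub>R \<xi>)))) has_integral
      of_nat (Suc k) * inner_radial k \<sigma> \<xi> + (\<Sum>i\<in>UNIV. of_real (\<xi> $ i) * inner_radial (Suc k) (pderiv_at i \<sigma>) \<xi>)) {0..1}"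
    by (intro has_integral_add has_integral_sum has_integral_mult_right inner_radial_has_integral
        smooth_on_continuous smooth_on_pderiv assms) auto
  moreover have "of_nat (Suc k) * (of_real t ^ k * \<sigma> (t *\<^sub>R \<xi>))
        + (\<Sum>i\<in>UNIV. of_real (\<xi> $ i) * (of_real t ^ Suc k * pderiv_at i \<sigma> (t *\<^sub>R \<xi>)))
      = of_real t ^ k * (of_nat (Suc k) * \<sigma> (t *\<^sub>R \<xi>) + euler \<sigma> (t *\<^sub>R \<xi>))" for t
    by (simp add: euler_def sum_distrib_left algebra_simps)
  ultimately have "inner_radial k (\<lambda>\<xi>. of_nat (Suc k) * \<sigma> \<xi> + euler \<sigma> \<xi>) \<xi>
      = of_nat (Suc k) * inner_radial k \<sigma> \<xi> + (\<Sum>i\<in>UNIV. of_real (\<xi> $ i) * inner_radial (Suc k) (pderiv_at i \<sigma>) \<xi>)"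
    unfolding inner_radial_def[of k "\<lambda>\<xi>. of_nat (Suc k) * \<sigma> \<xi> + euler \<sigma> \<xi>"]
    by (intro integral_unique) (simp only:)
  then show ?thesis
    using inner_radial_primitive[OF assms, of k \<xi>]
    by (simp add: euler_def[of "inner_radial k \<sigma>"] pderiv_inner_radial[OF assms])
qed

lemma outer_radial_ode:
  fixes \<sigma> :: "real^'n::{finite,linorder} \<Rightarrow> complex"
  assumes \<sigma>: "\<sigma> \<in> symbols a" "Re a + real k + 1 < 0" and k: "k > 0" and \<xi>: "\<xi> \<noteq> 0"
  shows "of_nat k * outer_radial (Suc k) \<sigma> \<xi> + euler (outer_radial (Suc k) \<sigma>) \<xi> = - \<sigma> \<xi>"
proof -
  have "((\<lambda>s. of_nat k * (of_real (inverse s) ^ Suc k * \<sigma> (inverse s *\<^sub>R \<xi>))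
        + (\<Sum>i\<in>UNIV. of_real (\<xi> $ i) * (of_real (inverse s) ^ Suc (Suc k) * pderiv_at i \<sigma> (inverse s *\<^sub>R \<xi>)))) has_integral
      of_nat k * outer_radial (Suc k) \<sigma> \<xi>
        + (\<Sum>i\<in>UNIV. of_real (\<xi> $ i) * outer_radial (Suc (Suc k)) (pderiv_at i \<sigma>) \<xi>)) {0..1}"
    using \<sigma> \<xi>
    by (intro has_integral_add has_integral_sum has_integral_mult_right outer_radial_has_integral[OF \<sigma>(1)]
        outer_radial_has_integral[where a = "a - 1"] symbols_pderiv) auto
  moreover have "of_nat k * (of_real (inverse s) ^ Suc k * \<sigma> (inverse s *\<^sub>R \<xi>))
        + (\<Sum>i\<in>UNIV. of_real (\<xi> $ i) * (of_real (inverse s) ^ Suc (Suc k) * pderiv_at i \<sigma> (inverse s *\<^sub>R \<xi>)))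
      = of_real (inverse s) ^ Suc k * (of_nat k * \<sigma> (inverse s *\<^sub>R \<xi>) + euler \<sigma> (inverse s *\<^sub>R \<xi>))" for s
    by (simp add: euler_def sum_distrib_left algebra_simps)
  ultimately have "outer_radial (Suc k) (\<lambda>\<xi>. of_nat k * \<sigma> \<xi> + euler \<sigma> \<xi>) \<xi>
      = of_nat k * outer_radial (Suc k) \<sigma> \<xi>
        + (\<Sum>i\<in>UNIV. of_real (\<xi> $ i) * outer_radial (Suc (Suc k)) (pderiv_at i \<sigma>) \<xi>)"
    unfolding outer_radial_def[of "Suc k" "\<lambda>\<xi>. of_nat k * \<sigma> \<xi> + euler \<sigma> \<xi>"]
    by (intro integral_unique) (simp only:)
  moreover have "outer_radial (Suc k) (\<lambda>\<xi>. of_nat k * \<sigma> \<xi> + euler \<sigma> \<xi>) \<xi> = - \<sigma> \<xi>"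
    using outer_radial_primitive[OF symbols_smooth[OF \<sigma>(1)] outer_integrand_tendsto_0[OF \<sigma>(1) _ k \<xi>]] \<sigma>(2) by simp
  moreover have "pderiv_at i (outer_radial (Suc k) \<sigma>) \<xi> = outer_radial (Suc (Suc k)) (pderiv_at i \<sigma>) \<xi>" for i
    using pderiv_outer_radial[OF \<sigma>(1) _ _ \<xi>] \<sigma>(2) by simp
  ultimately show ?thesis
    by (simp only: euler_def[of "outer_radial (Suc k) \<sigma>"])
qed

text \<open>The right hand sides of the equations for the inner and outer integrals cancel, and the solutions of
  the remaining Euler equation are the homogeneous functions.\<close>
lemma
  fixes \<sigma> :: "real^'n::{finite,linorder} \<Rightarrow> complex"
  assumes \<sigma>: "\<sigma> \<in> symbols a" "Re a + real n + 1 < 0" and n: "n > 0"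
  shows smooth_on_ray_integral: "smooth_on (- {0}) (ray_integral n \<sigma>)"
    and pderiv_ray_integral: "\<xi> \<noteq> 0 \<Longrightarrow> pderiv_at i (ray_integral n \<sigma>) \<xi> = ray_integral (Suc n) (pderiv_at i \<sigma>) \<xi>"
    and pos_homogeneous_ray_integral: "pos_homogeneous (- of_nat n) (ray_integral n \<sigma>)"
proof -
  have sm: "smooth_on UNIV \<sigma>" using \<sigma> symbols_smooth by blast
  have out: "smooth_on (- {0}) (outer_radial (n + 1) \<sigma>)" using smooth_on_outer_radial[OF \<sigma>(1), of "n + 1"] \<sigma>(2) by simp
  have inn: "smooth_on UNIV (inner_radial (n - 1) \<sigma>)" by (rule smooth_on_inner_radial[OF sm])
  have op: "open (- {0::real^'n::{finite,linorder}})" by auto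
  show smW: "smooth_on (- {0}) (ray_integral n \<sigma>)"
    unfolding ray_integral_def[abs_def]
    using smooth_on_add[OF op smooth_on_subset[OF inn] out] by simp
  have pd: "pderiv_at i (ray_integral n \<sigma>) \<xi> = pderiv_at i (inner_radial (n - 1) \<sigma>) \<xi> + pderiv_at i (outer_radial (n + 1) \<sigma>) \<xi>"
    if "\<xi> \<noteq> 0" for i \<xi>
    unfolding ray_integral_def[abs_def]
    by (rule pderiv_at_add) (use that out inn in \<open>auto intro: smooth_on_differentiable\<close>)
  then show "pderiv_at i (ray_integral n \<sigma>) \<xi> = ray_integral (Suc n) (pderiv_at i \<sigma>) \<xi>" if "\<xi> \<noteq> 0"
    using that pderiv_outer_radial[OF \<sigma>(1), of "n + 1" \<xi> i] pderiv_inner_radial[OF sm, of i "n - 1" \<xi>] \<sigma>(2) n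
    by (simp add: ray_integral_def)
  have ode: "of_nat n * ray_integral n \<sigma> \<xi> + euler (ray_integral n \<sigma>) \<xi> = 0" if \<xi>: "\<xi> \<noteq> 0" for \<xi>
  proof -
    have "euler (ray_integral n \<sigma>) \<xi> = euler (inner_radial (n - 1) \<sigma>) \<xi> + euler (outer_radial (n + 1) \<sigma>) \<xi>"
      by (simp add: euler_def pd[OF \<xi>] distrib_left sum.distrib)
    then show ?thesis
      using inner_radial_ode[OF sm, of "n - 1" \<xi>] outer_radial_ode[OF \<sigma> n \<xi>] n
      by (simp add: ray_integral_def algebra_simps)
  qed
  show "pos_homogeneous (- of_nat n) (ray_integral n \<sigma>)"
    unfolding pos_homogeneous_def
  proof (intro allI impI)
    fix t :: real and \<xi> :: "real^'n::{finite,linorder}" assume t: "t > 0" and \<xi>: "\<xi> \<noteq> 0"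
    \<comment> \<open>By the Euler equation this function of t has derivative zero.\<close>
    let ?G = "\<lambda>t. complex_of_real t ^ n * ray_integral n \<sigma> (t *\<^sub>R \<xi>)"
    have "(?G has_vector_derivative 0) (at r within {0<..})" if r: "r \<in> {0<..}" for r
    proof -
      have d: "ray_integral n \<sigma> differentiable (at (r *\<^sub>R \<xi>))"
        using smW \<xi> r by (auto intro: smooth_on_differentiable)
      have "((\<lambda>t. complex_of_real t ^ n) has_vector_derivative of_nat n * of_real r ^ (n - 1)) (at r within {0<..})"
        by (rule has_vector_derivative_of_real_power)
      from has_vector_derivative_mult[OF this has_vector_derivative_radial[OF d, of "{0<..}"]]
      have "(?G has_vector_derivative of_real r ^ n * (euler (ray_integral n \<sigma>) (r *\<^sub>R \<xi>) / of_real r)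
         + of_nat n * of_real r ^ (n - 1) * ray_integral n \<sigma> (r *\<^sub>R \<xi>)) (at r within {0<..})" using r by simp
      moreover have "of_real r ^ n * (euler (ray_integral n \<sigma>) (r *\<^sub>R \<xi>) / of_real r)
         + of_nat n * of_real r ^ (n - 1) * ray_integral n \<sigma> (r *\<^sub>R \<xi>)
         = of_real r ^ (n - 1) * (of_nat n * ray_integral n \<sigma> (r *\<^sub>R \<xi>) + euler (ray_integral n \<sigma>) (r *\<^sub>R \<xi>))"
        using r n by (cases n) (auto simp: field_simps)
      ultimately show ?thesis using ode[of "r *\<^sub>R \<xi>"] \<xi> r by simp
    qed
    then obtain c where "\<And>r. r \<in> {0<..} \<Longrightarrow> ?G r = c"
      using has_vector_derivative_zero_constant[of "{0<..}" ?G] by auto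
    from this[of t] this[of 1] t have "of_real t ^ n * ray_integral n \<sigma> (t *\<^sub>R \<xi>) = ray_integral n \<sigma> \<xi>" by simp
    moreover have "complex_of_real t powr (- of_nat n) = inverse (of_real t ^ n)"
      using t by (simp add: powr_minus powr_nat')
    moreover have "ray_integral n \<sigma> (t *\<^sub>R \<xi>) = inverse (of_real t ^ n) * (of_real t ^ n * ray_integral n \<sigma> (t *\<^sub>R \<xi>))"
      using t by (simp add: field_simps)
    ultimately show "ray_integral n \<sigma> (t *\<^sub>R \<xi>) = complex_of_real t powr - of_nat n * ray_integral n \<sigma> \<xi>"
      by simp
  qed
qed

section \<open>Symbols that every closed singular form kills\<close>

lemma pderiv_cutoff_mult_outside:
  fixes h :: "real^'n::finite \<Rightarrow> complex"
  assumes "cutoff \<psi>" "norm \<xi> > 1"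
  shows "pderiv_at i (\<lambda>\<xi>. of_real (\<psi> \<xi>) * h \<xi>) \<xi> = pderiv_at i h \<xi>"
proof (rule pderiv_at_cong_open)
  show "open {\<xi>::real^'n. 1 < norm \<xi>}" by (intro open_Collect_less continuous_intros)
qed (use assms in \<open>auto simp: cutoff_eq_1[OF assms(1)]\<close>)

lemma euler_cutoff_homogeneous:
  fixes h :: "real^'n::finite \<Rightarrow> complex"
  assumes "cutoff \<psi>" "smooth_on (- {0}) h" "pos_homogeneous b h" "norm \<xi> > 1"
  shows "euler (\<lambda>\<xi>. of_real (\<psi> \<xi>) * h \<xi>) \<xi> = b * (of_real (\<psi> \<xi>) * h \<xi>)"
proof -
  have "euler (\<lambda>\<xi>. of_real (\<psi> \<xi>) * h \<xi>) \<xi> = euler h \<xi>"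
    by (simp add: euler_def pderiv_cutoff_mult_outside[OF assms(1,4)])
  then show ?thesis
    using euler_pos_homogeneous[OF assms(2,3), of \<xi>] assms(4) cutoff_eq_1[OF assms(1), of \<xi>] by force
qed

text \<open>By the Euler equation the component, cut off to \<open>g\<close>, satisfies \<open>n g + E g = (n + b) g\<close> outside the unit
  ball, and the left hand side has an explicit outer integral.\<close>
lemma outer_radial_homogeneous:
  fixes h :: "real^'n::{finite,linorder} \<Rightarrow> complex"
  assumes \<psi>: "cutoff \<psi>" and h: "smooth_on (- {0}) h" "pos_homogeneous b h"
    and n: "Re b + real n + 1 < 0" "n > 0" and \<xi>: "norm \<xi> > 1"
  shows "outer_radial (Suc n) (\<lambda>\<xi>. of_real (\<psi> \<xi>) * h \<xi>) \<xi> = - 1 / (of_nat n + b) * h \<xi>"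
proof -
  let ?g = "\<lambda>\<xi>. of_real (\<psi> \<xi>) * h \<xi>"
  have g: "?g \<in> symbols b" by (rule cutoff_homogeneous_symbol[OF \<psi> h])
  have \<xi>0: "\<xi> \<noteq> 0" using \<xi> by auto
  have "(of_nat n + b) * outer_radial (Suc n) ?g \<xi>
      = integral {0..1} (\<lambda>s. (of_nat n + b) * (of_real (inverse s) ^ Suc n * ?g (inverse s *\<^sub>R \<xi>)))"
    unfolding outer_radial_def by simp
  also have "\<dots> = outer_radial (Suc n) (\<lambda>\<xi>. of_nat n * ?g \<xi> + euler ?g \<xi>) \<xi>"
    unfolding outer_radial_def
  proof (rule integral_cong)
    fix s :: real assume s: "s \<in> {0..1}"
    show "(of_nat n + b) * (of_real (inverse s) ^ Suc n * ?g (inverse s *\<^sub>R \<xi>))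
        = of_real (inverse s) ^ Suc n * (of_nat n * ?g (inverse s *\<^sub>R \<xi>) + euler ?g (inverse s *\<^sub>R \<xi>))"
    proof (cases "s = 0")
      case False
      have "1 * 1 < inverse s * norm \<xi>"
        using s False \<xi> by (intro mult_le_less_imp_less) (auto simp: one_le_inverse)
      then have "norm (inverse s *\<^sub>R \<xi>) > 1" using s by simp
      from euler_cutoff_homogeneous[OF \<psi> h this] show ?thesis by (simp add: algebra_simps)
    qed simp
  qed
  also have "\<dots> = - h \<xi>"
    using outer_radial_primitive[OF symbols_smooth[OF g] outer_integrand_tendsto_0[OF g _ n(2) \<xi>0]] n(1)
      cutoff_eq_1[OF \<psi>, of \<xi>] \<xi> by simp
  finally have "(of_nat n + b) * outer_radial (Suc n) ?g \<xi> = - h \<xi>" .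
  moreover have "of_nat n + b \<noteq> 0"
  proof
    assume "of_nat n + b = 0"
    then have "Re (of_nat n + b) = 0" by simp
    then show False using n by simp
  qed
  ultimately show ?thesis by (simp add: field_simps)
qed

text \<open>The outer integral multiplies the component of degree \<open>a - j\<close> by the constant \<open>c j\<close> below. Outside the
  unit ball it maps the remainder of order \<open>N\<close> of the symbol to that of its image.\<close>
lemma cutoff_outer_radial_classical:
  fixes \<sigma> :: "real^'n::{finite,linorder} \<Rightarrow> complex"
  assumes \<psi>: "cutoff \<psi>" and \<sigma>: "\<sigma> \<in> CS_order a" and n: "Re a + real n + 1 < 0" "n > 0"
  shows "(\<lambda>\<xi>. of_real (\<psi> \<xi>) * outer_radial (Suc n) \<sigma> \<xi>) \<in> CS_order a"
proof -
  obtain h where "classical_expansion a h \<sigma>" using CS_orderE[OF \<sigma>] .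
  note h = classical_expansionD[OF this]
  define c where "c j = - 1 / (of_nat n + (a - of_nat j))" for j :: nat
  show ?thesis
  proof (rule classical_expansionI(3)[where h = "\<lambda>j \<xi>. c j * h j \<xi>", OF _ _ \<psi>])
    fix j :: nat
    show "smooth_on (- {0}) (\<lambda>\<xi>. c j * h j \<xi>)" by (intro smooth_on_intros h) auto
    show "pos_homogeneous (a - of_nat j) (\<lambda>\<xi>. c j * h j \<xi>)" by (intro pos_homogeneous_cmult h)
  next
    fix N :: nat
    define r where "r \<xi> = \<sigma> \<xi> - (\<Sum>j<N. of_real (\<psi> \<xi>) * h j \<xi>)" for \<xi>
    have r: "r \<in> symbols (a - of_nat N)" unfolding r_def[abs_def] by (rule h(3)[OF \<psi>])
    have smV: "smooth_on (- {0}) (outer_radial (Suc n) \<sigma>)"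
      using n by (intro smooth_on_outer_radial[OF CS_order_symbols[OF \<sigma>]]) auto
    let ?R = "\<lambda>\<xi>. of_real (\<psi> \<xi>) * outer_radial (Suc n) \<sigma> \<xi> - (\<Sum>j<N. of_real (\<psi> \<xi>) * (c j * h j \<xi>))"
    show "?R \<in> symbols (a - of_nat N)"
    proof (rule symbolsI)
      show "smooth_on UNIV ?R"
        by (intro smooth_on_diff smooth_on_sum smooth_on_cutoff_mult[OF \<psi>] smV smooth_on_mult smooth_on_const h) auto
      have R: "?R \<xi> = outer_radial (Suc n) r \<xi>" if \<xi>: "norm \<xi> > 1" for \<xi>
      proof -
        have \<xi>0: "\<xi> \<noteq> 0" using \<xi> by auto
        have "((\<lambda>s. of_real (inverse s) ^ Suc n * r (inverse s *\<^sub>R \<xi>)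
             + (\<Sum>j<N. of_real (inverse s) ^ Suc n * (of_real (\<psi> (inverse s *\<^sub>R \<xi>)) * h j (inverse s *\<^sub>R \<xi>)))) has_integral
            outer_radial (Suc n) r \<xi> + (\<Sum>j<N. outer_radial (Suc n) (\<lambda>\<xi>. of_real (\<psi> \<xi>) * h j \<xi>) \<xi>)) {0..1}"
          using n \<xi>0
          by (intro has_integral_add has_integral_sum outer_radial_has_integral[OF r]
              outer_radial_has_integral[OF cutoff_homogeneous_symbol[OF \<psi> h(1,2)]]) auto
        moreover have "of_real (inverse s) ^ Suc n * r (inverse s *\<^sub>R \<xi>)
             + (\<Sum>j<N. of_real (inverse s) ^ Suc n * (of_real (\<psi> (inverse s *\<^sub>R \<xi>)) * h j (inverse s *\<^sub>R \<xi>)))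
             = of_real (inverse s) ^ Suc n * \<sigma> (inverse s *\<^sub>R \<xi>)" for s
          unfolding r_def by (simp only: right_diff_distrib sum_distrib_left) simp
        ultimately have "outer_radial (Suc n) \<sigma> \<xi>
            = outer_radial (Suc n) r \<xi> + (\<Sum>j<N. outer_radial (Suc n) (\<lambda>\<xi>. of_real (\<psi> \<xi>) * h j \<xi>) \<xi>)"
          unfolding outer_radial_def[of "Suc n" \<sigma>] by (intro integral_unique) (simp only:)
        also have "(\<Sum>j<N. outer_radial (Suc n) (\<lambda>\<xi>. of_real (\<psi> \<xi>) * h j \<xi>) \<xi>) = (\<Sum>j<N. c j * h j \<xi>)"
          using n \<xi> unfolding c_def by (intro sum.cong outer_radial_homogeneous[OF \<psi> h(1,2)]) auto
        finally show ?thesis using \<xi> by (simp add: cutoff_eq_1[OF \<psi>])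
      qed
      fix js
      obtain C where C: "\<And>\<xi>. \<xi> \<noteq> 0 \<Longrightarrow> norm (iter_pderiv js (outer_radial (Suc n) r) \<xi>)
           \<le> C * norm \<xi> powr (Re (a - of_nat N) - real (length js))"
        using outer_radial_bound[OF r, of "Suc n" js] n by auto
      have op: "open {\<xi>::real^'n::{finite,linorder}. 1 < norm \<xi>}"
        by (intro open_Collect_less continuous_intros)
      have "norm (iter_pderiv js ?R \<xi>) \<le> C * norm \<xi> powr (Re (a - of_nat N) - real (length js))" if "norm \<xi> > 1" for \<xi>
      proof -
        have "iter_pderiv js ?R \<xi> = iter_pderiv js (outer_radial (Suc n) r) \<xi>"
          by (rule iter_pderiv_cong_open[OF op]) (use R that in auto)
        moreover have "\<xi> \<noteq> 0" using that by auto
        ultimately show ?thesis using C by metis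
      qed
      then show "\<exists>C. \<forall>\<xi>. norm \<xi> > 1 \<longrightarrow> norm (iter_pderiv js ?R \<xi>)
           \<le> C * norm \<xi> powr (Re (a - of_nat N) - real (length js))" by blast
    qed
  qed
qed

text \<open>Away from the origin, the inner integral is the whole integral along the ray, which is homogeneous, minus
  the outer one, which is classical.\<close>
lemma inner_radial_in_CS:
  fixes \<sigma> :: "real^'n::{finite,linorder} \<Rightarrow> complex" and \<psi> :: "real^'n::{finite,linorder} \<Rightarrow> real"
  assumes \<psi>: "cutoff \<psi>" and \<sigma>: "\<sigma> \<in> CS_order a" and n: "Re a + real n + 1 < 0" "n > 0"
  shows "inner_radial (n - 1) \<sigma> \<in> CS"
proof -
  let ?u = "inner_radial (n - 1) \<sigma>" and ?w = "ray_integral n \<sigma>" and ?v = "outer_radial (Suc n) \<sigma>"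
  have sym: "\<sigma> \<in> symbols a" using CS_order_symbols[OF \<sigma>] .
  have "(\<lambda>\<xi>. of_real (\<psi> \<xi>) * ?w \<xi>) \<in> CS"
    by (rule CS_base[OF cutoff_homogeneous_CS_order(2)[OF \<psi> smooth_on_ray_integral[OF sym n] pos_homogeneous_ray_integral[OF sym n]]])
  moreover have "(\<lambda>\<xi>. of_real (\<psi> \<xi>) * ?v \<xi>) \<in> CS"
    by (rule CS_base[OF cutoff_outer_radial_classical[OF \<psi> \<sigma> n]])
  moreover have "(\<lambda>\<xi>. (1 - of_real (\<psi> \<xi>)) * ?u \<xi>) \<in> CS"
    by (intro smoothing_in_CS bounded_support_smoothing[OF \<psi>, where R = 1] smooth_on_mult smooth_on_diff
        smooth_on_const cutoff_smooth[OF \<psi>] smooth_on_inner_radial symbols_smooth[OF sym])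
       (auto simp: cutoff_eq_1[OF \<psi>])
  ultimately have "(\<lambda>\<xi>. (1 - of_real (\<psi> \<xi>)) * ?u \<xi> + (of_real (\<psi> \<xi>) * ?w \<xi> - of_real (\<psi> \<xi>) * ?v \<xi>)) \<in> CS"
    by (intro CS_add CS_diff)
  moreover have "(\<lambda>\<xi>. (1 - of_real (\<psi> \<xi>)) * ?u \<xi> + (of_real (\<psi> \<xi>) * ?w \<xi> - of_real (\<psi> \<xi>) * ?v \<xi>)) = ?u"
    by (simp add: ray_integral_def algebra_simps)
  ultimately show ?thesis by simp
qed

text \<open>A function supported in a shell around the origin: along each ray, the derivative of the cutoff with
  respect to the logarithm of the radius.\<close>
definition radial_slope :: "(real^'n::finite \<Rightarrow> real) \<Rightarrow> real^'n \<Rightarrow> complex"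
  where "radial_slope \<psi> = euler (\<lambda>\<xi>. of_real (\<psi> \<xi>))"

lemma cutoff_derivative_support:
  fixes \<psi> :: "real^'n::finite \<Rightarrow> real"
  assumes \<psi>: "cutoff \<psi>"
  obtains U where "open U" "0 \<in> U"
    "\<And>\<xi> i. \<xi> \<in> U \<or> norm \<xi> > 1 \<Longrightarrow> pderiv_at i (\<lambda>\<xi>. complex_of_real (\<psi> \<xi>)) \<xi> = 0"
proof -
  obtain U where U: "open U" "0 \<in> U" "\<And>\<xi>. \<xi> \<in> U \<Longrightarrow> \<psi> \<xi> = 0"
    using cutoff_nbhd[OF \<psi>] by blast
  have "pderiv_at i (\<lambda>\<xi>. complex_of_real (\<psi> \<xi>)) \<xi> = 0" if "\<xi> \<in> U" for \<xi> i
  proof -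
    have "pderiv_at i (\<lambda>\<xi>. complex_of_real (\<psi> \<xi>)) \<xi> = pderiv_at i (\<lambda>_. 0) \<xi>"
      by (rule pderiv_at_cong_open[OF U(1) that]) (simp add: U(3))
    then show ?thesis by simp
  qed
  moreover have "pderiv_at i (\<lambda>\<xi>. complex_of_real (\<psi> \<xi>)) \<xi> = 0" if "norm \<xi> > 1" for \<xi> i
    using pderiv_cutoff_mult_outside[OF \<psi> that, of i "\<lambda>_. 1"] by simp
  ultimately show ?thesis using that[OF U(1,2)] by blast
qed

lemma smooth_on_pderiv_cutoff_mult:
  fixes h :: "real^'n::finite \<Rightarrow> complex"
  assumes \<psi>: "cutoff \<psi>" and h: "smooth_on (- {0}) h"
  shows "smooth_on UNIV (\<lambda>\<xi>. pderiv_at i (\<lambda>\<xi>. complex_of_real (\<psi> \<xi>)) \<xi> * h \<xi>)"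
proof -
  obtain U where U: "open U" "0 \<in> U"
    "\<And>\<xi> i. \<xi> \<in> U \<or> norm \<xi> > 1 \<Longrightarrow> pderiv_at i (\<lambda>\<xi>. complex_of_real (\<psi> \<xi>)) \<xi> = 0"
    using cutoff_derivative_support[OF \<psi>] by blast
  show ?thesis
    by (rule smooth_on_extend_by_zero[OF _ U(1,2)])
       (auto simp: U(3) intro!: smooth_on_mult h smooth_on_pderiv smooth_on_subset[OF cutoff_smooth[OF \<psi>]])
qed

lemma pderiv_cutoff_mult_smoothing:
  fixes h :: "real^'n::{finite,linorder} \<Rightarrow> complex"
  assumes \<psi>: "cutoff \<psi>" and h: "smooth_on (- {0}) h"
  shows "(\<lambda>\<xi>. pderiv_at i (\<lambda>\<xi>. complex_of_real (\<psi> \<xi>)) \<xi> * h \<xi>) \<in> CS_smoothing"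
proof -
  obtain U where U: "open U" "0 \<in> U"
    "\<And>\<xi> i. \<xi> \<in> U \<or> norm \<xi> > 1 \<Longrightarrow> pderiv_at i (\<lambda>\<xi>. complex_of_real (\<psi> \<xi>)) \<xi> = 0"
    using cutoff_derivative_support[OF \<psi>] by blast
  show ?thesis
    by (rule bounded_support_smoothing[OF \<psi> smooth_on_pderiv_cutoff_mult[OF \<psi> h], of 1]) (simp add: U)
qed

lemma radial_slope_support:
  fixes \<psi> :: "real^'n::finite \<Rightarrow> real"
  assumes \<psi>: "cutoff \<psi>"
  obtains U where "open U" "0 \<in> U" "\<And>\<xi>. \<xi> \<in> U \<or> norm \<xi> > 1 \<Longrightarrow> radial_slope \<psi> \<xi> = 0"
proof -
  obtain U where U: "open U" "0 \<in> U"
    "\<And>\<xi> i. \<xi> \<in> U \<or> norm \<xi> > 1 \<Longrightarrow> pderiv_at i (\<lambda>\<xi>. complex_of_real (\<psi> \<xi>)) \<xi> = 0"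
    using cutoff_derivative_support[OF \<psi>] by blast
  show ?thesis by (rule that[OF U(1,2)]) (simp add: radial_slope_def euler_def U(3))
qed

lemma radial_slope_outside: "cutoff \<psi> \<Longrightarrow> norm \<xi> > 1 \<Longrightarrow> radial_slope \<psi> \<xi> = 0"
  by (rule radial_slope_support) auto

lemma radial_slope_mult_eq:
  "radial_slope \<psi> \<xi> * h \<xi> = (\<Sum>i\<in>UNIV. pderiv_at i (\<lambda>\<xi>. complex_of_real (\<psi> \<xi>)) \<xi> * (of_real (\<xi> $ i) * h \<xi>))"
  by (simp add: radial_slope_def euler_def sum_distrib_left sum_distrib_right mult_ac)

lemma smooth_on_radial_slope_mult:
  fixes h :: "real^'n::finite \<Rightarrow> complex"
  assumes \<psi>: "cutoff \<psi>" and h: "smooth_on (- {0}) h"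
  shows "smooth_on UNIV (\<lambda>\<xi>. radial_slope \<psi> \<xi> * h \<xi>)"
  unfolding radial_slope_mult_eq
  by (intro smooth_on_sum smooth_on_pderiv_cutoff_mult[OF \<psi>] smooth_on_mult smooth_on_coord h) auto

text \<open>In the critical degree \<open>b = -n\<close> the first term disappears and the divergence has bounded support.\<close>
lemma divergence_cutoff_homogeneous:
  fixes h :: "real^'n::finite \<Rightarrow> complex"
  assumes \<psi>: "cutoff \<psi>" and h: "smooth_on (- {0}) h" "pos_homogeneous b h"
  shows "(\<Sum>i\<in>UNIV. pderiv_at i (\<lambda>\<xi>. of_real (\<xi> $ i) * (of_real (\<psi> \<xi>) * h \<xi>)) \<xi>)
    = (of_nat CARD('n) + b) * (of_real (\<psi> \<xi>) * h \<xi>) + radial_slope \<psi> \<xi> * h \<xi>"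
proof -
  have d: "(\<lambda>\<xi>. of_real (\<psi> \<xi>) * h \<xi>) differentiable (at \<xi>)"
    using smooth_on_differentiable[OF smooth_on_cutoff_mult[OF \<psi> h(1)]] by blast
  have "euler (\<lambda>\<xi>. of_real (\<psi> \<xi>) * h \<xi>) \<xi> = radial_slope \<psi> \<xi> * h \<xi> + b * (of_real (\<psi> \<xi>) * h \<xi>)"
  proof (cases "\<xi> = 0")
    case True
    have "\<psi> 0 = 0" using cutoff_nbhd[OF \<psi>] by blast
    then show ?thesis using True by (simp add: euler_def radial_slope_def)
  next
    case False
    then show ?thesis
      using euler_mult[of "\<lambda>\<xi>. of_real (\<psi> \<xi>)" \<xi> h] smooth_on_differentiable[OF cutoff_smooth[OF \<psi>]]
        smooth_on_differentiable[OF h(1), of \<xi>] euler_pos_homogeneous[OF h False]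
      by (simp add: radial_slope_def)
  qed
  then show ?thesis unfolding divergence_radial[OF d] by (simp add: ring_distribs)
qed

locale closed_singular_form =
  fixes \<rho> :: "(real^'n::{finite,linorder} \<Rightarrow> complex) \<Rightarrow> complex"
    and \<psi> :: "real^'n::{finite,linorder} \<Rightarrow> real"
  assumes linear: "linear_form \<rho>" and singular: "singular_form \<rho>" and stokes: "stokes \<rho>"
    and cutoff: "cutoff \<psi>"
begin

lemma zero_in_CS: "(\<lambda>_::real^'n::{finite,linorder}. 0) \<in> CS"
  using coord_in_CS[OF cutoff, THEN CS_scale, of 0] by simp

lemma \<rho>_add: "\<sigma> \<in> CS \<Longrightarrow> \<tau> \<in> CS \<Longrightarrow> \<rho> (\<lambda>\<xi>. \<sigma> \<xi> + \<tau> \<xi>) = \<rho> \<sigma> + \<rho> \<tau>"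
  using linear by (simp add: linear_form_def)

lemma \<rho>_cmult: "\<sigma> \<in> CS \<Longrightarrow> \<rho> (\<lambda>\<xi>. c * \<sigma> \<xi>) = c * \<rho> \<sigma>"
  using linear by (simp add: linear_form_def)

lemma \<rho>_zero: "\<rho> (\<lambda>_. 0) = 0"
  using \<rho>_cmult[OF zero_in_CS, of 0] by simp

lemma \<rho>_sum: "(\<And>k. k \<in> K \<Longrightarrow> f k \<in> CS) \<Longrightarrow> \<rho> (\<lambda>\<xi>. \<Sum>k\<in>K. f k \<xi>) = (\<Sum>k\<in>K. \<rho> (f k))"
  by (induction K rule: infinite_finite_induct) (auto simp: \<rho>_zero \<rho>_add CS_sum[OF zero_in_CS])

lemma \<rho>_divergence:
  assumes "\<And>i. \<tau> i \<in> CS"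
  shows "\<rho> (\<lambda>\<xi>. \<Sum>i\<in>UNIV. pderiv_at i (\<tau> i) \<xi>) = 0"
proof -
  have "\<rho> (pderiv_at i (\<tau> i)) = 0" for i
    using stokes assms unfolding stokes_def by blast
  then show ?thesis by (subst \<rho>_sum) (auto intro: CS_pderiv assms)
qed

lemma \<rho>_smoothing: "\<sigma> \<in> CS_smoothing \<Longrightarrow> \<rho> \<sigma> = 0"
  using singular by (simp add: singular_form_def)

text \<open>A symbol of low order is the divergence of the radial field built from its inner integral.\<close>
lemma \<rho>_low_order:
  assumes \<sigma>: "\<sigma> \<in> CS_order a" and a: "Re a + real CARD('n) + 1 < 0"
  shows "\<rho> \<sigma> = 0"
proof -
  let ?u = "inner_radial (CARD('n) - 1) \<sigma>"
  have sm: "smooth_on UNIV \<sigma>" using symbols_smooth[OF CS_order_symbols[OF \<sigma>]] .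
  have "(\<lambda>\<xi>. of_real (\<xi> $ i) * ?u \<xi>) \<in> CS" for i
    by (rule CS_mult[OF coord_in_CS[OF cutoff] inner_radial_in_CS[OF cutoff \<sigma> a]]) simp
  from \<rho>_divergence[OF this]
  have "\<rho> (\<lambda>\<xi>. \<Sum>i\<in>UNIV. pderiv_at i (\<lambda>\<xi>. of_real (\<xi> $ i) * ?u \<xi>) \<xi>) = 0" .
  moreover have "(\<Sum>i\<in>UNIV. pderiv_at i (\<lambda>\<xi>. of_real (\<xi> $ i) * ?u \<xi>) \<xi>) = \<sigma> \<xi>" for \<xi>
  proof -
    have "?u differentiable (at \<xi>)"
      using smooth_on_differentiable[OF smooth_on_inner_radial[OF sm]] by blast
    from divergence_radial[OF this] show ?thesis
      using inner_radial_ode[OF sm, of "CARD('n) - 1" \<xi>] by simp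
  qed
  ultimately show ?thesis by simp
qed

lemma \<rho>_noncritical_component:
  assumes h: "smooth_on (- {0}) h" "pos_homogeneous b h" and b: "b \<noteq> - of_nat CARD('n)"
  shows "\<rho> (\<lambda>\<xi>. of_real (\<psi> \<xi>) * h \<xi>) = 0"
proof -
  let ?g = "\<lambda>\<xi>. of_real (\<psi> \<xi>) * h \<xi>"
  let ?div = "\<lambda>\<xi>. \<Sum>i\<in>UNIV. pderiv_at i (\<lambda>\<xi>. of_real (\<xi> $ i) * ?g \<xi>) \<xi>"
  let ?q = "\<lambda>\<xi>. radial_slope \<psi> \<xi> * h \<xi>"
  have g: "?g \<in> CS" by (rule CS_base[OF cutoff_homogeneous_CS_order(2)[OF cutoff h]])
  have f: "(\<lambda>\<xi>. of_real (\<xi> $ i) * ?g \<xi>) \<in> CS" for i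
    by (rule CS_mult[OF coord_in_CS[OF cutoff] g])
  have div: "?div \<in> CS" by (intro CS_sum[OF zero_in_CS] CS_pderiv f)
  have q: "?q \<in> CS_smoothing"
    by (rule bounded_support_smoothing[OF cutoff smooth_on_radial_slope_mult[OF cutoff h(1)], of 1])
       (simp add: radial_slope_outside[OF cutoff])
  let ?c = "of_nat CARD('n) + b"
  have "?c * \<rho> ?g = \<rho> (\<lambda>\<xi>. ?c * ?g \<xi>)" using \<rho>_cmult[OF g] by simp
  also have "(\<lambda>\<xi>. ?c * ?g \<xi>) = (\<lambda>\<xi>. ?div \<xi> + (- 1) * ?q \<xi>)"
    unfolding divergence_cutoff_homogeneous[OF cutoff h] by simp
  also have "\<rho> \<dots> = \<rho> ?div + (- 1) * \<rho> ?q"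
    using \<rho>_add[OF div CS_scale[OF smoothing_in_CS[OF q], of "- 1"]] \<rho>_cmult[OF smoothing_in_CS[OF q], of "- 1"] by simp
  also have "\<dots> = 0" using \<rho>_divergence[OF f] \<rho>_smoothing[OF q] by simp
  finally have "?c * \<rho> ?g = 0" .
  moreover have "?c \<noteq> 0" using b by (auto simp: add_eq_0_iff)
  ultimately show ?thesis by simp
qed

end

section \<open>Closed functionals on test functions\<close>

definition test_function :: "(real^'n::finite \<Rightarrow> complex) \<Rightarrow> bool"
  where "test_function \<phi> \<longleftrightarrow> smooth_on UNIV \<phi> \<and> (\<exists>R. \<forall>\<xi>. norm \<xi> > R \<longrightarrow> \<phi> \<xi> = 0)"

lemma test_functionI: "smooth_on UNIV \<phi> \<Longrightarrow> (\<And>\<xi>. norm \<xi> > R \<Longrightarrow> \<phi> \<xi> = 0) \<Longrightarrow> test_function \<phi>"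
  unfolding test_function_def by blast

lemma test_function_smooth: "test_function \<phi> \<Longrightarrow> smooth_on UNIV \<phi>"
  unfolding test_function_def by blast

lemma test_function_continuous: "test_function \<phi> \<Longrightarrow> continuous_on UNIV \<phi>"
  by (intro smooth_on_continuous test_function_smooth)

lemma test_function_symbols:
  fixes \<phi> :: "real^'n::{finite,linorder} \<Rightarrow> complex"
  shows "test_function \<phi> \<Longrightarrow> \<phi> \<in> symbols a"
  unfolding test_function_def using bounded_support_symbols by blast

lemma test_function_common_radius:
  assumes "test_function \<phi>" "test_function \<theta>"
  obtains R where "R \<ge> 0" "\<forall>\<xi>. norm \<xi> > R \<longrightarrow> \<phi> \<xi> = 0 \<and> \<theta> \<xi> = 0"
proof -
  obtain R S where "\<forall>\<xi>. norm \<xi> > R \<longrightarrow> \<phi> \<xi> = 0" "\<forall>\<xi>. norm \<xi> > S \<longrightarrow> \<theta> \<xi> = 0"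
    using assms unfolding test_function_def by blast
  then show ?thesis by (intro that[of "max 0 (max R S)"]) auto
qed

lemma test_function_add:
  assumes "test_function \<phi>" "test_function \<theta>"
  shows "test_function (\<lambda>\<xi>. \<phi> \<xi> + \<theta> \<xi>)"
proof -
  obtain R where "R \<ge> 0" "\<forall>\<xi>. norm \<xi> > R \<longrightarrow> \<phi> \<xi> = 0 \<and> \<theta> \<xi> = 0"
    by (rule test_function_common_radius[OF assms])
  then show ?thesis
    using smooth_on_add[OF open_UNIV assms[THEN test_function_smooth]] by (intro test_functionI[of _ R]) auto
qed

lemma test_function_cmult:
  fixes \<phi> :: "real^'n::finite \<Rightarrow> complex"
  shows "test_function \<phi> \<Longrightarrow> test_function (\<lambda>\<xi>. c * \<phi> \<xi>)"
  unfolding test_function_def by (auto intro!: smooth_on_mult smooth_on_const)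

lemma test_function_zero: "test_function (\<lambda>_. 0)"
  by (rule test_functionI[of _ 0]) (auto simp: smooth_on_const)

lemma test_function_sum:
  "(\<And>k. k \<in> K \<Longrightarrow> test_function (f k)) \<Longrightarrow> test_function (\<lambda>\<xi>. \<Sum>k\<in>K. f k \<xi>)"
  by (induction K rule: infinite_finite_induct) (auto intro: test_function_add test_function_zero)

lemma test_function_pderiv:
  fixes \<phi> :: "real^'n::finite \<Rightarrow> complex"
  assumes "test_function \<phi>"
  shows "test_function (pderiv_at i \<phi>)"
proof -
  obtain R where R: "\<And>\<xi>. norm \<xi> > R \<Longrightarrow> \<phi> \<xi> = 0" using assms unfolding test_function_def by blast
  have op: "open {\<xi>::real^'n. R < norm \<xi>}" by (intro open_Collect_less continuous_intros)
  have "pderiv_at i \<phi> \<xi> = 0" if "norm \<xi> > R" for \<xi>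
    using pderiv_at_cong_open[OF op, of \<xi> \<phi> "\<lambda>_. 0" i] that R by simp
  then show ?thesis by (rule test_functionI[OF smooth_on_pderiv[OF test_function_smooth[OF assms]]])
qed

lemma lborel_integral_affine:
  fixes f :: "'a::euclidean_space \<Rightarrow> complex"
  assumes "c \<noteq> 0" and [measurable]: "f \<in> borel_measurable borel"
  shows "(LINT x|lborel. f x) = of_real (\<bar>c\<bar> ^ DIM('a)) * (LINT x|lborel. f (t + c *\<^sub>R x))"
proof -
  have "(LINT x|lborel. f x) = (LINT x|density (distr lborel borel (\<lambda>x. t + c *\<^sub>R x)) (\<lambda>_. ennreal (\<bar>c\<bar> ^ DIM('a))). f x)"
    using lborel_affine[OF assms(1), of t] by simp
  also have "\<dots> = (LINT x|distr lborel borel (\<lambda>x. t + c *\<^sub>R x). \<bar>c\<bar> ^ DIM('a) *\<^sub>R f x)"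
    by (rule integral_density) auto
  also have "\<dots> = (LINT x|lborel. \<bar>c\<bar> ^ DIM('a) *\<^sub>R f (t + c *\<^sub>R x))"
    by (rule integral_distr) auto
  finally show ?thesis by (simp add: scaleR_conv_of_real[where 'a = complex])
qed

lemma continuous_bounded_support_lborel:
  fixes f :: "'a::euclidean_space \<Rightarrow> complex"
  assumes "continuous_on UNIV f" "\<And>y. y \<notin> cbox a b \<Longrightarrow> f y = 0"
  shows "integrable lborel f" "(LINT y|lborel. f y) = integral (cbox a b) f"
proof -
  have ind: "(\<lambda>y. indicator (cbox a b) y *\<^sub>R f y) = f"
    using assms(2) by (auto simp: indicator_def)
  show int: "integrable lborel f"
    using borel_integrable_compact[OF compact_cbox continuous_on_subset[OF assms(1) subset_UNIV], of a b] ind by simp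
  have "integral UNIV f = integral UNIV (\<lambda>y. if y \<in> cbox a b then f y else 0)"
    using assms(2) by (intro integral_cong) auto
  then show "(LINT y|lborel. f y) = integral (cbox a b) f"
    using integral_lborel[OF int] by (simp add: Henstock_Kurzweil_Integration.integral_restrict_UNIV)
qed

abbreviation cube :: "real \<Rightarrow> (real^'n::finite) set"
  where "cube R \<equiv> cbox (\<chi> i. - R) (\<chi> i. R)"

lemma norm_le_in_cube: "norm y \<le> R \<Longrightarrow> y \<in> cube R"
  using order_trans[OF component_le_norm_cart[of y]] by (auto simp: mem_box_cart abs_le_iff minus_le_iff)

lemma test_function_integrable:
  assumes "test_function \<phi>"
  shows "integrable lborel \<phi>"
proof -
  obtain R where R: "\<forall>\<xi>. norm \<xi> > R \<longrightarrow> \<phi> \<xi> = 0"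
    using assms unfolding test_function_def by blast
  show ?thesis
  proof (rule continuous_bounded_support_lborel(1)[OF test_function_continuous[OF assms]])
    show "\<phi> y = 0" if "y \<notin> cube R" for y
      using R norm_le_in_cube[of y R] that by (metis not_le)
  qed
qed

text \<open>Averaging the difference of a function and its translates against a second function gives a
  divergence, because the difference along a segment is the integral of a directional derivative.\<close>
lemma convolution_minus_mass_is_divergence:
  fixes \<phi> \<theta> :: "real^'n::finite \<Rightarrow> complex"
  assumes \<phi>: "test_function \<phi>" and \<theta>: "test_function \<theta>"
  obtains K where "\<And>i. test_function (K i)"
    "\<And>\<xi>. (LINT y|lborel. \<theta> y * \<phi> (\<xi> - y)) = (LINT y|lborel. \<theta> y) * \<phi> \<xi> + (\<Sum>i\<in>UNIV. pderiv_at i (K i) \<xi>)"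
proof -
  obtain R where "R \<ge> 0" and van: "\<forall>\<xi>. norm \<xi> > R \<longrightarrow> \<phi> \<xi> = 0 \<and> \<theta> \<xi> = 0"
    by (rule test_function_common_radius[OF \<phi> \<theta>])
  then have R: "R \<ge> 0" "\<And>\<xi>. norm \<xi> > R \<Longrightarrow> \<phi> \<xi> = 0" "\<And>\<xi>. norm \<xi> > R \<Longrightarrow> \<theta> \<xi> = 0"
    by auto
  let ?a = "(\<chi> i. - R) :: real^'n" and ?b = "(\<chi> i. R) :: real^'n"
  \<comment> \<open>The first entry of p is the translation y, the second the position s on the segment from 0 to y.\<close>
  define F where "F i p \<xi> = - (of_real (fst p $ i) * \<theta> (fst p)) * \<phi> (1 *\<^sub>R \<xi> + (- snd p *\<^sub>R fst p))"
    for i and p :: "(real^'n) \<times> real" and \<xi>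
  define K where "K i \<xi> = integral (cbox (?a, 0) (?b, 1)) (\<lambda>p. F i p \<xi>)" for i \<xi>
  have sm: "smooth_on UNIV \<phi>" by (rule test_function_smooth[OF \<phi>])
  have cont: "continuous_on A \<theta>" "continuous_on A (iter_pderiv js \<phi>)" for A js
    using test_function_continuous[OF \<theta>] smooth_on_continuous[OF smooth_on_iter_pderiv[OF sm]]
    by (auto intro: continuous_on_subset)
  note comp = continuous_on_compose2[OF cont(1)[of UNIV]] continuous_on_compose2[OF cont(2)[of UNIV]]
    continuous_on_compose2[OF cont(2)[of UNIV "[]", simplified]]
  have smT: "smooth_on UNIV (\<lambda>\<xi>. \<phi> (1 *\<^sub>R \<xi> + d))" for d
    using smooth_on_affine[OF open_UNIV sm, of 1 d] by simp
  have smF: "smooth_on UNIV (F i p)" for i p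
    unfolding F_def[abs_def] by (intro smooth_on_mult smooth_on_const smT) auto
  have iterT: "iter_pderiv js (\<lambda>\<xi>. k * \<phi> (1 *\<^sub>R \<xi> + d)) \<xi> = k * iter_pderiv js \<phi> (1 *\<^sub>R \<xi> + d)" for js k d \<xi>
    using iter_pderiv_bounded_linear[OF open_UNIV bounded_linear_mult_right smT, of \<xi> js]
      iter_pderiv_affine[OF open_UNIV sm, of 1 \<xi> _ js] by simp
  have iterF: "iter_pderiv js (F i p) \<xi>
      = - (of_real (fst p $ i) * \<theta> (fst p)) * iter_pderiv js \<phi> (1 *\<^sub>R \<xi> + (- snd p *\<^sub>R fst p))" for js i p \<xi>
    unfolding F_def[abs_def] by (rule iterT)
  have contF: "continuous_on (UNIV \<times> cbox (?a, 0) (?b, 1)) (\<lambda>(\<xi>, p). iter_pderiv js (F i p) \<xi>)" for i js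
    unfolding iterF case_prod_unfold
    by (intro continuous_intros comp) auto
  have smK: "smooth_on UNIV (K i)" for i
    unfolding K_def[abs_def] by (rule smooth_on_parametric_integral[OF open_UNIV smF contF])
  have pdK: "pderiv_at i (K i) \<xi> = integral (cbox (?a, 0) (?b, 1))
      (\<lambda>p. - (of_real (fst p $ i) * \<theta> (fst p)) * pderiv_at i \<phi> (1 *\<^sub>R \<xi> + (- snd p *\<^sub>R fst p)))" for i \<xi>
    using iter_pderiv_parametric_integral[OF open_UNIV smF contF, of \<xi> "[i]"]
    unfolding K_def[abs_def] iterF by simp
  show ?thesis
  proof (rule that[of K])
    fix i
    obtain B where B: "\<And>y. y \<in> cube R \<Longrightarrow> norm (y :: real^'n) \<le> B"
      using bounded_cbox[of ?a ?b] unfolding bounded_iff by blast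
    have "K i \<xi> = 0" if "norm \<xi> > R + B" for \<xi>
    proof -
      have "F i p \<xi> = 0" if p: "p \<in> cbox (?a, 0) (?b, 1)" for p
      proof -
        obtain y s where ys: "p = (y, s)" by (cases p)
        have y: "norm y \<le> B" and s: "0 \<le> s" "s \<le> 1" using p B unfolding ys by (auto simp: cbox_Pair_eq)
        have "norm (s *\<^sub>R y) \<le> 1 * B" unfolding norm_scaleR using y s by (intro mult_mono) auto
        then have "norm (\<xi> - s *\<^sub>R y) > R" using \<open>norm \<xi> > R + B\<close> norm_triangle_ineq2[of \<xi> "s *\<^sub>R y"] by linarith
        then show ?thesis by (simp add: F_def ys R(2))
      qed
      then show ?thesis unfolding K_def by (subst integral_cong[of _ _ "\<lambda>_. 0"]) auto
    qed
    then show "test_function (K i)" by (rule test_functionI[OF smK])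
  next
    fix \<xi> :: "real^'n"
    let ?G = "\<lambda>p. \<theta> (fst p) * (\<Sum>i\<in>UNIV. of_real ((- fst p) $ i) * pderiv_at i \<phi> (\<xi> - snd p *\<^sub>R fst p))"
    note cont1 = cont(2)[of UNIV "[_]", simplified]
    have int: "(\<lambda>p. - (of_real (fst p $ i) * \<theta> (fst p)) * pderiv_at i \<phi> (1 *\<^sub>R \<xi> + (- snd p *\<^sub>R fst p)))
        integrable_on cbox (?a, 0) (?b, 1)" for i
      by (intro integrable_continuous continuous_intros comp continuous_on_compose2[OF cont1]) auto
    have "(\<Sum>i\<in>UNIV. pderiv_at i (K i) \<xi>) = integral (cbox (?a, 0) (?b, 1)) ?G"
    proof -
      have "(\<Sum>i\<in>UNIV. pderiv_at i (K i) \<xi>) = integral (cbox (?a, 0) (?b, 1))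
          (\<lambda>p. \<Sum>i\<in>UNIV. - (of_real (fst p $ i) * \<theta> (fst p)) * pderiv_at i \<phi> (1 *\<^sub>R \<xi> + (- snd p *\<^sub>R fst p)))"
        unfolding pdK by (rule integral_sum[symmetric]) (rule finite, rule int)
      also have "\<dots> = integral (cbox (?a, 0) (?b, 1)) ?G"
        by (intro integral_cong) (simp add: sum_distrib_left mult_ac)
      finally show ?thesis .
    qed
    also have "\<dots> = integral (cube R) (\<lambda>y. integral (cbox 0 1) (\<lambda>s. ?G (y, s)))"
      by (intro integral_prod_continuous continuous_intros comp continuous_on_compose2[OF cont1]) auto
    also have "\<dots> = integral (cube R) (\<lambda>y. \<theta> y * \<phi> (\<xi> - y) - \<theta> y * \<phi> \<xi>)"
    proof (rule integral_cong)
      fix y :: "real^'n"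
      have "((\<lambda>s. \<phi> (\<xi> - s *\<^sub>R y)) has_vector_derivative
          (\<Sum>i\<in>UNIV. of_real ((- y) $ i) * pderiv_at i \<phi> (\<xi> - s *\<^sub>R y))) (at s within {0..1})" for s
      proof (rule pderiv_chain)
        show "((\<lambda>s. \<xi> - s *\<^sub>R y) has_vector_derivative - y) (at s within {0..1})"
          by (auto simp: has_vector_derivative_def intro!: derivative_eq_intros)
      qed (use sm smooth_on_differentiable in blast)
      then have "((\<lambda>s. (\<Sum>i\<in>UNIV. of_real ((- y) $ i) * pderiv_at i \<phi> (\<xi> - s *\<^sub>R y))) has_integral
          \<phi> (\<xi> - 1 *\<^sub>R y) - \<phi> (\<xi> - 0 *\<^sub>R y)) {0..1}"
        by (intro fundamental_theorem_of_calculus) auto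
      from has_integral_mult_right[OF this, of "\<theta> y"]
      show "integral (cbox 0 1) (\<lambda>s. ?G (y, s)) = \<theta> y * \<phi> (\<xi> - y) - \<theta> y * \<phi> \<xi>"
        by (intro integral_unique) (simp add: right_diff_distrib)
    qed
    also have "\<dots> = integral (cube R) (\<lambda>y. \<theta> y * \<phi> (\<xi> - y)) - integral (cube R) \<theta> * \<phi> \<xi>"
      by (subst integral_diff) (auto intro!: integrable_continuous continuous_intros comp)
    also have "integral (cube R) \<theta> = (LINT y|lborel. \<theta> y)"
    proof (rule continuous_bounded_support_lborel(2)[symmetric, OF cont(1)])
      show "\<theta> y = 0" if "y \<notin> cube R" for y
        using R(3)[of y] norm_le_in_cube[of y R] that by fastforce
    qed
    also have "integral (cube R) (\<lambda>y. \<theta> y * \<phi> (\<xi> - y)) = (LINT y|lborel. \<theta> y * \<phi> (\<xi> - y))"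
    proof (rule continuous_bounded_support_lborel(2)[symmetric])
      show "continuous_on UNIV (\<lambda>y. \<theta> y * \<phi> (\<xi> - y))" by (intro continuous_intros comp) auto
      show "\<theta> y * \<phi> (\<xi> - y) = 0" if "y \<notin> cube R" for y
        using R(3)[of y] norm_le_in_cube[of y R] that by fastforce
    qed
    finally show "(LINT y|lborel. \<theta> y * \<phi> (\<xi> - y)) = (LINT y|lborel. \<theta> y) * \<phi> \<xi> + (\<Sum>i\<in>UNIV. pderiv_at i (K i) \<xi>)"
      by simp
  qed
qed

lemma convolution_commute:
  fixes \<phi> \<theta> :: "real^'n::finite \<Rightarrow> complex"
  assumes "test_function \<phi>" "test_function \<theta>"
  shows "(LINT y|lborel. \<theta> y * \<phi> (\<xi> - y)) = (LINT y|lborel. \<phi> y * \<theta> (\<xi> - y))"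
proof -
  have "continuous_on UNIV (\<lambda>y. \<theta> y * \<phi> (\<xi> - y))"
    by (intro continuous_intros continuous_on_compose2[OF test_function_continuous[OF assms(1)]]
        test_function_continuous[OF assms(2)]) auto
  then have "(\<lambda>y. \<theta> y * \<phi> (\<xi> - y)) \<in> borel_measurable borel"
    by (rule borel_measurable_continuous_onI)
  from lborel_integral_affine[of "- 1", OF _ this, of \<xi>] show ?thesis
    by (simp add: mult.commute)
qed

text \<open>A functional that vanishes on derivatives sees a convolution as the product of one factor's mass
  with its value on the other; exchanging the factors shows that its value is proportional to the mass.\<close>
lemma closed_functional_proportional_to_integral:
  fixes L :: "(real^'n::finite \<Rightarrow> complex) \<Rightarrow> complex"
  assumes add: "\<And>\<phi> \<theta>. test_function \<phi> \<Longrightarrow> test_function \<theta> \<Longrightarrow> L (\<lambda>\<xi>. \<phi> \<xi> + \<theta> \<xi>) = L \<phi> + L \<theta>"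
    and cmult: "\<And>\<phi> c. test_function \<phi> \<Longrightarrow> L (\<lambda>\<xi>. c * \<phi> \<xi>) = c * L \<phi>"
    and closed: "\<And>\<phi> i. test_function \<phi> \<Longrightarrow> L (pderiv_at i \<phi>) = 0"
    and \<phi>: "test_function \<phi>" and \<theta>: "test_function \<theta>"
  shows "(LINT y|lborel. \<theta> y) * L \<phi> = (LINT y|lborel. \<phi> y) * L \<theta>"
proof -
  have zero: "L (\<lambda>_. 0) = 0" using cmult[OF test_function_zero, of 0] by simp
  have sum: "L (\<lambda>\<xi>. \<Sum>k\<in>K. f k \<xi>) = (\<Sum>k\<in>K. L (f k))" if "\<And>k. k \<in> K \<Longrightarrow> test_function (f k)"
    for K :: "'n set" and f
    using that by (induction K rule: infinite_finite_induct) (auto simp: zero add test_function_sum)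
  have conv: "L (\<lambda>\<xi>. LINT y|lborel. \<beta> y * \<alpha> (\<xi> - y)) = (LINT y|lborel. \<beta> y) * L \<alpha>"
    if \<alpha>: "test_function \<alpha>" and \<beta>: "test_function \<beta>" for \<alpha> \<beta>
  proof -
    obtain K where K: "\<And>i. test_function (K i)" and eq: "\<And>\<xi>. (LINT y|lborel. \<beta> y * \<alpha> (\<xi> - y))
        = (LINT y|lborel. \<beta> y) * \<alpha> \<xi> + (\<Sum>i\<in>UNIV. pderiv_at i (K i) \<xi>)"
      using convolution_minus_mass_is_divergence[OF \<alpha> \<beta>] by blast
    show ?thesis unfolding eq
      by (subst add) (auto simp: sum[of UNIV "\<lambda>i. pderiv_at i (K i)"] cmult closed K \<alpha> test_function_pderiv
             intro!: test_function_cmult test_function_sum)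
  qed
  show ?thesis
    using conv[OF \<phi> \<theta>] conv[OF \<theta> \<phi>] convolution_commute[OF \<phi> \<theta>] by simp
qed

lemma
  fixes \<sigma> :: "real^'n::{finite,linorder} \<Rightarrow> complex"
  assumes \<sigma>: "\<sigma> \<in> symbols a" and a: "Re a + real n + 1 < 0" and \<xi>: "\<xi> \<noteq> 0"
  shows ray_integral_add: "\<tau> \<in> symbols a \<Longrightarrow> ray_integral n (\<lambda>\<xi>. \<sigma> \<xi> + \<tau> \<xi>) \<xi> = ray_integral n \<sigma> \<xi> + ray_integral n \<tau> \<xi>"
    and ray_integral_cmult: "ray_integral n (\<lambda>\<xi>. c * \<sigma> \<xi>) \<xi> = c * ray_integral n \<sigma> \<xi>"
proof -
  have inner: "((\<lambda>t. of_real t ^ k * f (t *\<^sub>R \<xi>)) has_integral inner_radial k f \<xi>) {0..1}" if "f \<in> symbols a"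
    for f k by (rule inner_radial_has_integral[OF smooth_on_continuous[OF symbols_smooth[OF that]]])
  have outer: "((\<lambda>s. of_real (inverse s) ^ (n + 1) * f (inverse s *\<^sub>R \<xi>)) has_integral outer_radial (n + 1) f \<xi>) {0..1}"
    if "f \<in> symbols a" for f by (rule outer_radial_has_integral[OF that _ _ \<xi>]) (use a in auto)
  show "ray_integral n (\<lambda>\<xi>. \<sigma> \<xi> + \<tau> \<xi>) \<xi> = ray_integral n \<sigma> \<xi> + ray_integral n \<tau> \<xi>" if \<tau>: "\<tau> \<in> symbols a"
  proof -
    have "inner_radial (n - 1) (\<lambda>\<xi>. \<sigma> \<xi> + \<tau> \<xi>) \<xi> = inner_radial (n - 1) \<sigma> \<xi> + inner_radial (n - 1) \<tau> \<xi>"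
      using has_integral_add[OF inner[OF \<sigma>] inner[OF \<tau>], of "n - 1" "n - 1"]
      by (subst inner_radial_def, intro integral_unique) (simp add: distrib_left)
    moreover have "outer_radial (n + 1) (\<lambda>\<xi>. \<sigma> \<xi> + \<tau> \<xi>) \<xi> = outer_radial (n + 1) \<sigma> \<xi> + outer_radial (n + 1) \<tau> \<xi>"
      using has_integral_add[OF outer[OF \<sigma>] outer[OF \<tau>]]
      by (subst outer_radial_def, intro integral_unique) (simp only: distrib_left)
    ultimately show ?thesis by (simp add: ray_integral_def)
  qed
  have "inner_radial (n - 1) (\<lambda>\<xi>. c * \<sigma> \<xi>) \<xi> = c * inner_radial (n - 1) \<sigma> \<xi>"
    using has_integral_mult_right[OF inner[OF \<sigma>, of "n - 1"], of c]
    by (subst inner_radial_def, intro integral_unique) (simp add: mult.left_commute)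
  moreover have "outer_radial (n + 1) (\<lambda>\<xi>. c * \<sigma> \<xi>) \<xi> = c * outer_radial (n + 1) \<sigma> \<xi>"
    using has_integral_mult_right[OF outer[OF \<sigma>], of c]
    by (subst outer_radial_def, intro integral_unique) (simp only: mult.left_commute)
  ultimately show "ray_integral n (\<lambda>\<xi>. c * \<sigma> \<xi>) \<xi> = c * ray_integral n \<sigma> \<xi>"
    by (simp add: ray_integral_def distrib_left)
qed

section \<open>The functional induced on test functions\<close>

context closed_singular_form
begin

definition ray_form :: "(real^'n::{finite,linorder} \<Rightarrow> complex) \<Rightarrow> complex"
  where "ray_form \<phi> = \<rho> (\<lambda>\<xi>. of_real (\<psi> \<xi>) * ray_integral CARD('n) \<phi> \<xi>)"

lemma cutoff_at_0: "\<psi> 0 = 0"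
  using cutoff_nbhd[OF cutoff] by blast

lemma cutoff_ray_integral_CS:
  assumes "test_function \<phi>" "n > 0"
  shows "(\<lambda>\<xi>. of_real (\<psi> \<xi>) * ray_integral n \<phi> \<xi>) \<in> CS"
proof -
  have "\<phi> \<in> symbols (- of_nat n - 2)" by (rule test_function_symbols[OF assms(1)])
  from CS_base[OF cutoff_homogeneous_CS_order(2)[OF cutoff smooth_on_ray_integral[OF this _ assms(2)]
        pos_homogeneous_ray_integral[OF this _ assms(2)]]]
  show ?thesis by simp
qed

lemma ray_form_add:
  assumes "test_function \<phi>" "test_function \<theta>"
  shows "ray_form (\<lambda>\<xi>. \<phi> \<xi> + \<theta> \<xi>) = ray_form \<phi> + ray_form \<theta>"
proof -
  have "of_real (\<psi> \<xi>) * ray_integral CARD('n) (\<lambda>\<xi>. \<phi> \<xi> + \<theta> \<xi>) \<xi>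
      = of_real (\<psi> \<xi>) * ray_integral CARD('n) \<phi> \<xi> + of_real (\<psi> \<xi>) * ray_integral CARD('n) \<theta> \<xi>" for \<xi>
    using ray_integral_add[OF test_function_symbols[OF assms(1)] _ _ test_function_symbols[OF assms(2)],
        of "- of_nat CARD('n) - 2" "CARD('n)" \<xi>]
    by (cases "\<xi> = 0") (simp_all add: cutoff_at_0 distrib_left)
  then show ?thesis unfolding ray_form_def
    using \<rho>_add[OF cutoff_ray_integral_CS[OF assms(1)] cutoff_ray_integral_CS[OF assms(2)]] by simp
qed

lemma ray_form_cmult:
  assumes "test_function \<phi>"
  shows "ray_form (\<lambda>\<xi>. c * \<phi> \<xi>) = c * ray_form \<phi>"
proof -
  have "of_real (\<psi> \<xi>) * ray_integral CARD('n) (\<lambda>\<xi>. c * \<phi> \<xi>) \<xi>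
      = c * (of_real (\<psi> \<xi>) * ray_integral CARD('n) \<phi> \<xi>)" for \<xi>
    using ray_integral_cmult[OF test_function_symbols[OF assms], of "- of_nat CARD('n) - 2" "CARD('n)" \<xi> c]
    by (cases "\<xi> = 0") (simp_all add: cutoff_at_0)
  then show ?thesis unfolding ray_form_def
    using \<rho>_cmult[OF cutoff_ray_integral_CS[OF assms], of "CARD('n)" c] by (simp only: zero_less_card_finite)
qed

text \<open>The ray integral of a derivative is the derivative of the ray integral with one power of the
  parameter less; for that one to exist near the origin the dimension must be at least two.\<close>
lemma ray_form_pderiv:
  assumes \<phi>: "test_function \<phi>" and n: "CARD('n) \<ge> 2"
  shows "ray_form (pderiv_at i \<phi>) = 0"
proof -
  define m where "m = CARD('n) - 1"
  have m: "m > 0" "CARD('n) = Suc m" using n by (auto simp: m_def)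
  have sym: "\<phi> \<in> symbols (- of_nat m - 2)" by (rule test_function_symbols[OF \<phi>])
  let ?w = "ray_integral m \<phi>" and ?\<psi> = "\<lambda>\<xi>. complex_of_real (\<psi> \<xi>)"
  have smw: "smooth_on (- {0}) ?w" by (rule smooth_on_ray_integral[OF sym _ m(1)]) simp
  have eq: "?\<psi> \<xi> * ray_integral CARD('n) (pderiv_at i \<phi>) \<xi>
      = pderiv_at i (\<lambda>\<xi>. ?\<psi> \<xi> * ?w \<xi>) \<xi> + (- 1) * (pderiv_at i ?\<psi> \<xi> * ?w \<xi>)" for \<xi>
  proof (cases "\<xi> = 0")
    case False
    then have "pderiv_at i ?w \<xi> = ray_integral CARD('n) (pderiv_at i \<phi>) \<xi>"
      using pderiv_ray_integral[OF sym _ m(1) False] m(2) by simp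
    moreover have "pderiv_at i (\<lambda>\<xi>. ?\<psi> \<xi> * ?w \<xi>) \<xi> = pderiv_at i ?\<psi> \<xi> * ?w \<xi> + ?\<psi> \<xi> * pderiv_at i ?w \<xi>"
      using False smooth_on_differentiable[OF smw, of \<xi>] smooth_on_differentiable[OF cutoff_smooth[OF cutoff]]
      by (intro pderiv_at_mult) auto
    ultimately show ?thesis by simp
  next
    case True
    obtain U where U: "open U" "0 \<in> U" "\<And>\<xi>. \<xi> \<in> U \<Longrightarrow> \<psi> \<xi> = 0"
      using cutoff_nbhd[OF cutoff] by blast
    have "pderiv_at i (\<lambda>\<xi>. ?\<psi> \<xi> * ?w \<xi>) 0 = pderiv_at i (\<lambda>_. 0) 0"
      by (rule pderiv_at_cong_open[OF U(1,2)]) (simp add: U(3))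
    moreover have "pderiv_at i ?\<psi> 0 = pderiv_at i (\<lambda>_. 0) 0"
      by (rule pderiv_at_cong_open[OF U(1,2)]) (simp add: U(3))
    ultimately show ?thesis using True by (simp add: cutoff_at_0)
  qed
  have CSw: "(\<lambda>\<xi>. ?\<psi> \<xi> * ?w \<xi>) \<in> CS" by (rule cutoff_ray_integral_CS[OF \<phi> m(1)])
  have s: "(\<lambda>\<xi>. pderiv_at i ?\<psi> \<xi> * ?w \<xi>) \<in> CS_smoothing"
    by (rule pderiv_cutoff_mult_smoothing[OF cutoff smw])
  have "\<rho> (pderiv_at i (\<lambda>\<xi>. ?\<psi> \<xi> * ?w \<xi>)) = 0" using stokes CSw unfolding stokes_def by blast
  moreover have "\<rho> (\<lambda>\<xi>. (- 1) * (pderiv_at i ?\<psi> \<xi> * ?w \<xi>)) = 0"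
    using \<rho>_cmult[OF smoothing_in_CS[OF s], of "- 1"] \<rho>_smoothing[OF s] by (simp only: mult_zero_right)
  ultimately show ?thesis unfolding ray_form_def eq
    using \<rho>_add[OF CS_pderiv[OF CSw] CS_scale[OF smoothing_in_CS[OF s], of "- 1"]] by simp
qed

end

text \<open>Along each ray the radial slope of a cutoff has total logarithmic mass one, so every homogeneous
  function of critical degree is the ray integral of its product with that slope.\<close>
lemma ray_integral_radial_slope:
  fixes h :: "real^'n::{finite,linorder} \<Rightarrow> complex" and \<psi> :: "real^'n::{finite,linorder} \<Rightarrow> real"
  assumes \<psi>: "cutoff \<psi>" and h: "smooth_on (- {0}) h" "pos_homogeneous (- of_nat CARD('n)) h" and \<xi>: "\<xi> \<noteq> 0"
  shows "ray_integral CARD('n) (\<lambda>\<xi>. radial_slope \<psi> \<xi> * h \<xi>) \<xi> = h \<xi>"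
proof -
  let ?n = "CARD('n)"
  let ?g = "\<lambda>\<xi>. of_real (\<psi> \<xi>) * h \<xi>"
  have sm: "smooth_on UNIV ?g" by (rule smooth_on_cutoff_mult[OF \<psi> h(1)])
  have q: "(\<lambda>\<xi>. radial_slope \<psi> \<xi> * h \<xi>) = (\<lambda>\<xi>. of_nat ?n * ?g \<xi> + euler ?g \<xi>)"
    using divergence_cutoff_homogeneous[OF \<psi> h] divergence_radial[OF smooth_on_differentiable[OF sm UNIV_I]] by (intro ext) simp
  have "inner_radial (?n - 1) (\<lambda>\<xi>. radial_slope \<psi> \<xi> * h \<xi>) \<xi> = ?g \<xi>"
    unfolding q using inner_radial_primitive[OF sm, of "?n - 1" \<xi>] by simp
  moreover have "outer_radial (?n + 1) (\<lambda>\<xi>. radial_slope \<psi> \<xi> * h \<xi>) \<xi> = h \<xi> - ?g \<xi>"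
    unfolding q Suc_eq_plus1[symmetric]
  proof (rule outer_radial_primitive[OF sm])
    have "\<forall>\<^sub>F s in at_right 0. h \<xi> = of_real (inverse s) ^ ?n * ?g (inverse s *\<^sub>R \<xi>)"
      unfolding eventually_at_right_field
    proof (intro exI[of _ "norm \<xi>"] conjI allI impI)
      fix s :: real assume s: "0 < s" "s < norm \<xi>"
      then have "1 < norm (inverse s *\<^sub>R \<xi>)" by (simp add: field_simps)
      then have "\<psi> (inverse s *\<^sub>R \<xi>) = 1" by (intro cutoff_eq_1[OF \<psi>]) simp
      moreover have "complex_of_real (inverse s) powr (- of_nat ?n) = inverse (complex_of_real (inverse s) ^ ?n)"
        using s by (simp add: powr_minus powr_nat')
      ultimately show "h \<xi> = of_real (inverse s) ^ ?n * ?g (inverse s *\<^sub>R \<xi>)"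
        using pos_homogeneousD[OF h(2), of "inverse s" \<xi>] s \<xi> by (simp add: field_simps)
    qed (use \<xi> in auto)
    then show "((\<lambda>s. of_real (inverse s) ^ ?n * ?g (inverse s *\<^sub>R \<xi>)) \<longlongrightarrow> h \<xi>) (at_right 0)"
      by (rule Lim_transform_eventually[OF tendsto_const])
  qed
  ultimately show ?thesis by (simp add: ray_integral_def)
qed

section \<open>Polar coordinates\<close>

lemma scale_measure_eq_density: "scale_measure (ennreal r) M = density M (\<lambda>_. ennreal r)"
  by (rule measure_eqI) (simp_all add: emeasure_density_const)

lemma integral_sphere_measure:
  fixes f :: "real^'n::finite \<Rightarrow> complex"
  assumes f: "continuous_on (- {0}) f"
  shows "(LINT \<xi>|sphere_measure. f \<xi>)
    = of_nat CARD('n) * (LINT x|lborel. indicator (ball 0 1 - {0}) x *\<^sub>R f (sgn x))"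
proof -
  let ?S = "restrict_space borel (sphere (0::real^'n) 1)" and ?B = "restrict_space lborel (ball (0::real^'n) 1 - {0})"
  have f': "f \<in> borel_measurable ?S"
    by (rule borel_measurable_continuous_on_restrict[OF continuous_on_subset[OF f]]) auto
  have "(sgn :: real^'n \<Rightarrow> _) \<in> borel_measurable borel"
    unfolding sgn_div_norm[abs_def] by measurable
  then have sgn: "sgn \<in> measurable ?B ?S"
    by (intro measurable_restrict_space2 measurable_restrict_space1) (auto simp: space_restrict_space norm_sgn)
  have "sphere_measure = density (distr ?B ?S sgn) (\<lambda>_. ennreal (real CARD('n)))"
    unfolding sphere_measure_def scale_measure_eq_density[symmetric] by (simp add: ennreal_of_nat_eq_real_of_nat)
  then have "(LINT \<xi>|sphere_measure. f \<xi>) = (LINT \<xi>|density (distr ?B ?S sgn) (\<lambda>_. ennreal (real CARD('n))). f \<xi>)"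
    by (rule arg_cong)
  also have "\<dots> = (LINT \<xi>|distr ?B ?S sgn. real CARD('n) *\<^sub>R f \<xi>)"
    by (rule integral_density) (use f' in auto)
  also have "\<dots> = real CARD('n) *\<^sub>R (LINT \<xi>|distr ?B ?S sgn. f \<xi>)" by simp
  also have "(LINT \<xi>|distr ?B ?S sgn. f \<xi>) = (LINT x|?B. f (sgn x))"
    by (rule integral_distr[OF sgn f'])
  also have "\<dots> = (LINT x|lborel. indicator (ball 0 1 - {0}) x *\<^sub>R f (sgn x))"
    by (rule integral_restrict_space) simp
  finally show ?thesis by (simp add: scaleR_conv_of_real[where 'a = complex])
qed

lemma lborel_Fubini_bounded:
  fixes f :: "'a::euclidean_space \<times> 'b::euclidean_space \<Rightarrow> complex"
  assumes "f \<in> borel_measurable borel" "\<And>p. norm (f p) \<le> B" "bounded S" "\<And>p. p \<notin> S \<Longrightarrow> f p = 0"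
  shows "(LINT y|lborel. LINT x|lborel. f (x, y)) = (LINT x|lborel. LINT y|lborel. f (x, y))"
proof -
  have S: "closure S \<in> sets lborel" "emeasure lborel (closure S) < \<infinity>"
    using emeasure_bounded_finite[OF bounded_closure[OF assms(3)]] by auto
  have "integrable lborel f"
  proof (rule integrableI_bounded_set[where B = B, OF S(1) _ S(2)])
    show "AE x in lborel. x \<notin> closure S \<longrightarrow> f x = 0"
      using assms(4) closure_subset[of S] by (intro AE_I2) blast
  qed (use assms in auto)
  then have "integrable (lborel \<Otimes>\<^sub>M lborel) (\<lambda>(x, y). f (x, y))"
    by (simp add: lborel_prod case_prod_unfold)
  from lborel_pair.Fubini_integral[OF this] show ?thesis .
qed

text \<open>The integrand is the derivative of the cutoff along the ray, and the range \<open>0 \<le> t \<le> 2\<close> is long enough for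
  the cutoff to rise from zero to one.\<close>
lemma radial_slope_ray_mass:
  fixes \<psi> :: "real^'n::finite \<Rightarrow> real"
  assumes \<psi>: "cutoff \<psi>" and x: "norm x \<ge> 1/2"
  shows "(LINT t|lborel. indicator {0..2} t *\<^sub>R
      (\<Sum>i\<in>UNIV. of_real (x $ i) * pderiv_at i (\<lambda>\<xi>. complex_of_real (\<psi> \<xi>)) (t *\<^sub>R x))) = 1"
proof -
  let ?\<psi> = "\<lambda>\<xi>. complex_of_real (\<psi> \<xi>)"
  have sm: "smooth_on UNIV ?\<psi>" by (rule cutoff_smooth[OF \<psi>])
  have "(LINT t|lborel. indicator {0..2} t *\<^sub>R
      (\<Sum>i\<in>UNIV. of_real (x $ i) * pderiv_at i ?\<psi> (t *\<^sub>R x))) = ?\<psi> (2 *\<^sub>R x) - ?\<psi> (0 *\<^sub>R x)"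
  proof (rule integral_FTC_Icc)
    fix t :: real
    show "((\<lambda>t. ?\<psi> (t *\<^sub>R x)) has_vector_derivative (\<Sum>i\<in>UNIV. of_real (x $ i) * pderiv_at i ?\<psi> (t *\<^sub>R x))) (at t within {0..2})"
    proof (rule pderiv_chain)
      show "((\<lambda>t. t *\<^sub>R x) has_vector_derivative x) (at t within {0..2})"
        by (auto simp: has_vector_derivative_def intro!: derivative_eq_intros)
    qed (use sm smooth_on_differentiable in blast)
  next
    show "continuous_on {0..2} (\<lambda>t. \<Sum>i\<in>UNIV. of_real (x $ i) * pderiv_at i ?\<psi> (t *\<^sub>R x))"
      by (intro continuous_intros continuous_on_compose2[OF smooth_on_continuous[OF smooth_on_pderiv[OF sm]]]) auto
  qed simp
  moreover have "\<psi> (2 *\<^sub>R x) = 1" by (rule cutoff_eq_1[OF \<psi>]) (use x in simp)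
  moreover have "\<psi> 0 = 0" using cutoff_nbhd[OF \<psi>] by blast
  ultimately show ?thesis by simp
qed

lemma integral_inverse_power:
  assumes "0 < r" "n > 0"
  shows "(LINT t|lborel. indicator {r<..2 * r} t *\<^sub>R complex_of_real (real n * inverse t ^ (n + 1)))
    = of_real (inverse r ^ n * (1 - inverse 2 ^ n))"
proof -
  have "(LINT t|lborel. indicator {r<..2 * r} t *\<^sub>R complex_of_real (real n * inverse t ^ (n + 1)))
      = (LINT t|lborel. indicator {r..2 * r} t *\<^sub>R complex_of_real (real n * inverse t ^ (n + 1)))"
  proof (rule integral_cong_AE)
    show "AE t in lborel. indicator {r<..2 * r} t *\<^sub>R complex_of_real (real n * inverse t ^ (n + 1))
       = indicator {r..2 * r} t *\<^sub>R complex_of_real (real n * inverse t ^ (n + 1))"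
      using AE_lborel_singleton[of r] by eventually_elim (auto simp: indicator_def)
  qed auto
  also have "\<dots> = complex_of_real (- (inverse (2 * r) ^ n)) - complex_of_real (- (inverse r ^ n))"
  proof (rule integral_FTC_Icc)
    fix t :: real assume t: "r \<le> t" "t \<le> 2 * r"
    have "((\<lambda>t. - (inverse t ^ n)) has_real_derivative real n * inverse t ^ (n + 1)) (at t within {r..2 * r})"
    proof (rule DERIV_cong[OF DERIV_minus[OF DERIV_power[OF DERIV_inverse]]])
      show "- (real n * (- (inverse t ^ Suc (Suc 0)) * inverse t ^ (n - Suc 0))) = real n * inverse t ^ (n + 1)"
        using assms by (cases n) simp_all
    qed (use t assms in auto)
    then show "((\<lambda>t. complex_of_real (- (inverse t ^ n))) has_vector_derivative complex_of_real (real n * inverse t ^ (n + 1)))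
        (at t within {r..2 * r})"
      by (intro has_vector_derivative_of_real) (simp add: has_real_derivative_iff_has_vector_derivative)
  next
    show "continuous_on {r..2 * r} (\<lambda>t. complex_of_real (real n * inverse t ^ (n + 1)))"
      using assms by (intro continuous_intros) auto
  qed (use assms in auto)
  also have "\<dots> = of_real (inverse r ^ n * (1 - inverse 2 ^ n))"
    unfolding inverse_mult_distrib power_mult_distrib by (simp add: algebra_simps)
  finally show ?thesis .
qed

text \<open>Insert the factor \<open>1 = \<integral> (d/dt \<psi>(t x)) dt\<close> into the integral of \<open>h (sgn x)\<close>, exchange the integrals and
  substitute \<open>t x\<close> for \<open>x\<close>. With \<open>x\<close> restricted to the shell \<open>1/2 \<le> |x| < 1\<close> instead of the unit ball, all
  integrands are bounded with bounded support; both sides of the identity then carry the same factor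
  \<open>1 - 2\<^sup>-\<^sup>n\<close>.\<close>
lemma integral_radial_slope:
  fixes h :: "real^'n::finite \<Rightarrow> complex"
  assumes \<psi>: "cutoff \<psi>" and h: "smooth_on (- {0}) h" "pos_homogeneous (- of_nat CARD('n)) h"
  shows "(LINT \<xi>|lborel. radial_slope \<psi> \<xi> * h \<xi>) = (LINT \<xi>|sphere_measure. h \<xi>)"
proof -
  let ?n = "CARD('n)"
  let ?\<psi> = "\<lambda>\<xi>. complex_of_real (\<psi> \<xi>)"
  let ?I = "indicator {1/2..<1} :: real \<Rightarrow> real"
  define g where "g x = indicator (- {0}) x *\<^sub>R h (sgn x)" for x :: "real^'n"
  \<comment> \<open>Outside t = 0 this is the radial slope at t x divided by t; in this form it is continuous in t.\<close>
  define D where "D t x = (\<Sum>i\<in>UNIV. of_real (x $ i) * pderiv_at i ?\<psi> (t *\<^sub>R x))" for t x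
  have sm: "smooth_on UNIV ?\<psi>" by (rule cutoff_smooth[OF \<psi>])
  have contD: "continuous_on UNIV (\<lambda>p. D (snd p) (fst p))"
    unfolding D_def
    by (intro continuous_intros continuous_on_compose2[OF smooth_on_continuous[OF smooth_on_pderiv[OF sm]]]) auto
  have contq: "continuous_on UNIV (radial_slope \<psi>)"
    unfolding radial_slope_def by (intro smooth_on_continuous smooth_on_euler sm) auto
  have conth: "continuous_on (- {0}) h" by (rule smooth_on_continuous[OF h(1)])
  have "continuous_on (- {0}) (\<lambda>x. h (sgn x))"
    by (intro continuous_on_compose2[OF conth] continuous_intros) (auto simp: sgn_zero_iff)
  then have g_meas [measurable]: "g \<in> borel_measurable borel"
    unfolding g_def[abs_def] by (rule borel_measurable_continuous_on_indicator[rotated]) auto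
  have [measurable]: "(\<lambda>p. D (snd p) (fst p)) \<in> borel_measurable (borel \<Otimes>\<^sub>M borel)" "radial_slope \<psi> \<in> borel_measurable borel"
    unfolding borel_prod
    by (rule borel_measurable_continuous_onI[OF contD], rule borel_measurable_continuous_onI[OF contq])
  have gscale: "g (c *\<^sub>R x) = g x" if "c > 0" for c x
    using that by (auto simp: g_def sgn_scaleR indicator_def)
  obtain G where G: "G \<ge> 0" "\<And>x. norm (g x) \<le> G"
  proof -
    have "compact (h ` sphere 0 1)"
      by (intro compact_continuous_image continuous_on_subset[OF conth]) auto
    from compact_imp_bounded[OF this] obtain B where B: "\<forall>y\<in>h ` sphere 0 1. norm y \<le> B"
      unfolding bounded_iff by blast
    have "norm (g x) \<le> max 0 B" for x
    proof (cases "x = 0")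
      case False
      then have "sgn x \<in> sphere 0 1" by (simp add: norm_sgn)
      then have "norm (h (sgn x)) \<le> B" using B by blast
      then show ?thesis using False by (simp add: g_def)
    qed (simp add: g_def)
    then show ?thesis using that[of "max 0 B"] by auto
  qed
  obtain U where U: "open U" "0 \<in> U" "\<And>\<xi> i. \<xi> \<in> U \<or> norm \<xi> > 1 \<Longrightarrow> pderiv_at i ?\<psi> \<xi> = 0"
    using cutoff_derivative_support[OF \<psi>] by blast
  obtain d where d: "d > 0" "ball 0 d \<subseteq> U" using U open_contains_ball by blast
  have slope0: "radial_slope \<psi> \<xi> = 0" if "norm \<xi> < d \<or> norm \<xi> > 1" for \<xi>
    using that d U(3)[of \<xi>] by (auto simp: radial_slope_def euler_def)
  have Dslope: "D t (inverse t *\<^sub>R \<xi>) = inverse (of_real t) * radial_slope \<psi> \<xi>" if "t > 0" for t \<xi>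
    using that by (simp add: D_def radial_slope_def euler_def sum_distrib_left mult_ac)
  have D0: "D 0 x = 0" for x using U by (simp add: D_def)
  \<comment> \<open>Up to the Jacobian of the substitution, F at (x, t) is H at (t x, t).\<close>
  define F where "F p = (?I (norm (fst p)) * indicator {0..2} (snd p)) *\<^sub>R (of_nat ?n * g (fst p) * D (snd p) (fst p))"
    for p :: "(real^'n) \<times> real"
  define H where "H p = (?I (norm (fst p) * inverse (snd p)) * indicator {0..2} (snd p)) *\<^sub>R
      (of_real (real ?n * inverse (snd p) ^ (?n + 1)) * (g (fst p) * radial_slope \<psi> (fst p)))"
    for p :: "(real^'n) \<times> real"
  have shell: "(LINT x|lborel. LINT t|lborel. F (x, t)) = of_nat ?n * (LINT x|lborel. ?I (norm x) *\<^sub>R g x)"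
  proof -
    have "(LINT t|lborel. F (x, t)) = of_nat ?n * (?I (norm x) *\<^sub>R g x)" for x
    proof (cases "1/2 \<le> norm x \<and> norm x < 1")
      case True
      have "(LINT t|lborel. F (x, t)) = (LINT t|lborel. (of_nat ?n * g x) * (indicator {0..2} t *\<^sub>R D t x))"
        using True by (intro Bochner_Integration.integral_cong) (auto simp: F_def)
      also have "\<dots> = of_nat ?n * g x * (LINT t|lborel. indicator {0..2} t *\<^sub>R D t x)"
        by (rule integral_mult_right_zero)
      also have "\<dots> = of_nat ?n * g x"
        using radial_slope_ray_mass[OF \<psi>, of x] True by (simp add: D_def)
      finally show ?thesis using True by simp
    qed (auto simp: F_def)
    then show ?thesis by (simp only: integral_mult_right_zero)
  qed
  have swap1: "(LINT t|lborel. LINT x|lborel. F (x, t)) = (LINT x|lborel. LINT t|lborel. F (x, t))"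
  proof -
    let ?K = "cball (0::real^'n) 1 \<times> {0..2::real}"
    have "compact ((\<lambda>p. D (snd p) (fst p)) ` ?K)"
      by (intro compact_continuous_image continuous_on_subset[OF contD] compact_Times) auto
    from compact_imp_bounded[OF this] obtain B where "\<forall>y\<in>(\<lambda>p. D (snd p) (fst p)) ` ?K. norm y \<le> B"
      unfolding bounded_iff by blast
    then have B: "norm (D t x) \<le> B" if "norm x \<le> 1" "0 \<le> t" "t \<le> 2" for x t
      using that by force
    have B0: "B \<ge> 0" using order_trans[OF norm_ge_zero B[of 0 0]] by simp
    show ?thesis
    proof (rule lborel_Fubini_bounded[where S = ?K and B = "real ?n * G * B"])
      show "F \<in> borel_measurable borel" unfolding F_def[abs_def] borel_prod[symmetric] by measurable
      show "bounded ?K" by (intro bounded_Times) auto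
      show F0: "F p = 0" if "p \<notin> ?K" for p
        using that by (cases p) (auto simp: F_def indicator_def)
      show "norm (F p) \<le> real ?n * G * B" for p
      proof (cases "p \<in> ?K")
        case True
        then have "norm (F p) \<le> 1 * (real ?n * norm (g (fst p)) * norm (D (snd p) (fst p)))"
          unfolding F_def norm_scaleR norm_mult by (intro mult_mono) (auto simp: indicator_def)
        also have "\<dots> \<le> 1 * (real ?n * G * B)"
          using True B G B0 by (intro mult_mono) (auto intro!: mult_nonneg_nonneg)
        finally show ?thesis by simp
      next
        case False
        then show ?thesis using B0 G F0[OF False] by simp
      qed
    qed
  qed
  have change: "(LINT x|lborel. F (x, t)) = (LINT \<eta>|lborel. H (\<eta>, t))" for t
  proof (cases "t > 0")
    case True
    have meas: "(\<lambda>x. F (x, t)) \<in> borel_measurable borel"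
    proof -
      have "continuous_on UNIV (\<lambda>x::real^'n. (x, t))" by (intro continuous_intros)
      from continuous_on_compose2[OF contD this subset_UNIV] have "continuous_on UNIV (D t)" by simp
      then have [measurable]: "D t \<in> borel_measurable borel" by (rule borel_measurable_continuous_onI)
      show ?thesis unfolding F_def fst_conv snd_conv by measurable
    qed
    have "(LINT x|lborel. F (x, t)) = of_real (\<bar>inverse t\<bar> ^ DIM(real^'n)) * (LINT \<eta>|lborel. F (0 + inverse t *\<^sub>R \<eta>, t))"
      using True by (intro lborel_integral_affine meas) auto
    also have "\<dots> = (LINT \<eta>|lborel. of_real (\<bar>inverse t\<bar> ^ DIM(real^'n)) * F (0 + inverse t *\<^sub>R \<eta>, t))"
      by simp
    also have "\<dots> = (LINT \<eta>|lborel. H (\<eta>, t))"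
      using True by (intro Bochner_Integration.integral_cong)
        (simp_all add: F_def H_def gscale Dslope mult_ac)
    finally show ?thesis .
  next
    case False
    then show ?thesis by (cases "t = 0") (auto simp: F_def H_def D0)
  qed
  have swap2: "(LINT t|lborel. LINT \<eta>|lborel. H (\<eta>, t)) = (LINT \<eta>|lborel. LINT t|lborel. H (\<eta>, t))"
  proof -
    let ?K = "cball (0::real^'n) 1 \<times> {0..2::real}"
    have "compact (radial_slope \<psi> ` cball 0 1)"
      by (intro compact_continuous_image continuous_on_subset[OF contq]) auto
    from compact_imp_bounded[OF this] obtain B where B': "\<forall>y\<in>radial_slope \<psi> ` cball 0 1. norm y \<le> B"
      unfolding bounded_iff by blast
    have B0: "B \<ge> 0" using B' order_trans[OF norm_ge_zero, of "radial_slope \<psi> 0" B] by auto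
    have B: "norm (radial_slope \<psi> \<xi>) \<le> B" for \<xi>
      using B' B0 slope0[of \<xi>] by (cases "norm \<xi> \<le> 1") auto
    let ?C = "real ?n * inverse d ^ (?n + 1) * (G * B)"
    have C0: "?C \<ge> 0" using d G B0 by (intro mult_nonneg_nonneg) auto
    have bd: "norm (H p) \<le> ?C \<and> (p \<notin> ?K \<longrightarrow> H p = 0)" for p
    proof (cases "norm (fst p) < d \<or> norm (fst p) > 1 \<or> \<not> (0 \<le> snd p \<and> snd p \<le> 2)
        \<or> \<not> (norm (fst p) * inverse (snd p) < 1) \<or> \<not> (1/2 \<le> norm (fst p) * inverse (snd p))")
      case True
      then have "H p = 0" using slope0[of "fst p"] by (auto simp: H_def indicator_def)
      then show ?thesis using C0 by simp
    next
      case False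
      then have *: "d \<le> norm (fst p)" "norm (fst p) \<le> 1" "0 \<le> snd p" "snd p \<le> 2"
         "norm (fst p) * inverse (snd p) < 1" "1/2 \<le> norm (fst p) * inverse (snd p)" by auto
      then have pos: "snd p > 0" by (cases "snd p = 0") auto
      then have "d \<le> snd p" using *(1,5) by (simp add: field_simps)
      then have "inverse (snd p) ^ (?n + 1) \<le> inverse d ^ (?n + 1)"
        using d pos by (intro power_mono) (auto simp: le_imp_inverse_le)
      then have "norm (H p) \<le> 1 * (real ?n * inverse d ^ (?n + 1) * (G * B))"
        unfolding H_def norm_scaleR norm_mult
        using G B B0 pos d
        by (intro mult_mono) (auto simp: indicator_def norm_mult norm_power norm_inverse intro!: mult_left_mono mult_nonneg_nonneg)
      moreover have "p \<in> ?K" using * by (cases p) auto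
      ultimately show ?thesis by simp
    qed
    show ?thesis
    proof (rule lborel_Fubini_bounded[where S = ?K and B = ?C])
      show "H \<in> borel_measurable borel" unfolding H_def[abs_def] borel_prod[symmetric] by measurable
      show "bounded ?K" by (intro bounded_Times) auto
    qed (use bd in auto)
  qed
  have radial: "(LINT t|lborel. H (\<eta>, t)) = of_real (1 - inverse 2 ^ ?n) * (radial_slope \<psi> \<eta> * h \<eta>)" for \<eta>
  proof (cases "radial_slope \<psi> \<eta> = 0")
    case True
    then show ?thesis by (simp add: H_def)
  next
    case False
    then have "\<not> (norm \<eta> < d \<or> norm \<eta> > 1)" using slope0[of \<eta>] by blast
    then have \<eta>: "norm \<eta> \<ge> d" "norm \<eta> \<le> 1" by auto
    have pos: "norm \<eta> > 0" using \<eta> d by linarith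
    then have \<eta>0: "\<eta> \<noteq> 0" by simp
    have ind: "?I (norm \<eta> * inverse t) * indicator {0..2} t = indicator {norm \<eta><..2 * norm \<eta>} t" for t :: real
    proof (cases "t > 0")
      case True
      then have "norm \<eta> * inverse t < 1 \<longleftrightarrow> norm \<eta> < t" "1/2 \<le> norm \<eta> * inverse t \<longleftrightarrow> t \<le> 2 * norm \<eta>"
        by (auto simp: field_simps)
      then show ?thesis using True \<eta> by (auto simp: indicator_def)
    next
      case False
      then show ?thesis using pos by (cases "t = 0") (auto simp: indicator_def)
    qed
    have "(LINT t|lborel. H (\<eta>, t)) = (LINT t|lborel. (indicator {norm \<eta><..2 * norm \<eta>} t *\<^sub>R
        complex_of_real (real ?n * inverse t ^ (?n + 1))) * (g \<eta> * radial_slope \<psi> \<eta>))"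
      by (simp only: H_def fst_conv snd_conv ind mult_scaleR_left)
    also have "\<dots> = of_real (inverse (norm \<eta>) ^ ?n * (1 - inverse 2 ^ ?n)) * (g \<eta> * radial_slope \<psi> \<eta>)"
      by (simp only: integral_mult_left_zero integral_inverse_power[OF pos zero_less_card_finite])
    finally have "(LINT t|lborel. H (\<eta>, t))
        = of_real (inverse (norm \<eta>) ^ ?n * (1 - inverse 2 ^ ?n)) * (g \<eta> * radial_slope \<psi> \<eta>)" .
    moreover have "h \<eta> = of_real (inverse (norm \<eta>) ^ ?n) * g \<eta>"
    proof -
      have "h \<eta> = h (norm \<eta> *\<^sub>R sgn \<eta>)" using \<eta>0 by (simp add: sgn_div_norm)
      also have "\<dots> = complex_of_real (norm \<eta>) powr (- of_nat ?n) * h (sgn \<eta>)"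
        using pos \<eta>0 by (intro pos_homogeneousD[OF h(2)]) (auto simp: sgn_zero_iff)
      finally show ?thesis using pos \<eta>0 by (simp add: g_def powr_minus powr_nat' power_inverse)
    qed
    ultimately show ?thesis by (simp add: mult_ac)
  qed
  have dyadic: "(LINT x|lborel. ?I (norm x) *\<^sub>R g x)
      = of_real (1 - inverse 2 ^ ?n) * (LINT x|lborel. indicator (ball 0 1 - {0}) x *\<^sub>R h (sgn x))"
  proof -
    have int: "integrable lborel (\<lambda>x. indicator (ball 0 r) x *\<^sub>R g x)" for r
      by (rule integrableI_bounded_set_indicator[where B = G, OF _ _ emeasure_bounded_finite[OF bounded_ball]])
         (use G in auto)
    have "(LINT x|lborel. indicator (ball 0 (1/2)) x *\<^sub>R g x) = of_real (\<bar>1/2\<bar> ^ DIM(real^'n)) *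
        (LINT x|lborel. indicator (ball 0 (1/2)) (0 + (1/2) *\<^sub>R x) *\<^sub>R g (0 + (1/2) *\<^sub>R x))"
    proof (rule lborel_integral_affine)
      show "(\<lambda>x. indicator (ball 0 (1/2)) x *\<^sub>R g x) \<in> borel_measurable borel"
        by (intro borel_measurable_scaleR borel_measurable_indicator g_meas) auto
    qed simp
    also have "(LINT x|lborel. indicator (ball 0 (1/2)) (0 + (1/2) *\<^sub>R x) *\<^sub>R g (0 + (1/2) *\<^sub>R x))
        = (LINT x|lborel. indicator (ball 0 1) x *\<^sub>R g x)"
      using gscale[of "1/2"] by (intro Bochner_Integration.integral_cong) (auto simp: indicator_def)
    finally have half: "(LINT x|lborel. indicator (ball 0 (1/2)) x *\<^sub>R g x)
        = of_real (inverse 2 ^ ?n) * (LINT x|lborel. indicator (ball 0 1) x *\<^sub>R g x)"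
      by (simp add: inverse_eq_divide)
    have "(LINT x|lborel. ?I (norm x) *\<^sub>R g x)
       = (LINT x|lborel. indicator (ball 0 1) x *\<^sub>R g x - indicator (ball 0 (1/2)) x *\<^sub>R g x)"
      by (intro Bochner_Integration.integral_cong) (auto simp: indicator_def)
    also have "\<dots> = of_real (1 - inverse 2 ^ ?n) * (LINT x|lborel. indicator (ball 0 1) x *\<^sub>R g x)"
      by (subst Bochner_Integration.integral_diff[OF int int]) (simp add: half left_diff_distrib)
    also have "(LINT x|lborel. indicator (ball 0 1) x *\<^sub>R g x)
        = (LINT x|lborel. indicator (ball 0 1 - {0}) x *\<^sub>R h (sgn x))"
      by (intro Bochner_Integration.integral_cong) (auto simp: indicator_def g_def)
    finally show ?thesis .
  qed
  let ?c = "complex_of_real (1 - inverse 2 ^ ?n)"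
  have "?c * (LINT \<xi>|lborel. radial_slope \<psi> \<xi> * h \<xi>) = (LINT \<eta>|lborel. LINT t|lborel. H (\<eta>, t))"
    unfolding radial by simp
  also have "\<dots> = (LINT x|lborel. LINT t|lborel. F (x, t))"
    unfolding swap2[symmetric] change[symmetric] by (rule swap1)
  also have "\<dots> = ?c * (LINT \<xi>|sphere_measure. h \<xi>)"
    unfolding shell dyadic integral_sphere_measure[OF conth] by simp
  finally have "?c * (LINT \<xi>|lborel. radial_slope \<psi> \<xi> * h \<xi>) = ?c * (LINT \<xi>|sphere_measure. h \<xi>)" .
  moreover have "?c \<noteq> 0"
  proof -
    have "inverse 2 ^ ?n < (1::real)" by (rule power_Suc_less_one[of _ "?n - 1", simplified]) auto
    then show ?thesis by (metis diff_gt_0_iff_gt less_irrefl of_real_eq_0_iff)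
  qed
  ultimately show ?thesis by simp
qed

section \<open>The residue is well defined\<close>

text \<open>Induction on the number of exponents: subtracting \<open>l\<^sup>b\<^sup>0\<close> times the function from its dilation by \<open>l\<close>
  removes the term with exponent \<open>b0\<close> and multiplies the others by factors that are nonzero for
  suitable \<open>l\<close>.\<close>
lemma powers_asymptotically_independent:
  fixes c :: "complex \<Rightarrow> complex"
  assumes "finite B" "\<And>b. b \<in> B \<Longrightarrow> Re b \<ge> 0"
    and "((\<lambda>t. \<Sum>b\<in>B. c b * complex_of_real t powr b) \<longlongrightarrow> 0) at_top"
  shows "\<forall>b\<in>B. c b = 0"
  using assms
proof (induction B arbitrary: c rule: finite_induct)
  case (insert b0 B)
  let ?G = "\<lambda>t. \<Sum>b\<in>insert b0 B. c b * complex_of_real t powr b"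
  obtain M where M: "M > 0" "\<And>b. b \<in> B \<Longrightarrow> norm (b - b0) \<le> M"
  proof -
    have "bounded ((\<lambda>b. b - b0) ` B)" using insert.hyps by (intro finite_imp_bounded) auto
    then show ?thesis using that unfolding bounded_pos by blast
  qed
  \<comment> \<open>With \<open>ln l = 1/M\<close> the imaginary parts of the \<open>b ln l\<close> differ by less than \<open>2 \<pi>\<close>, where exp is injective.\<close>
  define s where "s = 1 / M"
  define l where "l = exp s"
  have s: "s > 0" using M by (simp add: s_def)
  have l: "l > 0" by (simp add: l_def)
  have lb: "complex_of_real l powr b = exp (b * of_real s)" for b
    by (simp add: powr_def l_def flip: exp_of_real)
  have sep: "complex_of_real l powr b \<noteq> complex_of_real l powr b0" if "b \<in> B" for b
  proof
    assume eq: "complex_of_real l powr b = complex_of_real l powr b0"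
    have "\<bar>Im (b * of_real s) - Im (b0 * of_real s)\<bar> = \<bar>Im (b - b0)\<bar> * s"
      using s by (simp add: abs_mult left_diff_distrib[symmetric])
    also have "\<dots> \<le> M * s"
      using M(2)[OF that] abs_Im_le_cmod[of "b - b0"] s by (intro mult_right_mono) auto
    also have "\<dots> < 2 * pi" using M(1) pi_gt3 by (simp add: s_def)
    finally have im: "\<bar>Im (b * of_real s) - Im (b0 * of_real s)\<bar> < 2 * pi" .
    have "b * of_real s = b0 * of_real s"
      by (rule exp_complex_eqI[OF im eq[unfolded lb]])
    then have "b = b0" using s by simp
    then show False using that insert.hyps by blast
  qed
  have "filterlim (\<lambda>t. l * t) at_top at_top"
    using l by (intro filterlim_tendsto_pos_mult_at_top[OF tendsto_const] filterlim_ident) auto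
  from filterlim_compose[OF insert.prems(2) this]
  have "((\<lambda>t. ?G (l * t) - complex_of_real l powr b0 * ?G t) \<longlongrightarrow> 0 - complex_of_real l powr b0 * 0) at_top"
    by (intro tendsto_diff tendsto_mult tendsto_const insert.prems(2))
  then have "((\<lambda>t. ?G (l * t) - complex_of_real l powr b0 * ?G t) \<longlongrightarrow> 0) at_top"
    by (simp only: mult_zero_right diff_zero)
  moreover have "\<forall>\<^sub>F t in at_top. ?G (l * t) - complex_of_real l powr b0 * ?G t
      = (\<Sum>b\<in>B. (c b * (complex_of_real l powr b - complex_of_real l powr b0)) * complex_of_real t powr b)"
    using eventually_gt_at_top[of 0]
  proof eventually_elim
    case (elim t)
    have "complex_of_real (l * t) powr b = complex_of_real l powr b * complex_of_real t powr b" for b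
      using l elim by (simp add: powr_times_real)
    then show ?case using insert.hyps
      by (simp add: sum_distrib_left sum_subtractf algebra_simps)
  qed
  ultimately have "((\<lambda>t. \<Sum>b\<in>B. (c b * (complex_of_real l powr b - complex_of_real l powr b0)) * complex_of_real t powr b) \<longlongrightarrow> 0) at_top"
    by (rule Lim_transform_eventually)
  then have "\<forall>b\<in>B. c b * (complex_of_real l powr b - complex_of_real l powr b0) = 0"
    using insert.prems(1) by (intro insert.IH) auto
  then have cB: "\<forall>b\<in>B. c b = 0" using sep by auto
  have "((\<lambda>t. norm (?G t)) \<longlongrightarrow> 0) at_top" using tendsto_norm[OF insert.prems(2)] by simp
  moreover have "\<forall>\<^sub>F t in at_top. norm (c b0) \<le> norm (?G t)"
    using eventually_ge_at_top[of 1]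
  proof eventually_elim
    case (elim t)
    have "norm (c b0) * 1 \<le> norm (c b0) * t powr Re b0"
      using elim insert.prems(1)[of b0] by (intro mult_left_mono ge_one_powr_ge_zero) auto
    also have "\<dots> = norm (?G t)"
      using elim insert.hyps cB by (simp add: norm_mult norm_powr_real_powr)
    finally show ?case by simp
  qed
  ultimately have "norm (c b0) \<le> 0" by (rule tendsto_lowerbound) simp
  then show ?case using cB by simp
qed simp

text \<open>The growth of \<open>\<sigma>\<close> along rays up to \<open>o(t\<^sup>-\<^sup>n)\<close>. In contrast to a classical expansion this makes sense
  for sums of classical symbols of different orders.\<close>
definition leading_terms :: "(real^'n::finite \<Rightarrow> complex) \<Rightarrow> complex set \<Rightarrow> (complex \<Rightarrow> real^'n \<Rightarrow> complex) \<Rightarrow> bool"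
  where "leading_terms \<sigma> B c \<longleftrightarrow> finite B \<and> (\<forall>b\<in>B. Re b \<ge> - real CARD('n)) \<and> (\<forall>b. b \<notin> B \<longrightarrow> c b = (\<lambda>_. 0)) \<and>
    (\<forall>b. continuous_on (- {0}) (c b)) \<and>
    (\<forall>\<omega>. norm \<omega> = 1 \<longrightarrow> ((\<lambda>t. of_real t ^ CARD('n) * (\<sigma> (t *\<^sub>R \<omega>) - (\<Sum>b\<in>B. c b \<omega> * complex_of_real t powr b))) \<longlongrightarrow> 0) at_top)"

lemma leading_terms_extend:
  assumes "leading_terms \<sigma> B c" "finite B'" "B \<subseteq> B'" "\<And>b. b \<in> B' \<Longrightarrow> Re b \<ge> - real CARD('n)"
  shows "leading_terms (\<sigma> :: real^'n::finite \<Rightarrow> complex) B' c"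
proof -
  have "(\<Sum>b\<in>B'. c b \<omega> * complex_of_real t powr b) = (\<Sum>b\<in>B. c b \<omega> * complex_of_real t powr b)" for \<omega> t
    using assms by (intro sum.mono_neutral_right) (auto simp: leading_terms_def)
  then show ?thesis using assms unfolding leading_terms_def by auto
qed

lemma leading_terms_add:
  fixes \<sigma> \<tau> :: "real^'n::finite \<Rightarrow> complex"
  assumes "leading_terms \<sigma> B c" "leading_terms \<tau> B' c'"
  shows "leading_terms (\<lambda>\<xi>. \<sigma> \<xi> + \<tau> \<xi>) (B \<union> B') (\<lambda>b \<xi>. c b \<xi> + c' b \<xi>)"
proof -
  have B: "finite (B \<union> B')" "b \<in> B \<union> B' \<Longrightarrow> Re b \<ge> - real CARD('n)" for b
    using assms by (auto simp: leading_terms_def)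
  have l: "leading_terms \<sigma> (B \<union> B') c" "leading_terms \<tau> (B \<union> B') c'"
    using leading_terms_extend[OF assms(1) B(1) _ B(2)] leading_terms_extend[OF assms(2) B(1) _ B(2)] by auto
  have "((\<lambda>t. of_real t ^ CARD('n) * (\<sigma> (t *\<^sub>R \<omega>) + \<tau> (t *\<^sub>R \<omega>) - (\<Sum>b\<in>B \<union> B'. (c b \<omega> + c' b \<omega>) * complex_of_real t powr b))) \<longlongrightarrow> 0) at_top"
    if "norm \<omega> = 1" for \<omega>
  proof -
    have "((\<lambda>t. of_real t ^ CARD('n) * (\<sigma> (t *\<^sub>R \<omega>) - (\<Sum>b\<in>B \<union> B'. c b \<omega> * complex_of_real t powr b))
       + of_real t ^ CARD('n) * (\<tau> (t *\<^sub>R \<omega>) - (\<Sum>b\<in>B \<union> B'. c' b \<omega> * complex_of_real t powr b))) \<longlongrightarrow> 0 + 0) at_top"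
      using l that by (intro tendsto_add) (auto simp: leading_terms_def)
    then show ?thesis by (simp add: algebra_simps sum.distrib)
  qed
  then show ?thesis using l unfolding leading_terms_def by (auto intro!: continuous_intros)
qed

lemma leading_terms_cmult:
  fixes \<sigma> :: "real^'n::finite \<Rightarrow> complex"
  assumes "leading_terms \<sigma> B c"
  shows "leading_terms (\<lambda>\<xi>. k * \<sigma> \<xi>) B (\<lambda>b \<xi>. k * c b \<xi>)"
proof -
  have "((\<lambda>t. of_real t ^ CARD('n) * (k * \<sigma> (t *\<^sub>R \<omega>) - (\<Sum>b\<in>B. k * c b \<omega> * complex_of_real t powr b))) \<longlongrightarrow> 0) at_top"
    if "norm \<omega> = 1" for \<omega>
  proof -
    have "((\<lambda>t. k * (of_real t ^ CARD('n) * (\<sigma> (t *\<^sub>R \<omega>) - (\<Sum>b\<in>B. c b \<omega> * complex_of_real t powr b)))) \<longlongrightarrow> k * 0) at_top"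
      using assms that by (intro tendsto_mult tendsto_const) (auto simp: leading_terms_def)
    then show ?thesis by (simp add: algebra_simps sum_distrib_left)
  qed
  then show ?thesis using assms unfolding leading_terms_def by (auto intro!: continuous_intros)
qed

text \<open>After multiplication by \<open>t\<^sup>n\<close> all exponents of the difference have nonnegative real part.\<close>
lemma leading_terms_unique:
  fixes \<sigma> :: "real^'n::finite \<Rightarrow> complex"
  assumes "leading_terms \<sigma> B c" "leading_terms \<sigma> B' c'" "norm \<omega> = 1"
  shows "c b \<omega> = c' b \<omega>"
proof -
  let ?n = "of_nat CARD('n) :: complex"
  have l: "leading_terms (\<lambda>\<xi>. \<sigma> \<xi> + (- 1) * \<sigma> \<xi>) (B \<union> B') (\<lambda>b \<xi>. c b \<xi> + (- 1) * c' b \<xi>)"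
    by (intro leading_terms_add leading_terms_cmult assms)
  define d where "d z = c (z - ?n) \<omega> - c' (z - ?n) \<omega>" for z
  let ?S = "(\<lambda>b. b + ?n) ` (B \<union> B')"
  have "((\<lambda>t. of_real t ^ CARD('n) * (0 - (\<Sum>b\<in>B \<union> B'. (c b \<omega> - c' b \<omega>) * complex_of_real t powr b))) \<longlongrightarrow> 0) at_top"
    using l assms(3) by (simp add: leading_terms_def)
  then have "((\<lambda>t. - (of_real t ^ CARD('n) * (0 - (\<Sum>b\<in>B \<union> B'. (c b \<omega> - c' b \<omega>) * complex_of_real t powr b)))) \<longlongrightarrow> - 0) at_top"
    by (rule tendsto_minus)
  then have "((\<lambda>t. - (of_real t ^ CARD('n) * (0 - (\<Sum>b\<in>B \<union> B'. (c b \<omega> - c' b \<omega>) * complex_of_real t powr b)))) \<longlongrightarrow> 0) at_top"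
    by (simp only: minus_zero)
  moreover have "\<forall>\<^sub>F t in at_top. - (of_real t ^ CARD('n) * (0 - (\<Sum>b\<in>B \<union> B'. (c b \<omega> - c' b \<omega>) * complex_of_real t powr b)))
      = (\<Sum>z\<in>?S. d z * complex_of_real t powr z)"
    using eventually_gt_at_top[of 0]
  proof eventually_elim
    case (elim t)
    have "(\<Sum>z\<in>?S. d z * complex_of_real t powr z)
        = (\<Sum>b\<in>B \<union> B'. (c b \<omega> - c' b \<omega>) * complex_of_real t powr (b + ?n))"
      by (subst sum.reindex) (auto simp: d_def inj_on_def)
    also have "\<dots> = of_real t ^ CARD('n) * (\<Sum>b\<in>B \<union> B'. (c b \<omega> - c' b \<omega>) * complex_of_real t powr b)"
      unfolding sum_distrib_left using elim
      by (intro sum.cong) (auto simp: powr_add powr_nat')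
    finally show ?case by simp
  qed
  ultimately have "((\<lambda>t. \<Sum>z\<in>?S. d z * complex_of_real t powr z) \<longlongrightarrow> 0) at_top"
    by (rule Lim_transform_eventually)
  moreover have "finite (B \<union> B')" "b \<in> B \<union> B' \<Longrightarrow> Re b \<ge> - real CARD('n)" for b
    using l by (auto simp: leading_terms_def)
  then have "finite ?S" "z \<in> ?S \<Longrightarrow> Re z \<ge> 0" for z by force+
  ultimately have z: "\<forall>z\<in>?S. d z = 0"
    by (intro powers_asymptotically_independent)
  show ?thesis
  proof (cases "b \<in> B \<union> B'")
    case True
    then have "d (b + ?n) = 0" using z by blast
    then show ?thesis by (simp add: d_def)
  next
    case False
    then show ?thesis using assms by (simp add: leading_terms_def)
  qed
qed

lemma component_eq: "component a h (a - of_nat j) = h j"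
proof -
  have "(THE i. a - of_nat i = a - of_nat j) = j" by (rule the_equality) auto
  then show ?thesis unfolding component_def by auto
qed

lemma component_other: "(\<And>j. a - of_nat j \<noteq> b) \<Longrightarrow> component a h b = (\<lambda>_. 0)"
  unfolding component_def by auto

lemma ex_lower_order: "\<exists>N. Re a - real N < x"
proof -
  obtain N where "Re a - x < real N" using reals_Archimedean2 by blast
  then show ?thesis by (intro exI[of _ N]) simp
qed

lemma leading_terms_classical:
  fixes \<sigma> :: "real^'n::{finite,linorder} \<Rightarrow> complex"
  assumes e: "classical_expansion a h \<sigma>"
  shows "\<exists>B c. leading_terms \<sigma> B c \<and> c (- of_nat CARD('n)) = component a h (- of_nat CARD('n))"
proof -
  let ?n = "CARD('n)"
  note h = classical_expansionD[OF e]
  obtain \<psi> :: "real^'n::{finite,linorder} \<Rightarrow> real" where \<psi>: "cutoff \<psi>"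
    using e unfolding classical_expansion_def by blast
  \<comment> \<open>The components of index below N are exactly those of critical growth or more.\<close>
  define N where "N = (LEAST N. Re a - real N < - real ?n)"
  have N: "Re a - real N < - real ?n" unfolding N_def by (rule LeastI_ex[OF ex_lower_order])
  have N': "Re a - real j \<ge> - real ?n" if "j < N" for j
    using not_less_Least[of j] that unfolding N_def by force
  define B where "B = (\<lambda>j. a - of_nat j) ` {..<N}"
  define c where "c b = (if b \<in> B then component a h b else (\<lambda>_. 0))" for b
  have cj: "c (a - of_nat j) = h j" if "j < N" for j
    using that by (auto simp: c_def B_def component_eq)
  have crit: "c (- of_nat ?n) = component a h (- of_nat ?n)"
  proof (cases "\<exists>j. a - of_nat j = - of_nat ?n")
    case True
    then obtain j where j: "a - of_nat j = - of_nat ?n" by blast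
    have "Re (a - of_nat j) = - real ?n" unfolding j by simp
    then have "Re a - real j = - real ?n" by simp
    then have "j < N" using N by linarith
    then show ?thesis using cj[of j] component_eq[of a h j] unfolding j by simp
  next
    case False
    then have "component a h (- of_nat ?n) = (\<lambda>_. 0)" by (intro component_other) auto
    moreover have "- of_nat ?n \<notin> B" using False by (force simp: B_def)
    ultimately show ?thesis by (simp add: c_def)
  qed
  have "leading_terms \<sigma> B c"
    unfolding leading_terms_def
  proof (intro conjI ballI allI impI)
    show "finite B" by (simp add: B_def)
    show "Re b \<ge> - real ?n" if "b \<in> B" for b using that N' by (auto simp: B_def)
    show "c b = (\<lambda>_. 0)" if "b \<notin> B" for b using that by (simp add: c_def)
    show "continuous_on (- {0}) (c b)" for b
    proof (cases "b \<in> B")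
      case True
      then obtain j where "j < N" "b = a - of_nat j" by (auto simp: B_def)
      then show ?thesis using cj smooth_on_continuous[OF h(1)] by simp
    qed (simp add: c_def)
    fix \<omega> :: "real^'n::{finite,linorder}" assume \<omega>: "norm \<omega> = 1"
    define r where "r \<xi> = \<sigma> \<xi> - (\<Sum>j<N. of_real (\<psi> \<xi>) * h j \<xi>)" for \<xi>
    have "r \<in> symbols (a - of_nat N)" unfolding r_def[abs_def] by (rule h(3)[OF \<psi>])
    then obtain C where C: "C \<ge> 0" "\<And>\<xi>. norm (r \<xi>) \<le> C * (1 + norm \<xi>) powr (Re a - real N)"
      using symbols_bound[of r "a - of_nat N" "[]"] by auto
    have "((\<lambda>t. C * t powr (real ?n + (Re a - real N))) \<longlongrightarrow> C * 0) at_top"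
      using N by (intro tendsto_mult tendsto_const tendsto_neg_powr filterlim_ident) auto
    then have "((\<lambda>t. C * t powr (real ?n + (Re a - real N))) \<longlongrightarrow> 0) at_top" by simp
    moreover have "\<forall>\<^sub>F t in at_top. norm (of_real t ^ ?n * (\<sigma> (t *\<^sub>R \<omega>) - (\<Sum>b\<in>B. c b \<omega> * complex_of_real t powr b)))
        \<le> C * t powr (real ?n + (Re a - real N))"
      using eventually_ge_at_top[of 1]
    proof eventually_elim
      case (elim t)
      have \<omega>0: "\<omega> \<noteq> 0" using \<omega> by auto
      have "(\<Sum>b\<in>B. c b \<omega> * complex_of_real t powr b) = (\<Sum>j<N. h j \<omega> * complex_of_real t powr (a - of_nat j))"
        unfolding B_def by (subst sum.reindex) (auto simp: inj_on_def cj intro!: sum.cong)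
      also have "\<dots> = (\<Sum>j<N. of_real (\<psi> (t *\<^sub>R \<omega>)) * h j (t *\<^sub>R \<omega>))"
        using elim \<omega> \<omega>0 cutoff_eq_1[OF \<psi>, of "t *\<^sub>R \<omega>"] by (simp add: pos_homogeneousD[OF h(2)] mult.commute)
      finally have "\<sigma> (t *\<^sub>R \<omega>) - (\<Sum>b\<in>B. c b \<omega> * complex_of_real t powr b) = r (t *\<^sub>R \<omega>)"
        by (simp add: r_def)
      moreover have "norm (r (t *\<^sub>R \<omega>)) \<le> C * t powr (Re a - real N)"
      proof -
        have "norm (r (t *\<^sub>R \<omega>)) \<le> C * (1 + t) powr (Re a - real N)"
          using C(2)[of "t *\<^sub>R \<omega>"] \<omega> elim by simp
        also have "\<dots> \<le> C * t powr (Re a - real N)"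
          using elim N C(1) by (intro mult_left_mono powr_mono2') auto
        finally show ?thesis .
      qed
      then have "t ^ ?n * norm (r (t *\<^sub>R \<omega>)) \<le> t ^ ?n * (C * t powr (Re a - real N))"
        using elim by (intro mult_left_mono) auto
      moreover have "t ^ ?n * (C * t powr (Re a - real N)) = C * t powr (real ?n + (Re a - real N))"
        using elim by (subst powr_add) (simp add: powr_realpow)
      ultimately show ?case using elim by (simp add: norm_mult norm_power)
    qed
    ultimately show "((\<lambda>t. of_real t ^ ?n * (\<sigma> (t *\<^sub>R \<omega>) - (\<Sum>b\<in>B. c b \<omega> * complex_of_real t powr b))) \<longlongrightarrow> 0) at_top"
      by (rule Lim_null_comparison[rotated])
  qed
  then show ?thesis using crit by blast
qed

lemma integrable_angular:
  fixes f :: "real^'n::finite \<Rightarrow> complex"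
  assumes f: "continuous_on (- {0}) f"
  shows "integrable lborel (\<lambda>x. indicator (ball 0 1 - {0}) x *\<^sub>R f (sgn x))"
proof -
  have "compact (f ` sphere 0 1)"
    by (intro compact_continuous_image continuous_on_subset[OF f]) auto
  from compact_imp_bounded[OF this] obtain B where B: "\<forall>y\<in>f ` sphere 0 1. norm y \<le> B"
    unfolding bounded_iff by blast
  have "continuous_on (- {0}) (\<lambda>x. f (sgn x))"
    by (intro continuous_on_compose2[OF f] continuous_intros) (auto simp: sgn_zero_iff)
  then have [measurable]: "(\<lambda>x. indicator (- {0}) x *\<^sub>R f (sgn x)) \<in> borel_measurable borel"
    by (rule borel_measurable_continuous_on_indicator[rotated]) auto
  have fin: "emeasure lborel (ball (0::real^'n) 1) < \<infinity>" by (rule emeasure_bounded_finite) auto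
  have bd: "norm (indicator (- {0}) x *\<^sub>R f (sgn x)) \<le> max 0 B" for x
  proof (cases "x = 0")
    case False
    then have "sgn x \<in> sphere 0 1" by (simp add: norm_sgn)
    then have "norm (f (sgn x)) \<le> B" using B by blast
    then show ?thesis using False by simp
  qed simp
  have "integrable lborel (\<lambda>x. indicator (ball 0 1) x *\<^sub>R (indicator (- {0}) x *\<^sub>R f (sgn x)))"
    by (rule integrableI_bounded_set_indicator[where B = "max 0 B", OF _ _ fin]) (use bd in auto)
  moreover have "(\<lambda>x. indicator (ball 0 1) x *\<^sub>R (indicator (- {0}) x *\<^sub>R f (sgn x))) = (\<lambda>x. indicator (ball 0 1 - {0}) x *\<^sub>R f (sgn x))"
    by (auto simp: indicator_def)
  ultimately show ?thesis by simp
qed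

lemma integral_sphere_add:
  fixes f g :: "real^'n::finite \<Rightarrow> complex"
  assumes "continuous_on (- {0}) f" "continuous_on (- {0}) g"
  shows "(LINT \<xi>|sphere_measure. f \<xi> + g \<xi>) = (LINT \<xi>|sphere_measure. f \<xi>) + (LINT \<xi>|sphere_measure. g \<xi>)"
proof -
  have "continuous_on (- {0}) (\<lambda>\<xi>. f \<xi> + g \<xi>)" using assms by (intro continuous_intros)
  then show ?thesis
    using Bochner_Integration.integral_add[OF integrable_angular[OF assms(1)] integrable_angular[OF assms(2)]]
    by (simp add: integral_sphere_measure assms scaleR_add_right distrib_left)
qed

lemma space_sphere_measure: "space (sphere_measure :: (real^'n::finite) measure) = sphere 0 1"
  by (simp add: sphere_measure_def space_scale_measure space_restrict_space)

lemma has_residue_leading_terms: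
  fixes \<sigma> :: "real^'n::{finite,linorder} \<Rightarrow> complex"
  assumes "has_residue \<sigma> r"
  shows "\<exists>B c. leading_terms \<sigma> B c \<and>
    r = complex_of_real ((2 * pi) powr (- real CARD('n) / 2)) * (LINT \<xi>|sphere_measure. c (- of_nat CARD('n)) \<xi>)"
  using assms
proof induction
  case (has_residue_classical \<sigma> a h)
  obtain B c where "leading_terms \<sigma> B c" "c (- of_nat CARD('n)) = component a h (- of_nat CARD('n))"
    using leading_terms_classical[OF has_residue_classical(2)] by blast
  then show ?case by (intro exI[of _ B] exI[of _ c]) simp
next
  case (has_residue_add \<sigma> r \<tau> s)
  then obtain B c B' c' where l: "leading_terms \<sigma> B c" "leading_terms \<tau> B' c'"
    and rs: "r = complex_of_real ((2 * pi) powr (- real CARD('n) / 2)) * (LINT \<xi>|sphere_measure. c (- of_nat CARD('n)) \<xi>)"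
      "s = complex_of_real ((2 * pi) powr (- real CARD('n) / 2)) * (LINT \<xi>|sphere_measure. c' (- of_nat CARD('n)) \<xi>)"
    by blast
  have "continuous_on (- {0}) (c (- of_nat CARD('n)))" "continuous_on (- {0}) (c' (- of_nat CARD('n)))"
    using l by (auto simp: leading_terms_def)
  from integral_sphere_add[OF this] show ?case
    by (intro exI[of _ "B \<union> B'"] exI[of _ "\<lambda>b \<xi>. c b \<xi> + c' b \<xi>"])
       (simp add: leading_terms_add[OF l] rs distrib_left)
next
  case (has_residue_scale \<sigma> r k)
  then obtain B c where l: "leading_terms \<sigma> B c"
    and r: "r = complex_of_real ((2 * pi) powr (- real CARD('n) / 2)) * (LINT \<xi>|sphere_measure. c (- of_nat CARD('n)) \<xi>)"
    by blast
  show ?case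
    by (rule exI[of _ B], rule exI[of _ "\<lambda>b \<xi>. k * c b \<xi>"])
       (simp add: leading_terms_cmult[OF l] r)
qed

text \<open>The residue is the spherical integral of a coefficient that depends on the function only.\<close>
lemma has_residue_unique:
  fixes \<sigma> :: "real^'n::{finite,linorder} \<Rightarrow> complex"
  assumes "has_residue \<sigma> r" "has_residue \<sigma> s"
  shows "r = s"
proof -
  let ?K = "complex_of_real ((2 * pi) powr (- real CARD('n) / 2))" and ?n = "- of_nat CARD('n) :: complex"
  obtain B c where c: "leading_terms \<sigma> B c" "r = ?K * (LINT \<xi>|sphere_measure. c ?n \<xi>)"
    using has_residue_leading_terms[OF assms(1)] by blast
  obtain B' c' where c': "leading_terms \<sigma> B' c'" "s = ?K * (LINT \<xi>|sphere_measure. c' ?n \<xi>)"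
    using has_residue_leading_terms[OF assms(2)] by blast
  have "(LINT \<xi>|sphere_measure. c ?n \<xi>) = (LINT \<xi>|sphere_measure. c' ?n \<xi>)"
    by (intro Bochner_Integration.integral_cong) (auto simp: space_sphere_measure leading_terms_unique[OF c(1) c'(1)])
  then show ?thesis using c c' by simp
qed

lemma has_residue_exists: "\<sigma> \<in> CS \<Longrightarrow> \<exists>r. has_residue \<sigma> r"
proof (induction rule: CS_sum_induct)
  case (classical \<sigma> a)
  obtain h where "classical_expansion a h \<sigma>" using CS_orderE[OF classical] .
  then show ?case using has_residue_classical[OF classical] by blast
next
  case (add \<sigma> \<tau>)
  then show ?case using has_residue_add by blast
qed

lemma has_residue_res: "\<sigma> \<in> CS \<Longrightarrow> has_residue \<sigma> (res \<sigma>)"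
  unfolding res_def by (rule theI', rule ex_ex1I) (auto intro: has_residue_exists has_residue_unique)

lemma has_residue_CS: "has_residue \<sigma> r \<Longrightarrow> \<sigma> \<in> CS"
  by (induction rule: has_residue.induct) (auto intro: CS.intros)

section \<open>Uniqueness of the residue\<close>

context closed_singular_form
begin

lemma bump_mass: "(LINT y|lborel. (1 - complex_of_real (\<psi> y)) ^ 2) \<noteq> 0"
  and test_function_bump: "test_function (\<lambda>\<xi>. (1 - complex_of_real (\<psi> \<xi>)) ^ 2)"
proof -
  show t: "test_function (\<lambda>\<xi>. (1 - complex_of_real (\<psi> \<xi>)) ^ 2)"
  proof (rule test_functionI[where R = 1])
    show "smooth_on UNIV (\<lambda>\<xi>. (1 - complex_of_real (\<psi> \<xi>)) ^ 2)"
      unfolding power2_eq_square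
      by (intro smooth_on_mult smooth_on_diff smooth_on_const cutoff_smooth[OF cutoff]) auto
  qed (simp add: cutoff_eq_1[OF cutoff])
  have real: "(\<lambda>\<xi>. (1 - complex_of_real (\<psi> \<xi>)) ^ 2) = (\<lambda>\<xi>. complex_of_real ((1 - \<psi> \<xi>) ^ 2))"
    by simp
  have "integrable lborel (\<lambda>\<xi>. (1 - complex_of_real (\<psi> \<xi>)) ^ 2)"
    by (rule test_function_integrable[OF t])
  then have int: "integrable lborel (\<lambda>\<xi>. (1 - \<psi> \<xi>) ^ 2)"
    unfolding real complex_of_real_integrable_eq .
  obtain U where U: "open U" "0 \<in> U" "\<And>\<xi>. \<xi> \<in> U \<Longrightarrow> \<psi> \<xi> = 0"
    using cutoff_nbhd[OF cutoff] by blast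
  obtain d where d: "d > 0" "ball 0 d \<subseteq> U" using U(1,2) open_contains_ball by blast
  have fin: "emeasure lborel (ball (0::real^'n::{finite,linorder}) d) < \<infinity>" by (rule emeasure_bounded_finite) auto
  have "0 < measure lborel (ball (0::real^'n::{finite,linorder}) d)" using d by (simp add: content_ball_pos)
  also have "\<dots> = (LINT y|lborel. indicator (ball (0::real^'n::{finite,linorder}) d) y)" by simp
  also have "\<dots> \<le> (LINT y|lborel. (1 - \<psi> y) ^ 2)"
    using int fin d U(3) by (intro integral_mono integrable_real_indicator) (auto simp: indicator_def)
  finally have "(LINT y|lborel. (1 - \<psi> y) ^ 2) \<noteq> 0" by simp
  moreover have "(LINT y|lborel. (1 - complex_of_real (\<psi> y)) ^ 2) = complex_of_real (LINT y|lborel. (1 - \<psi> y) ^ 2)"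
    unfolding real by (rule integral_complex_of_real)
  ultimately show "(LINT y|lborel. (1 - complex_of_real (\<psi> y)) ^ 2) \<noteq> 0" by simp
qed

text \<open>The functional induced on test functions is a multiple of the integral; the factor is read off from the
  test function \<open>(1 - \<psi>)\<^sup>2\<close>, whose integral is positive.\<close>
lemma \<rho>_critical_component:
  assumes n: "CARD('n) \<ge> 2"
  shows "\<exists>c. \<forall>h. smooth_on (- {0}) h \<and> pos_homogeneous (- of_nat CARD('n)) h \<longrightarrow>
    \<rho> (\<lambda>\<xi>. of_real (\<psi> \<xi>) * h \<xi>) = c * (LINT \<xi>|sphere_measure. h \<xi>)"
proof -
  let ?\<theta> = "\<lambda>\<xi>. (1 - complex_of_real (\<psi> \<xi>)) ^ 2"
  let ?c = "ray_form ?\<theta> / (LINT y|lborel. ?\<theta> y)"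
  have "\<rho> (\<lambda>\<xi>. of_real (\<psi> \<xi>) * h \<xi>) = ?c * (LINT \<xi>|sphere_measure. h \<xi>)"
    if h: "smooth_on (- {0}) h" "pos_homogeneous (- of_nat CARD('n)) h" for h
  proof -
    let ?q = "\<lambda>\<xi>. radial_slope \<psi> \<xi> * h \<xi>"
    have q: "test_function ?q"
      by (rule test_functionI[OF smooth_on_radial_slope_mult[OF cutoff h(1)], of 1])
         (simp add: radial_slope_outside[OF cutoff])
    have "of_real (\<psi> \<xi>) * ray_integral CARD('n) ?q \<xi> = of_real (\<psi> \<xi>) * h \<xi>" for \<xi>
      using ray_integral_radial_slope[OF cutoff h, of \<xi>] by (cases "\<xi> = 0") (simp_all add: cutoff_at_0)
    then have "\<rho> (\<lambda>\<xi>. of_real (\<psi> \<xi>) * h \<xi>) = ray_form ?q" unfolding ray_form_def by (simp only:)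
    moreover have "(LINT y|lborel. ?\<theta> y) * ray_form ?q = (LINT y|lborel. ?q y) * ray_form ?\<theta>"
      by (rule closed_functional_proportional_to_integral[OF ray_form_add ray_form_cmult ray_form_pderiv[OF _ n] q test_function_bump])
    ultimately show ?thesis
      using bump_mass integral_radial_slope[OF cutoff h] by (simp add: field_simps)
  qed
  then show ?thesis by blast
qed

lemma \<rho>_proportional_to_residue:
  assumes n: "CARD('n) \<ge> 2"
  shows "\<exists>c. \<forall>\<sigma> r. has_residue \<sigma> r \<longrightarrow> \<rho> \<sigma> = c * r"
proof -
  let ?n = "CARD('n)"
  let ?K = "complex_of_real ((2 * pi) powr (- real ?n / 2))"
  have K: "?K \<noteq> 0" by simp
  obtain c where c: "\<And>h. smooth_on (- {0}) h \<Longrightarrow> pos_homogeneous (- of_nat ?n) h \<Longrightarrow>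
      \<rho> (\<lambda>\<xi>. of_real (\<psi> \<xi>) * h \<xi>) = c * (LINT \<xi>|sphere_measure. h \<xi>)"
    using \<rho>_critical_component[OF n] by blast
  have classical: "\<rho> \<sigma> = c * (LINT \<xi>|sphere_measure. component a h (- of_nat ?n) \<xi>)"
    if e: "classical_expansion a h \<sigma>" for \<sigma> a h
  proof -
    note h = classical_expansionD[OF e]
    obtain N where "Re a - real N < - real ?n - 1" using ex_lower_order by blast
    then have N: "Re (a - of_nat N) + real ?n + 1 < 0" by simp
    \<comment> \<open>The order of this remainder is low enough for it to be killed.\<close>
    let ?r = "\<lambda>\<xi>. \<sigma> \<xi> - (\<Sum>j<N. of_real (\<psi> \<xi>) * h j \<xi>)"
    have r: "?r \<in> CS_order (a - of_nat N)" by (rule classical_remainder[OF e cutoff])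
    have g: "(\<lambda>\<xi>. of_real (\<psi> \<xi>) * h j \<xi>) \<in> CS" for j
      by (rule CS_base[OF cutoff_homogeneous_CS_order(2)[OF cutoff h(1,2)]])
    have "\<rho> \<sigma> = \<rho> (\<lambda>\<xi>. ?r \<xi> + (\<Sum>j<N. of_real (\<psi> \<xi>) * h j \<xi>))" by simp
    also have "\<dots> = \<rho> ?r + \<rho> (\<lambda>\<xi>. \<Sum>j<N. of_real (\<psi> \<xi>) * h j \<xi>)"
      by (rule \<rho>_add[OF CS_base[OF r] CS_sum[OF zero_in_CS g]])
    also have "\<rho> (\<lambda>\<xi>. \<Sum>j<N. of_real (\<psi> \<xi>) * h j \<xi>) = (\<Sum>j<N. \<rho> (\<lambda>\<xi>. of_real (\<psi> \<xi>) * h j \<xi>))"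
      by (rule \<rho>_sum[OF g])
    also have "\<rho> ?r = 0" by (rule \<rho>_low_order[OF r N])
    finally have sum: "\<rho> \<sigma> = (\<Sum>j<N. \<rho> (\<lambda>\<xi>. of_real (\<psi> \<xi>) * h j \<xi>))" by simp
    show ?thesis
    proof (cases "\<exists>j. a - of_nat j = - of_nat ?n")
      case True
      then obtain i where i: "a - of_nat i = - of_nat ?n" by blast
      have iN: "i < N"
      proof -
        have "Re (a - of_nat i) = - real ?n" unfolding i by simp
        then show ?thesis using N by simp
      qed
      have "\<rho> (\<lambda>\<xi>. of_real (\<psi> \<xi>) * h j \<xi>) = 0" if "j \<noteq> i" for j
        using that i by (intro \<rho>_noncritical_component[OF h(1,2)]) (simp flip: i)
      then have "\<rho> \<sigma> = (\<Sum>j<N. if j = i then \<rho> (\<lambda>\<xi>. of_real (\<psi> \<xi>) * h i \<xi>) else 0)"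
        unfolding sum by (intro sum.cong) auto
      also have "\<dots> = c * (LINT \<xi>|sphere_measure. h i \<xi>)"
        using iN c[OF h(1), of i] h(2)[of i] i by simp
      finally show ?thesis using component_eq[of a h i] i by simp
    next
      case False
      then have "\<rho> \<sigma> = 0" unfolding sum
        by (intro sum.neutral ballI \<rho>_noncritical_component[OF h(1,2)]) auto
      then show ?thesis using component_other[of a "- of_nat ?n" h] False by auto
    qed
  qed
  have "\<rho> \<sigma> = c / ?K * r" if "has_residue \<sigma> r" for \<sigma> r
    using that
  proof induction
    case (has_residue_classical \<sigma> a h)
    then show ?case using classical[of a h \<sigma>] K by simp
  next
    case (has_residue_add \<sigma> r \<tau> s)
    then show ?case using \<rho>_add[OF has_residue_CS has_residue_CS] by (simp add: distrib_left)
  next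
    case (has_residue_scale \<sigma> r k)
    then show ?case using \<rho>_cmult[OF has_residue_CS] by simp
  qed
  then show ?thesis by blast
qed

end

lemma closed_singular_proportional_to_res:
  fixes \<rho> :: "(real^'n::{finite,linorder} \<Rightarrow> complex) \<Rightarrow> complex"
  assumes "CARD('n) \<ge> 2" "linear_form \<rho>" "singular_form \<rho>" "stokes \<rho>"
  shows "\<exists>c. \<forall>\<sigma>\<in>CS. \<rho> \<sigma> = c * res \<sigma>"
  \<comment> \<open>Every classical expansion provides a cutoff; without one there are no symbols.\<close>
proof (cases "\<exists>\<psi> :: real^'n::{finite,linorder} \<Rightarrow> real. cutoff \<psi>")
  case True
  then obtain \<psi> :: "real^'n::{finite,linorder} \<Rightarrow> real" where "cutoff \<psi>" by blast
  then interpret closed_singular_form \<rho> \<psi> using assms by unfold_locales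
  show ?thesis using \<rho>_proportional_to_residue[OF assms(1)] has_residue_res by blast
next
  case False
  have "\<exists>\<psi> :: real^'n::{finite,linorder} \<Rightarrow> real. cutoff \<psi>" if "\<sigma> \<in> CS" for \<sigma> :: "real^'n::{finite,linorder} \<Rightarrow> complex"
    using that
  proof (induction rule: CS_sum_induct)
    case (classical \<sigma> a)
    obtain \<psi> :: "real^'n::{finite,linorder} \<Rightarrow> real" where "cutoff \<psi>" by (rule CS_order_cutoff[OF classical])
    then show ?case by blast
  qed blast
  then show ?thesis using False by blast
qed

text \<open>The form \<open>\<tau> d\<xi>\<^sub>I\<close> with \<open>I\<close> the complement of \<open>{j}\<close> has the differential \<open>\<plusminus> \<partial>\<^sub>j \<tau> d\<xi>\<^sub>1 \<and> \<dots> \<and> d\<xi>\<^sub>n\<close>; the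
  sign \<open>e\<close> is built into the form.\<close>
lemma stokes_if_closed_on_forms:
  fixes \<rho> :: "(real^'n::{finite,linorder} \<Rightarrow> complex) \<Rightarrow> complex"
  assumes closed: "closed_on_forms (extend_to_forms \<rho>)"
  shows "stokes \<rho>"
  unfolding stokes_def
proof (intro allI ballI)
  fix j :: 'n and \<tau> :: "real^'n::{finite,linorder} \<Rightarrow> complex" assume \<tau>: "\<tau> \<in> CS"
  define e :: complex where "e = (-1) ^ card {i\<in>UNIV. i < j}"
  define \<beta> :: "'n form" where "\<beta> I = (if I = UNIV - {j} then (\<lambda>\<xi>. e * \<tau> \<xi>) else (\<lambda>_. 0))" for I
  have ee: "e * e = 1" by (simp add: e_def flip: power_add mult_2 power_mult)
  have "\<beta> \<in> symbol_forms"
    using CS_scale[OF \<tau>, of 0] CS_scale[OF \<tau>, of e] by (auto simp: symbol_forms_def \<beta>_def)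
  then have "\<rho> (ext_deriv \<beta> UNIV) = 0"
    using closed by (simp add: closed_on_forms_def extend_to_forms_def)
  moreover have "ext_deriv \<beta> UNIV \<xi> = pderiv_at j \<tau> \<xi>" for \<xi>
  proof -
    have "(-1) ^ card {k\<in>UNIV. k < i} * pderiv_at i (\<beta> (UNIV - {i})) \<xi> = (if i = j then pderiv_at j \<tau> \<xi> else 0)" for i
    proof (cases "i = j")
      case True
      have "pderiv_at j (\<lambda>\<xi>. e * \<tau> \<xi>) \<xi> = e * pderiv_at j \<tau> \<xi>"
        by (rule pderiv_at_cmult[OF smooth_on_differentiable[OF CS_smooth[OF \<tau>] UNIV_I]])
      then show ?thesis using True ee by (simp add: \<beta>_def e_def mult.assoc[symmetric])
    next
      case False
      then have "UNIV - {i} \<noteq> UNIV - {j}" by blast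
      then show ?thesis using False by (simp add: \<beta>_def)
    qed
    then show ?thesis unfolding ext_deriv_def by simp
  qed
  ultimately show "\<rho> (pderiv_at j \<tau>) = 0" by (metis ext)
qed

theorem theorem1:
  assumes "CARD('n::{finite,linorder}) \<ge> 2"
  shows
    "(\<forall>\<rho> :: (real^'n::{finite,linorder} \<Rightarrow> complex) \<Rightarrow> complex.
        linear_form \<rho> \<and> singular_form \<rho> \<and> stokes \<rho> \<longrightarrow>
        (\<exists>c. \<forall>\<sigma>\<in>CS. \<rho> \<sigma> = c * res \<sigma>)) \<and>
     (\<forall>\<rho> :: (real^'n::{finite,linorder} \<Rightarrow> complex) \<Rightarrow> complex.
        linear_form \<rho> \<and> singular_form \<rho> \<and> closed_on_forms (extend_to_forms \<rho>) \<longrightarrow>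
        (\<exists>c. \<forall>\<beta>\<in>symbol_forms. extend_to_forms \<rho> \<beta> = c * extend_to_forms res \<beta>))"
proof (intro conjI allI impI)
  fix \<rho> :: "(real^'n::{finite,linorder} \<Rightarrow> complex) \<Rightarrow> complex"
  assume "linear_form \<rho> \<and> singular_form \<rho> \<and> stokes \<rho>"
  then show "\<exists>c. \<forall>\<sigma>\<in>CS. \<rho> \<sigma> = c * res \<sigma>"
    using closed_singular_proportional_to_res[OF assms] by blast
next
  fix \<rho> :: "(real^'n::{finite,linorder} \<Rightarrow> complex) \<Rightarrow> complex"
  assume "linear_form \<rho> \<and> singular_form \<rho> \<and> closed_on_forms (extend_to_forms \<rho>)"
  then obtain c where "\<forall>\<sigma>\<in>CS. \<rho> \<sigma> = c * res \<sigma>"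
    using closed_singular_proportional_to_res[OF assms] stokes_if_closed_on_forms by blast
  then show "\<exists>c. \<forall>\<beta>\<in>symbol_forms. extend_to_forms \<rho> \<beta> = c * extend_to_forms res \<beta>"
    by (auto simp: symbol_forms_def extend_to_forms_def)
qed

end
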